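(* Let $f:M\to M$ be a Lipschitz continuous transitive hyperbolic homeomorphism of a compact metric space $(M,d)$, let $A,B:M\to GL(d,\mathbb{R})$ be two $\nu$-H\"older continuous maps and let $\alpha\in\mathrm{Aut}(GL(d,\mathbb{R}))$. Suppose that the $\alpha$-twisted cocycles $A_\alpha$ and $B_\alpha$ generated by $A$ and $B$ over $f$ are both fiber-bunched and that, moreover, at least one of $A$, $B$ satisfies conditions (i), (ii), (iii) in the definition of fiber-bunching (recalled in the context) for some constants $C>0$ and $\rho,\theta>0$ with $7\rho+2\theta<\nu\lambda$. Then there exists a $\nu$-H\"older continuous map $Q:M\to GL(d,\mathbb{R})$ such that $$A^n_\alpha(p)=Q(p)\,B^n_\alpha(p)\,\alpha^n(Q(p))^{-1}\quad\text{for every } n\in\mathbb{Z} \text{ and } p\in\mathrm{Fix}(f^n)$$ if and only if there exists a $\nu$-H\"older continuous map $P:M\to GL(d,\mathbb{R})$ such that $$A^n_\alpha(x)=P(f^n(x))\,B^n_\alpha(x)\,\alpha^n(P(x))^{-1}\quad\text{for all } x\in M \text{ and } n\in\mathbb{Z}.$$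
   Context: Hyperbolic homeomorphism. For a homeomorphism $f:M\to M$ of a compact metric space $(M,d)$, $x\in M$ and $\varepsilon>0$, let $W^s_\varepsilon(x)=\{y\in M: d(f^n(x),f^n(y))\le\varepsilon\ \forall n\ge0\}$ and $W^u_\varepsilon(x)=\{y\in M: d(f^n(x),f^n(y))\le\varepsilon\ \forall n\le0\}$. The map $f$ is called hyperbolic (with local product structure) if there are constants $C,\varepsilon,\lambda,\tau>0$ (fixed from now on) such that: (1) $d(f^n(y_1),f^n(y_2))\le Ce^{-\lambda n}d(y_1,y_2)$ for all $x\in M$, $y_1,y_2\in W^s_\varepsilon(x)$, $n\ge0$; (2) $d(f^{-n}(y_1),f^{-n}(y_2))\le Ce^{-\lambda n}d(y_1,y_2)$ for all $x\in M$, $y_1,y_2\in W^u_\varepsilon(x)$, $n\ge0$; (3) if $d(x,y)\le\tau$ then $W^s_\varepsilon(x)\cap W^u_\varepsilon(y)$ consists of exactly one point $[x,y]$, which depends continuously on $x$ and $y$. Twisted cocycles. $\mathrm{Aut}(GL(d,\mathbb{R}))$ is the group of automorphisms of the group $GL(d,\mathbb{R})$, and $\alpha^n$ is the $n$-th iterate of $\alpha$ ($n\in\mathbb{Z}$). A map $A:M\to GL(d,\mathbb{R})$ generates the $\alpha$-twisted cocycle $A_\alpha$ over $f$ defined by $A^n_\alpha(x)=A(f^{n-1}(x))\,\alpha(A(f^{n-2}(x)))\cdots\alpha^{n-1}(A(x))$ if $n>0$, $A^0_\alpha(x)=\mathrm{Id}$, and $A^n_\alpha(x)=\alpha^n\big(A^{-n}_\alpha(f^n(x))^{-1}\big)$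 if $n<0$. It satisfies $A^{m+n}_\alpha(x)=A^n_\alpha(f^m(x))\,\alpha^n(A^m_\alpha(x))$ for all $m,n\in\mathbb{Z}$. The cocycle $B_\alpha$ is defined likewise from $B$. H\"older maps. $\|\cdot\|$ is the operator norm of matrices; a map $A:M\to GL(d,\mathbb{R})$ is $\nu$-H\"older if there is $C>0$ with $\|A(x)-A(y)\|\le C\,d(x,y)^\nu$ for all $x,y\in M$. Fiber-bunching. The cocycle $A_\alpha$ generated by the $\nu$-H\"older map $A$ is fiber-bunched if there are constants $C>0$ and $\rho,\theta>0$ with $5\rho+2\theta<\nu\lambda$ (with $\lambda$ the hyperbolicity constant of $f$ above) such that for every $n\in\mathbb{Z}$: (i) $\|\alpha^{-n}(A^n_\alpha(x))\|\,\|\alpha^{-n}(A^n_\alpha(x)^{-1})\|<Ce^{\theta|n|}$ for every $x\in M$; (ii) $\|\alpha^n(T_1)-\alpha^n(T_2)\|\le Ce^{\rho|n|}\|T_1-T_2\|$ for all $T_1,T_2\in GL(d,\mathbb{R})$; (iii) $\|\alpha^n(T)\|\le Ce^{\rho|n|}\|T\|$ for all $T\in GL(d,\mathbb{R})$. $\mathrm{Fix}(f^n)$ denotes the set of fixed points of $f^n$. *)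

theory Defs
  imports "HOL-Analysis.Analysis" "HOL-Algebra.Group"
begin

definition GL :: "(real ^ 'n ^ 'n) monoid" where
  "GL = \<lparr>carrier = {T. invertible T}, monoid.mult = (**), one = mat 1\<rparr>"

lemma group_GL: "group (GL :: (real ^ 'n ^ 'n) monoid)"
proof (rule groupI)
  fix T :: "real ^ 'n ^ 'n" assume "T \<in> carrier GL"
  then obtain S where "T ** S = mat 1" "S ** T = mat 1"
    by (auto simp: GL_def invertible_def)
  then have "S \<in> carrier GL \<and> S \<otimes>\<^bsub>GL\<^esub> T = \<one>\<^bsub>GL\<^esub>"
    by (auto simp: GL_def invertible_def)
  then show "\<exists>S\<in>carrier GL. S \<otimes>\<^bsub>GL\<^esub> T = \<one>\<^bsub>GL\<^esub>" by blast
next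
  have "invertible (mat 1 :: real ^ 'n ^ 'n)"
    unfolding invertible_def by (rule exI[of _ "mat 1"]) simp
  then show "\<one>\<^bsub>GL\<^esub> \<in> carrier (GL :: (real ^ 'n ^ 'n) monoid)"
    by (simp add: GL_def)
qed (auto simp: GL_def invertible_mult matrix_mul_assoc)

text \<open>The operator norm, for the Euclidean norm on \<open>real ^ 'n\<close>. The norm that the library
  provides on the type \<open>real ^ 'n ^ 'n\<close> is the Frobenius norm instead.\<close>

definition opnorm :: "real ^ 'n ^ 'n \<Rightarrow> real" where
  "opnorm T = onorm ((*v) T)"

text \<open>The \<open>n\<close>-th iterate, \<open>n\<close> an integer, of a bijection \<open>g\<close> of \<open>S\<close> onto itself. For an
  automorphism of \<open>GL\<close> one takes \<open>S = carrier GL\<close>; nothing is assumed about its values on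
  singular matrices.\<close>

definition iter_on :: "'b set \<Rightarrow> ('b \<Rightarrow> 'b) \<Rightarrow> int \<Rightarrow> 'b \<Rightarrow> 'b" where
  "iter_on S g n = (if n \<ge> 0 then g ^^ nat n else inv_into S g ^^ nat (- n))"

abbreviation iter :: "('b \<Rightarrow> 'b) \<Rightarrow> int \<Rightarrow> 'b \<Rightarrow> 'b" where
  "iter \<equiv> iter_on UNIV"

abbreviation aut_iter :: "(real ^ 'n ^ 'n \<Rightarrow> real ^ 'n ^ 'n) \<Rightarrow> int \<Rightarrow> real ^ 'n ^ 'n \<Rightarrow> real ^ 'n ^ 'n" where
  "aut_iter \<equiv> iter_on (carrier GL)"

definition Fix :: "('b \<Rightarrow> 'b) \<Rightarrow> 'b set" where
  "Fix g = {p. g p = p}"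

definition stable_set :: "('a::metric_space \<Rightarrow> 'a) \<Rightarrow> real \<Rightarrow> 'a \<Rightarrow> 'a set" where
  "stable_set f \<epsilon> x = {y. \<forall>n\<ge>0. dist (iter f n x) (iter f n y) \<le> \<epsilon>}"

definition unstable_set :: "('a::metric_space \<Rightarrow> 'a) \<Rightarrow> real \<Rightarrow> 'a \<Rightarrow> 'a set" where
  "unstable_set f \<epsilon> x = {y. \<forall>n\<le>0. dist (iter f n x) (iter f n y) \<le> \<epsilon>}"

definition hyperbolic_homeo ::
    "('a::metric_space \<Rightarrow> 'a) \<Rightarrow> real \<Rightarrow> real \<Rightarrow> real \<Rightarrow> real \<Rightarrow> bool" where
  "hyperbolic_homeo f C \<epsilon> lam \<tau> \<longleftrightarrow>
     homeomorphism UNIV UNIV f (inv_into UNIV f) \<and>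
     C > 0 \<and> \<epsilon> > 0 \<and> lam > 0 \<and> \<tau> > 0 \<and>
     (\<forall>x. \<forall>y1\<in>stable_set f \<epsilon> x. \<forall>y2\<in>stable_set f \<epsilon> x. \<forall>n\<ge>0.
        dist (iter f n y1) (iter f n y2) \<le> C * exp (- lam * real_of_int n) * dist y1 y2) \<and>
     (\<forall>x. \<forall>y1\<in>unstable_set f \<epsilon> x. \<forall>y2\<in>unstable_set f \<epsilon> x. \<forall>n\<ge>0.
        dist (iter f (- n) y1) (iter f (- n) y2) \<le> C * exp (- lam * real_of_int n) * dist y1 y2) \<and>
     (\<forall>x y. dist x y \<le> \<tau> \<longrightarrow> (\<exists>!z. z \<in> stable_set f \<epsilon> x \<inter> unstable_set f \<epsilon> y)) \<and>
     continuous_on {(x, y). dist x y \<le> \<tau>}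
       (\<lambda>(x, y). THE z. z \<in> stable_set f \<epsilon> x \<inter> unstable_set f \<epsilon> y)"

text \<open>Topological transitivity refers to forward iterates; on a compact metric space and for a
  homeomorphism this amounts to the existence of a dense forward orbit. Density of a two-sided
  orbit would be a strictly weaker requirement when there are isolated points.\<close>

definition transitive :: "('a::topological_space \<Rightarrow> 'a) \<Rightarrow> bool" where
  "transitive f \<longleftrightarrow>
     (\<forall>U V. open U \<and> open V \<and> U \<noteq> {} \<and> V \<noteq> {} \<longrightarrow> (\<exists>n::nat. (f ^^ n) ` U \<inter> V \<noteq> {}))"

definition holder_GL :: "real \<Rightarrow> ('a::metric_space \<Rightarrow> real ^ 'n ^ 'n) \<Rightarrow> bool" where
  "holder_GL \<nu> A \<longleftrightarrow>
     (\<forall>x. A x \<in> carrier GL) \<and> (\<exists>C>0. \<forall>x y. opnorm (A x - A y) \<le> C * dist x y powr \<nu>)"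

text \<open>The product \<open>A (f\<^sup>n\<^sup>-\<^sup>1 x) ** \<alpha> (A (f\<^sup>n\<^sup>-\<^sup>2 x)) ** \<dots> ** \<alpha>\<^sup>n\<^sup>-\<^sup>1 (A x)\<close>.\<close>

definition twisted_prod ::
    "('a \<Rightarrow> 'a) \<Rightarrow> (real ^ 'n ^ 'n \<Rightarrow> real ^ 'n ^ 'n) \<Rightarrow> ('a \<Rightarrow> real ^ 'n ^ 'n) \<Rightarrow> nat \<Rightarrow> 'a \<Rightarrow> real ^ 'n ^ 'n" where
  "twisted_prod f \<alpha> A n x =
     foldr (**) (map (\<lambda>i. (\<alpha> ^^ i) (A ((f ^^ (n - Suc i)) x))) [0..<n]) (mat 1)"

definition cocycle ::
    "('a \<Rightarrow> 'a) \<Rightarrow> (real ^ 'n ^ 'n \<Rightarrow> real ^ 'n ^ 'n) \<Rightarrow> ('a \<Rightarrow> real ^ 'n ^ 'n) \<Rightarrow> int \<Rightarrow> 'a \<Rightarrow> real ^ 'n ^ 'n" where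
  "cocycle f \<alpha> A n x =
     (if n \<ge> 0 then twisted_prod f \<alpha> A (nat n) x
      else aut_iter \<alpha> n (matrix_inv (twisted_prod f \<alpha> A (nat (- n)) (iter f n x))))"

definition bunching_conditions ::
    "('a \<Rightarrow> 'a) \<Rightarrow> (real ^ 'n ^ 'n \<Rightarrow> real ^ 'n ^ 'n) \<Rightarrow> ('a \<Rightarrow> real ^ 'n ^ 'n) \<Rightarrow> real \<Rightarrow> real \<Rightarrow> real \<Rightarrow> bool" where
  "bunching_conditions f \<alpha> A C \<rho> \<theta> \<longleftrightarrow>
     (\<forall>n::int.
        (\<forall>x. opnorm (aut_iter \<alpha> (- n) (cocycle f \<alpha> A n x)) *
             opnorm (aut_iter \<alpha> (- n) (matrix_inv (cocycle f \<alpha> A n x)))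
             < C * exp (\<theta> * real_of_int \<bar>n\<bar>)) \<and>
        (\<forall>T1\<in>carrier GL. \<forall>T2\<in>carrier GL.
             opnorm (aut_iter \<alpha> n T1 - aut_iter \<alpha> n T2)
             \<le> C * exp (\<rho> * real_of_int \<bar>n\<bar>) * opnorm (T1 - T2)) \<and>
        (\<forall>T\<in>carrier GL. opnorm (aut_iter \<alpha> n T) \<le> C * exp (\<rho> * real_of_int \<bar>n\<bar>) * opnorm T))"

definition fiber_bunched ::
    "('a \<Rightarrow> 'a) \<Rightarrow> (real ^ 'n ^ 'n \<Rightarrow> real ^ 'n ^ 'n) \<Rightarrow> ('a \<Rightarrow> real ^ 'n ^ 'n) \<Rightarrow> real \<Rightarrow> real \<Rightarrow> bool" where
  "fiber_bunched f \<alpha> A \<nu> lam \<longleftrightarrow>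
     (\<exists>C>0. \<exists>\<rho>>0. \<exists>\<theta>>0. 5 * \<rho> + 2 * \<theta> < \<nu> * lam \<and> bunching_conditions f \<alpha> A C \<rho> \<theta>)"

end

theory Submission
  imports Defs
begin

text \<open>Put \<open>\<Phi>\<^sup>n\<^sub>x(T) = A\<^sup>n\<^sub>\<alpha>(x) \<alpha>\<^sup>n(T) B\<^sup>n\<^sub>\<alpha>(x)\<^sup>-\<^sup>1\<close>, with inverse \<open>\<Psi>\<^sup>n\<^sub>x\<close>; the map \<open>P\<close> that is sought satisfies
  \<open>P(f x) = \<Phi>\<^sup>1\<^sub>x(P x)\<close>. Fix a periodic point \<open>p\<close>. If \<open>x\<close> is homoclinic to the orbit of \<open>p\<close>, then by
  fiber bunching both \<open>\<Phi>\<^sup>n\<close> started at \<open>f\<^sup>-\<^sup>n x\<close> and \<open>\<Psi>\<^sup>n\<^sub>x\<close>, applied to \<open>Q p\<close>, converge along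
  the times at which the orbit of \<open>x\<close> is close to \<open>p\<close>. Long segments of the orbit of \<open>x\<close> are shadowed
  exponentially well by periodic orbits, on which the hypothesis says that the two quantities agree;
  so the two limits coincide. Their common value \<open>P x\<close> is Hoelder along unstable sets because it is
  the first limit, and along stable sets because it is the second one. As \<open>f\<close> is Lipschitz, the local
  product structure is Lipschitz at the diagonal, so \<open>P\<close> is Hoelder with the same exponent on the dense
  set of homoclinic points, and it extends to \<open>M\<close>.\<close>

section \<open>The operator norm and invertible matrices\<close>

text \<open>The automorphism \<alpha> is not linear, so differences of matrices cannot be pushed
  through it, whereas ratios can. Errors are therefore measured by the distance \<open>dev\<close>
  of a ratio from the identity; bunching condition (ii) controls it because every iterate of
  \<alpha> fixes the identity. When two orbits are compared, the discrepancy at time i costs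
  exp(\<theta> i) by conjugation (condition (i)) and exp(\<rho> i) by the iterate of \<alpha>, and
  gains exp(-\<nu> lam i) from contraction and Hoelder continuity. The sign of \<rho> + \<theta> -
  \<nu> lam thus decides every convergence below. The delicate point is the comparison with periodic
  orbits: they stay close to the given orbit for a finite time n only, and the hypothesis provides
  \<open>Q\<close> at the periodic point instead of at \<open>p\<close>. Both errors are of order
  exp(-\<nu> lam n) already at the start, and transport over n steps magnifies them by at most
  exp((\<rho> + \<theta>) n), so they still vanish in the limit.\<close>

lemma opnorm_nonneg: "0 \<le> opnorm T"
  by (simp add: opnorm_def onorm_pos_le matrix_vector_mul_bounded_linear)

lemma opnorm_mult: "opnorm (S ** T) \<le> opnorm S * opnorm T"
proof -
  have "(*v) (S ** T) = (*v) S \<circ> (*v) T"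
    by (auto simp: matrix_vector_mul_assoc)
  then show ?thesis
    unfolding opnorm_def
    by (metis onorm_compose matrix_vector_mul_bounded_linear)
qed

lemma opnorm_triangle: "opnorm (S + T) \<le> opnorm S + opnorm T"
proof -
  have "(*v) (S + T) = (\<lambda>x. S *v x + T *v x)"
    by (auto simp: matrix_vector_mult_add_rdistrib)
  then show ?thesis
    unfolding opnorm_def
    by (metis onorm_triangle matrix_vector_mul_bounded_linear)
qed

lemma opnorm_uminus: "opnorm (- T) = opnorm T"
proof -
  have "(*v) (- T) = (\<lambda>x. - (T *v x))"
    using matrix_vector_mult_diff_rdistrib[of 0 T] by (auto simp del: matrix_vector_mult_diff_rdistrib)
  then show ?thesis
    unfolding opnorm_def by (simp add: onorm_neg)
qed

lemma opnorm_minus_commute: "opnorm (S - T) = opnorm (T - S)"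
  by (metis minus_diff_eq opnorm_uminus)

lemma opnorm_mat_1: "opnorm (mat 1 :: real ^ 'n ^ 'n) = 1"
proof -
  have "(*v) (mat 1 :: real ^ 'n ^ 'n) = (\<lambda>x. x)"
    by auto
  then show ?thesis
    unfolding opnorm_def by (simp add: onorm_id)
qed

lemma opnorm_le_add_diff: "opnorm S \<le> opnorm T + opnorm (S - T)"
  using opnorm_triangle[of T "S - T"] by simp

text \<open>Limits, series and uniform continuity refer to the Frobenius norm of the type, the
  estimates to \<open>opnorm\<close>; this equivalence is the bridge.\<close>

lemma opnorm_norm_equiv:
  obtains c where "c > 0" "\<And>T :: real ^ 'n ^ 'n. opnorm T \<le> c * norm T"
    "\<And>T :: real ^ 'n ^ 'n. norm T \<le> c * opnorm T"
proof
  let ?c = "(\<Sum>i\<in>(UNIV::'n set). \<Sum>j\<in>(UNIV::'n set). 1) :: real"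
  show "?c > 0" by (simp add: card_gt_0_iff)
  fix T :: "real ^ 'n ^ 'n"
  have comp: "\<bar>T $ i $ j\<bar> \<le> norm T" for i j
    using order_trans[OF component_le_norm_cart[of "T $ i" j] Finite_Cartesian_Product.norm_nth_le[of T i]] .
  have "opnorm T \<le> (\<Sum>i\<in>UNIV. \<Sum>j\<in>UNIV. \<bar>T $ i $ j\<bar>)"
    unfolding opnorm_def by (rule onorm_le_matrix_component_sum)
  also have "\<dots> \<le> (\<Sum>i\<in>(UNIV::'n set). \<Sum>j\<in>(UNIV::'n set). norm T)"
    by (intro sum_mono comp)
  finally show "opnorm T \<le> ?c * norm T" by simp
  have "norm T \<le> (\<Sum>i\<in>UNIV. norm (T $ i))"
    by (simp add: norm_vec_def L2_set_le_sum)
  also have "\<dots> \<le> (\<Sum>i\<in>UNIV. \<Sum>j\<in>UNIV. \<bar>T $ i $ j\<bar>)"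
    by (intro sum_mono norm_le_l1_cart)
  also have "\<dots> \<le> (\<Sum>i\<in>(UNIV::'n set). \<Sum>j\<in>(UNIV::'n set). opnorm T)"
    unfolding opnorm_def by (intro sum_mono matrix_component_le_onorm)
  finally show "norm T \<le> ?c * opnorm T" by simp
qed

lemma tendsto_opnormI:
  fixes X :: "'b \<Rightarrow> real ^ 'n ^ 'n"
  assumes "((\<lambda>n. opnorm (X n - L)) \<longlongrightarrow> 0) F"
  shows "(X \<longlongrightarrow> L) F"
proof -
  obtain c where c: "\<And>T :: real ^ 'n ^ 'n. norm T \<le> c * opnorm T"
    using opnorm_norm_equiv by metis
  have "((\<lambda>n. c * opnorm (X n - L)) \<longlongrightarrow> 0) F"
    using tendsto_mult_right_zero[OF assms] by simp
  then have "((\<lambda>n. norm (X n - L)) \<longlongrightarrow> 0) F"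
    by (rule tendsto_sandwich[rotated 2, OF tendsto_const]) (auto simp: c)
  then show ?thesis
    using LIM_zero_cancel tendsto_norm_zero_iff by blast
qed

lemma tendsto_opnormD:
  fixes X :: "'b \<Rightarrow> real ^ 'n ^ 'n"
  assumes "(X \<longlongrightarrow> L) F"
  shows "((\<lambda>n. opnorm (X n - L)) \<longlongrightarrow> 0) F"
proof -
  obtain c where c: "\<And>T :: real ^ 'n ^ 'n. opnorm T \<le> c * norm T"
    using opnorm_norm_equiv by metis
  have "((\<lambda>n. c * norm (X n - L)) \<longlongrightarrow> 0) F"
    using tendsto_mult_right_zero tendsto_norm_zero[OF LIM_zero[OF assms]] by blast
  then show ?thesis
    by (rule tendsto_sandwich[rotated 2, OF tendsto_const]) (auto simp: c opnorm_nonneg)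
qed

lemma tendsto_opnorm:
  fixes X :: "'b \<Rightarrow> real ^ 'n ^ 'n"
  assumes "(X \<longlongrightarrow> L) F"
  shows "((\<lambda>n. opnorm (X n)) \<longlongrightarrow> opnorm L) F"
proof -
  have "\<bar>opnorm (X n) - opnorm L\<bar> \<le> opnorm (X n - L)" for n
    using opnorm_le_add_diff[of "X n" L] opnorm_le_add_diff[of L "X n"]
    by (simp add: opnorm_minus_commute[of L])
  then have "((\<lambda>n. opnorm (X n) - opnorm L) \<longlongrightarrow> 0) F"
    by (intro Lim_null_comparison[OF _ tendsto_opnormD[OF assms]]) (auto intro: always_eventually)
  then show ?thesis by (rule LIM_zero_cancel)
qed

lemma tendsto_matrix_mult:
  fixes X Y :: "'b \<Rightarrow> real ^ 'n ^ 'n"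
  assumes "(X \<longlongrightarrow> S) F" "(Y \<longlongrightarrow> T) F"
  shows "((\<lambda>n. X n ** Y n) \<longlongrightarrow> S ** T) F"
  by (intro vec_tendstoI) (auto simp: matrix_matrix_mult_def intro!: tendsto_intros tendsto_vec_nth assms)

lemma invertible_matrix_inv:
  assumes "invertible T"
  shows "T ** matrix_inv T = mat 1" "matrix_inv T ** T = mat 1" "invertible (matrix_inv T)"
proof -
  have "T ** matrix_inv T = mat 1 \<and> matrix_inv T ** T = mat 1"
    using assms unfolding invertible_def matrix_inv_def by (rule someI_ex)
  then show "T ** matrix_inv T = mat 1" "matrix_inv T ** T = mat 1" "invertible (matrix_inv T)"
    unfolding invertible_def by auto
qed

lemma matrix_inv_cancel:
  assumes "invertible T"
  shows "T ** (matrix_inv T ** S) = S" "matrix_inv T ** (T ** S) = S"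
    "S ** T ** matrix_inv T = S" "S ** matrix_inv T ** T = S"
  using invertible_matrix_inv[OF assms]
  by (metis matrix_mul_assoc matrix_mul_lid matrix_mul_rid)+

lemma matrix_inv_unique:
  fixes S T :: "real ^ 'n ^ 'n"
  assumes "S ** T = mat 1"
  shows "matrix_inv S = T" "invertible S" "invertible T"
proof -
  have TS: "T ** S = mat 1" using assms matrix_left_right_inverse by blast
  show "invertible S" "invertible T" using assms TS invertible_def by blast+
  then show "matrix_inv S = T"
    using assms by (metis matrix_inv_cancel(2) matrix_mul_rid)
qed

lemma matrix_inv_mult:
  fixes S T :: "real ^ 'n ^ 'n"
  assumes "invertible S" "invertible T"
  shows "matrix_inv (S ** T) = matrix_inv T ** matrix_inv S"
proof (rule matrix_inv_unique(1))
  show "S ** T ** (matrix_inv T ** matrix_inv S) = mat 1"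
    using assms by (simp add: matrix_mul_assoc matrix_inv_cancel invertible_matrix_inv)
qed

lemma matrix_inv_matrix_inv:
  fixes T :: "real ^ 'n ^ 'n"
  assumes "invertible T"
  shows "matrix_inv (matrix_inv T) = T"
  using assms by (intro matrix_inv_unique(1) invertible_matrix_inv)

lemma invertible_mat_1: "invertible (mat 1 :: real ^ 'n ^ 'n)"
  unfolding invertible_def by (rule exI[of _ "mat 1"]) simp

lemma matrix_inv_mat_1: "matrix_inv (mat 1 :: real ^ 'n ^ 'n) = mat 1"
  by (rule matrix_inv_unique(1)) simp

lemma matrix_diff_ldistrib: "(A :: real ^ 'n ^ 'n) ** (B - C) = A ** B - A ** C"
  by (simp add: matrix_matrix_mult_def vec_eq_iff right_diff_distrib sum_subtractf)

lemma matrix_diff_rdistrib: "(A - B) ** (C :: real ^ 'n ^ 'n) = A ** C - B ** C"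
  by (simp add: matrix_matrix_mult_def vec_eq_iff left_diff_distrib sum_subtractf)

text \<open>Convenient because 1 + \<open>dev\<close> is submultiplicative
  (\<open>dev_mult\<close>), so the errors of a long product add up in an exponent.\<close>

definition dev :: "real ^ 'n ^ 'n \<Rightarrow> real" where
  "dev S = opnorm (S - mat 1)"

lemma dev_nonneg: "0 \<le> dev S"
  by (simp add: dev_def opnorm_nonneg)

lemma dev_mat_1: "dev (mat 1 :: real ^ 'n ^ 'n) = 0"
proof -
  have "(*v) (0 :: real ^ 'n ^ 'n) = (\<lambda>x. 0)" by (rule ext) simp
  then show ?thesis by (simp add: dev_def opnorm_def onorm_zero)
qed

lemma opnorm_le_dev: "opnorm S \<le> 1 + dev S"
  using opnorm_le_add_diff[of S "mat 1"] by (simp add: dev_def opnorm_mat_1)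

lemma dev_mult: "1 + dev (S ** T) \<le> (1 + dev S) * (1 + dev T)"
proof -
  have "S ** T - mat 1 = (S - mat 1) ** T + (T - mat 1)"
    by (simp add: matrix_diff_rdistrib)
  then have "dev (S ** T) \<le> dev S * opnorm T + dev T"
    unfolding dev_def
    using order_trans[OF opnorm_triangle[of "(S - mat 1) ** T" "T - mat 1"] add_right_mono[OF opnorm_mult]]
    by (simp add: add_diff_eq)
  also have "\<dots> \<le> dev S * (1 + dev T) + dev T"
    by (intro add_right_mono mult_left_mono opnorm_le_dev dev_nonneg)
  finally show ?thesis by (simp add: algebra_simps)
qed

lemma opnorm_mult3: "opnorm (R ** S ** T) \<le> opnorm R * opnorm S * opnorm T"
  using order_trans[OF opnorm_mult[of "R ** S" T] mult_right_mono[OF opnorm_mult opnorm_nonneg]] .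

text \<open>Conjugation commutes with subtracting the identity, so it costs at most the condition
  number that bunching condition (i) bounds.\<close>

lemma dev_conj:
  fixes M S :: "real ^ 'n ^ 'n"
  assumes "invertible M"
  shows "dev (M ** S ** matrix_inv M) \<le> opnorm M * opnorm (matrix_inv M) * dev S"
proof -
  have "M ** S ** matrix_inv M - mat 1 = M ** (S - mat 1) ** matrix_inv M"
    using assms by (simp add: matrix_diff_ldistrib matrix_diff_rdistrib invertible_matrix_inv)
  then show ?thesis
    unfolding dev_def using opnorm_mult3[of M "S - mat 1" "matrix_inv M"]
    by (simp add: mult.commute mult.left_commute)
qed

text \<open>Turns additive Hoelder estimates into estimates for ratios.\<close>

lemma dev_diff_le: "invertible T \<Longrightarrow> dev (matrix_inv T ** S) \<le> opnorm (matrix_inv T) * opnorm (S - T)"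
  "invertible T \<Longrightarrow> dev (S ** matrix_inv T) \<le> opnorm (matrix_inv T) * opnorm (S - T)"
proof -
  assume T: "invertible T"
  have "matrix_inv T ** S - mat 1 = matrix_inv T ** (S - T)"
    "S ** matrix_inv T - mat 1 = (S - T) ** matrix_inv T"
    using T by (simp_all add: matrix_diff_ldistrib matrix_diff_rdistrib invertible_matrix_inv)
  then show "dev (matrix_inv T ** S) \<le> opnorm (matrix_inv T) * opnorm (S - T)"
    "dev (S ** matrix_inv T) \<le> opnorm (matrix_inv T) * opnorm (S - T)"
    unfolding dev_def using opnorm_mult[of "matrix_inv T" "S - T"] opnorm_mult[of "S - T" "matrix_inv T"]
    by (auto simp: mult.commute)
qed

lemma convergent_opnorm_geometric:
  fixes X :: "nat \<Rightarrow> real ^ 'n ^ 'n"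
  assumes "\<And>n. opnorm (X (Suc n) - X n) \<le> b * r ^ n" "0 \<le> r" "r < 1"
  shows "convergent X"
proof -
  obtain c where c: "c > 0" "\<And>T :: real ^ 'n ^ 'n. norm T \<le> c * opnorm T"
    using opnorm_norm_equiv by metis
  have "norm (X (Suc n) - X n) \<le> (c * b) * r ^ n" for n
    using order_trans[OF c(2)[of "X (Suc n) - X n"] mult_left_mono[OF assms(1)[of n], of c]] c(1)
    by (simp add: mult.assoc)
  moreover have "summable (\<lambda>n. (c * b) * r ^ n)"
    using assms by (intro summable_mult summable_geometric) auto
  ultimately have "summable (\<lambda>n. X (Suc n) - X n)"
    by (rule summable_comparison_test'[rotated, where N = 0])
  then have "convergent (\<lambda>n. \<Sum>i<n. X (Suc i) - X i)"
    by (simp add: summable_iff_convergent)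
  then have "convergent (\<lambda>n. X n - X 0)"
    by (simp add: sum_lessThan_telescope)
  then have "convergent (\<lambda>n. (X n - X 0) + X 0)"
    by (intro convergent_add convergent_const)
  then show ?thesis by simp
qed

section \<open>Twisted cocycles and time reversal\<close>

locale inverse_maps =
  fixes f g :: "'a \<Rightarrow> 'a"
  assumes f_g [simp]: "f (g x) = x" and g_f [simp]: "g (f x) = x"
begin

lemma iterate_f_g [simp]: "(f ^^ n) ((g ^^ n) x) = x"
  by (induction n arbitrary: x) (simp_all add: funpow_swap1)

lemma iterate_g_f [simp]: "(g ^^ n) ((f ^^ n) x) = x"
  by (induction n arbitrary: x) (simp_all add: funpow_swap1)

lemma iterate_f_g_le: "m \<le> n \<Longrightarrow> (f ^^ m) ((g ^^ n) x) = (g ^^ (n - m)) x"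
  using funpow_add[of m "n - m" g] by simp

lemma iterate_g_f_le: "m \<le> n \<Longrightarrow> (g ^^ m) ((f ^^ n) x) = (f ^^ (n - m)) x"
  using funpow_add[of m "n - m" f] by simp

lemma iterate_g_f_ge: "n \<le> m \<Longrightarrow> (g ^^ m) ((f ^^ n) x) = (g ^^ (m - n)) x"
  using funpow_add[of "m - n" n g] by simp

end

text \<open>\<open>\<beta>\<close> stands for the inverse of \<open>\<alpha>\<close>. All laws are
  restricted to invertible matrices, since an automorphism of GL says nothing about singular
  ones.\<close>

locale twisted = inverse_maps f g
  for f g :: "'a \<Rightarrow> 'a" +
  fixes \<alpha> \<beta> :: "real ^ 'n ^ 'n \<Rightarrow> real ^ 'n ^ 'n"
  assumes inv_\<alpha>: "invertible T \<Longrightarrow> invertible (\<alpha> T)"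
    and inv_\<beta>: "invertible T \<Longrightarrow> invertible (\<beta> T)"
    and \<alpha>_\<beta>: "invertible T \<Longrightarrow> \<alpha> (\<beta> T) = T"
    and \<beta>_\<alpha>: "invertible T \<Longrightarrow> \<beta> (\<alpha> T) = T"
    and \<alpha>_mult: "\<lbrakk>invertible S; invertible T\<rbrakk> \<Longrightarrow> \<alpha> (S ** T) = \<alpha> S ** \<alpha> T"
begin

lemma \<beta>_mult: "\<lbrakk>invertible S; invertible T\<rbrakk> \<Longrightarrow> \<beta> (S ** T) = \<beta> S ** \<beta> T"
  by (metis \<alpha>_\<beta> \<alpha>_mult \<beta>_\<alpha> inv_\<beta> invertible_mult)

lemma twisted_reverse: "twisted g f \<beta> \<alpha>"
  by unfold_locales (simp_all add: inv_\<alpha> inv_\<beta> \<alpha>_\<beta> \<beta>_\<alpha> \<beta>_mult)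

lemma pow_inv: "invertible T \<Longrightarrow> invertible ((\<alpha> ^^ n) T)"
  by (induction n) (simp_all add: inv_\<alpha>)

lemma pow_mult:
  "\<lbrakk>invertible S; invertible T\<rbrakk> \<Longrightarrow> (\<alpha> ^^ n) (S ** T) = (\<alpha> ^^ n) S ** (\<alpha> ^^ n) T"
  by (induction n) (simp_all add: pow_inv \<alpha>_mult)

lemma pow_cancel: "invertible T \<Longrightarrow> (\<alpha> ^^ n) ((\<beta> ^^ n) T) = T"
proof (induction n arbitrary: T)
  case (Suc n)
  have "(\<alpha> ^^ Suc n) ((\<beta> ^^ Suc n) T) = \<alpha> ((\<alpha> ^^ n) ((\<beta> ^^ n) (\<beta> T)))"
    by (simp add: funpow_swap1)
  then show ?case using Suc by (simp add: inv_\<beta> \<alpha>_\<beta>)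
qed simp

text \<open>The image of the identity is an invertible idempotent.\<close>

lemma pow_one: "(\<alpha> ^^ n) (mat 1) = mat 1"
proof -
  let ?I = "(\<alpha> ^^ n) (mat 1)"
  have "?I ** ?I = ?I"
    using pow_mult[of "mat 1" "mat 1" n] by (simp add: invertible_mat_1)
  then show ?thesis
    by (metis invertible_mat_1 matrix_inv_cancel(2) invertible_matrix_inv(2) pow_inv)
qed

lemma pow_matrix_inv:
  assumes "invertible T"
  shows "(\<alpha> ^^ n) (matrix_inv T) = matrix_inv ((\<alpha> ^^ n) T)"
  using pow_mult[of T "matrix_inv T" n] assms
  by (intro matrix_inv_unique(1)[symmetric]) (simp add: invertible_matrix_inv pow_one)

end

text \<open>Exchanging past and future is an involution, so this self-inclusion adds just one copy
  of every fact, under the prefix \<open>rev\<close>.\<close>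

sublocale twisted \<subseteq> rev: twisted g f \<beta> \<alpha>
  by (rule twisted_reverse)

text \<open>\<open>rev_gen\<close> generates the time-reversed cocycle: it is \<open>x \<mapsto> A\<^sup>-\<^sup>1\<^sub>\<alpha>(x)\<close>, a cocycle over
  \<open>g = f\<^sup>-\<^sup>1\<close> twisted by \<open>\<beta> = \<alpha>\<^sup>-\<^sup>1\<close>, and turns every statement about forward time into one about
  backward time.\<close>

context twisted
begin

definition rev_gen :: "('a \<Rightarrow> real ^ 'n ^ 'n) \<Rightarrow> 'a \<Rightarrow> real ^ 'n ^ 'n" where
  "rev_gen A x = \<beta> (matrix_inv (A (g x)))"

context
  fixes A :: "'a \<Rightarrow> real ^ 'n ^ 'n"
  assumes inv_A: "\<And>x. invertible (A x)"
begin

lemma inv_foldr_twisted: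
  "invertible (foldr (**) (map (\<lambda>i. (\<alpha> ^^ i) (A (h i))) is) (mat 1))"
  by (induction "is") (simp_all add: invertible_mat_1 invertible_mult pow_inv inv_A)

lemma inv_twisted_prod: "invertible (twisted_prod f \<alpha> A n x)"
  unfolding twisted_prod_def by (rule inv_foldr_twisted)

lemma twisted_prod_0 [simp]: "twisted_prod f \<alpha> A 0 x = mat 1"
  by (simp add: twisted_prod_def)

lemma foldr_twisted_shift:
  "\<alpha> (foldr (**) (map (\<lambda>i. (\<alpha> ^^ i) (A (h i))) is) (mat 1)) =
    foldr (**) (map (\<lambda>i. (\<alpha> ^^ Suc i) (A (h i))) is) (mat 1)"
proof (induction "is")
  case Nil
  then show ?case using pow_one[of 1] by simp
next
  case (Cons i js)
  then show ?case by (simp add: \<alpha>_mult pow_inv inv_A inv_foldr_twisted)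
qed

lemma twisted_prod_Suc:
  "twisted_prod f \<alpha> A (Suc n) x = A ((f ^^ n) x) ** \<alpha> (twisted_prod f \<alpha> A n x)"
proof -
  have *: "[0..<Suc n] = 0 # map Suc [0..<n]"
    by (metis map_Suc_upt upt_conv_Cons zero_less_Suc)
  show ?thesis
    unfolding twisted_prod_def * foldr_twisted_shift by (simp add: comp_def)
qed

lemma twisted_prod_add:
  "twisted_prod f \<alpha> A (m + n) x =
    twisted_prod f \<alpha> A n ((f ^^ m) x) ** (\<alpha> ^^ n) (twisted_prod f \<alpha> A m x)"
proof (induction n)
  case (Suc n)
  then show ?case
    by (simp add: twisted_prod_Suc \<alpha>_mult inv_twisted_prod pow_inv matrix_mul_assoc funpow_add add.commute[of m n])
qed simp

lemma twisted_prod_1: "twisted_prod f \<alpha> A 1 x = A x"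
  using twisted_prod_Suc[of 0] pow_one[of 1] by simp

lemma inv_rev_gen: "invertible (rev_gen A x)"
  by (simp add: rev_gen_def inv_\<beta> invertible_matrix_inv inv_A)

text \<open>The right-hand side is the cocycle at time -n, so bunching bounds at negative times
  become bounds for the reversed product. The induction peels off the earliest factor of the forward
  product, which is the latest one for \<open>g\<close>.\<close>

lemma twisted_prod_rev:
  "twisted_prod g \<beta> (rev_gen A) n x = (\<beta> ^^ n) (matrix_inv (twisted_prod f \<alpha> A n ((g ^^ n) x)))"
proof (induction n)
  case 0
  show ?case by (simp add: twisted_prod_def matrix_inv_mat_1)
next
  case (Suc n)
  let ?y = "(g ^^ Suc n) x" and ?T = "twisted_prod f \<alpha> A n ((g ^^ n) x)"
  have T: "invertible ?T" by (rule inv_twisted_prod)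
  have "twisted_prod f \<alpha> A (Suc n) ?y = twisted_prod f \<alpha> A n (f ?y) ** (\<alpha> ^^ n) (A ?y)"
    using twisted_prod_add[of 1 n ?y] by (simp add: twisted_prod_1[simplified])
  then have "twisted_prod f \<alpha> A (Suc n) ?y = ?T ** (\<alpha> ^^ n) (A ?y)"
    by simp
  then have "matrix_inv (twisted_prod f \<alpha> A (Suc n) ?y) = (\<alpha> ^^ n) (matrix_inv (A ?y)) ** matrix_inv ?T"
    by (simp only: matrix_inv_mult T pow_inv inv_A pow_matrix_inv)
  then have "(\<beta> ^^ Suc n) (matrix_inv (twisted_prod f \<alpha> A (Suc n) ?y)) =
      \<beta> ((\<beta> ^^ n) ((\<alpha> ^^ n) (matrix_inv (A ?y)))) ** \<beta> ((\<beta> ^^ n) (matrix_inv ?T))"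
    by (simp add: rev.pow_mult rev.\<alpha>_mult pow_inv rev.pow_inv invertible_matrix_inv inv_A T)
  also have "\<dots> = rev_gen A ((g ^^ n) x) ** \<beta> (twisted_prod g \<beta> (rev_gen A) n x)"
    by (simp add: rev.pow_cancel invertible_matrix_inv inv_A rev_gen_def Suc)
  also have "\<dots> = twisted_prod g \<beta> (rev_gen A) (Suc n) x"
  proof (rule twisted.twisted_prod_Suc[OF twisted_reverse, symmetric])
    fix x show "invertible (rev_gen A x)"
      by (simp add: rev_gen_def inv_\<beta> invertible_matrix_inv inv_A)
  qed
  finally show ?case by simp
qed

end

end

section \<open>Transport of matrices by a pair of cocycles, and finite-time holonomies\<close>

context twisted
begin

definition Phi :: "('a \<Rightarrow> real ^ 'n ^ 'n) \<Rightarrow> ('a \<Rightarrow> real ^ 'n ^ 'n) \<Rightarrow> nat \<Rightarrow> 'a \<Rightarrow> real ^ 'n ^ 'n \<Rightarrow> real ^ 'n ^ 'n" where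
  "Phi A B n x T = twisted_prod f \<alpha> A n x ** (\<alpha> ^^ n) T ** matrix_inv (twisted_prod f \<alpha> B n x)"

definition Psi :: "('a \<Rightarrow> real ^ 'n ^ 'n) \<Rightarrow> ('a \<Rightarrow> real ^ 'n ^ 'n) \<Rightarrow> nat \<Rightarrow> 'a \<Rightarrow> real ^ 'n ^ 'n \<Rightarrow> real ^ 'n ^ 'n" where
  "Psi A B n x T = (\<beta> ^^ n) (matrix_inv (twisted_prod f \<alpha> A n x) ** T ** twisted_prod f \<alpha> B n x)"

text \<open>\<open>hol A n x y\<close> is the finite-time approximation of the stable holonomy from \<open>x\<close> to \<open>y\<close>.\<close>

definition hol :: "('a \<Rightarrow> real ^ 'n ^ 'n) \<Rightarrow> nat \<Rightarrow> 'a \<Rightarrow> 'a \<Rightarrow> real ^ 'n ^ 'n" where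
  "hol A n x y = (\<beta> ^^ n) (matrix_inv (twisted_prod f \<alpha> A n y) ** twisted_prod f \<alpha> A n x)"

context
  fixes A :: "'a \<Rightarrow> real ^ 'n ^ 'n"
  assumes inv_A: "\<And>x. invertible (A x)"
begin

lemma hol_0: "hol A 0 x y = mat 1"
  by (simp add: hol_def inv_A matrix_inv_mat_1)

lemma inv_hol: "invertible (hol A n x y)"
  by (simp add: hol_def inv_A inv_twisted_prod invertible_mult invertible_matrix_inv rev.pow_inv)

lemma hol_hol: "hol A n x y ** hol A n y x = mat 1"
  unfolding hol_def
  by (simp add: rev.pow_mult[symmetric] inv_A inv_twisted_prod invertible_mult invertible_matrix_inv
      matrix_mul_assoc matrix_inv_cancel rev.pow_one)

text \<open>Only the factors at time n are new; they enter as the one-step ratio \<open>u\<close>,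
  conjugated by \<open>M\<close>. Pulling everything back by \<open>\<beta>\<close> makes the
  condition number of \<open>M\<close> the quantity in bunching condition (i).\<close>

lemma hol_Suc:
  fixes n x y
  defines "M \<equiv> (\<beta> ^^ n) (twisted_prod f \<alpha> A n y)"
  defines "u \<equiv> (\<beta> ^^ Suc n) (matrix_inv (A ((f ^^ n) y)) ** A ((f ^^ n) x))"
  shows "hol A (Suc n) x y = (matrix_inv M ** u ** M) ** hol A n x y"
proof -
  let ?a = "twisted_prod f \<alpha> A n"
  let ?v = "matrix_inv (A ((f ^^ n) y)) ** A ((f ^^ n) x)"
  have i: "invertible (?a x)" "invertible (?a y)" "invertible ?v"
    by (simp_all add: inv_A inv_twisted_prod invertible_mult invertible_matrix_inv)
  have pow_\<alpha>: "(\<beta> ^^ Suc n) (\<alpha> T) = (\<beta> ^^ n) T" if "invertible T" for T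
    using that by (simp only: funpow_Suc_right o_apply \<beta>_\<alpha>)
  have "matrix_inv (twisted_prod f \<alpha> A (Suc n) y) ** twisted_prod f \<alpha> A (Suc n) x =
      \<alpha> (matrix_inv (?a y)) ** (?v ** \<alpha> (?a x))"
    using pow_matrix_inv[OF i(2), of 1]
    by (simp add: twisted_prod_Suc inv_A matrix_inv_mult inv_\<alpha> i matrix_mul_assoc)
  then have "hol A (Suc n) x y = (\<beta> ^^ n) (matrix_inv (?a y)) ** (u ** (\<beta> ^^ n) (?a x))"
    unfolding hol_def u_def
    by (simp add: rev.pow_mult i inv_\<alpha> invertible_mult invertible_matrix_inv pow_\<alpha> del: funpow.simps(2))
  also have "(\<beta> ^^ n) (?a x) = M ** hol A n x y"
    unfolding M_def hol_def
    by (simp add: rev.pow_mult[symmetric] i invertible_mult invertible_matrix_inv matrix_inv_cancel)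
  also have "(\<beta> ^^ n) (matrix_inv (?a y)) = matrix_inv M"
    unfolding M_def by (simp add: rev.pow_matrix_inv i)
  finally show ?thesis by (simp add: matrix_mul_assoc)
qed

end

context
  fixes A B :: "'a \<Rightarrow> real ^ 'n ^ 'n"
  assumes inv_A: "\<And>x. invertible (A x)" and inv_B: "\<And>x. invertible (B x)"
begin

lemma inv_Phi: "invertible T \<Longrightarrow> invertible (Phi A B n x T)"
  by (simp add: Phi_def inv_A inv_B inv_twisted_prod invertible_mult invertible_matrix_inv pow_inv)

lemma inv_Psi: "invertible T \<Longrightarrow> invertible (Psi A B n x T)"
  by (simp add: Psi_def inv_A inv_B inv_twisted_prod invertible_mult invertible_matrix_inv rev.pow_inv)

lemma Psi_Phi: "invertible T \<Longrightarrow> Psi A B n x (Phi A B n x T) = T"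
  unfolding Phi_def Psi_def
  by (simp add: matrix_mul_assoc inv_A inv_B inv_twisted_prod matrix_inv_cancel invertible_matrix_inv rev.pow_cancel)

lemma Phi_add:
  assumes "invertible T"
  shows "Phi A B (m + n) x T = Phi A B n ((f ^^ m) x) (Phi A B m x T)"
proof -
  have "(\<alpha> ^^ (m + n)) T = (\<alpha> ^^ n) ((\<alpha> ^^ m) T)"
    by (simp only: add.commute[of m n] funpow_add o_apply)
  then show ?thesis
    unfolding Phi_def
    by (simp add: twisted_prod_add inv_A inv_B inv_twisted_prod matrix_inv_mult pow_inv pow_mult assms
      invertible_mult invertible_matrix_inv pow_matrix_inv matrix_mul_assoc)
qed

lemma Psi_add:
  assumes "invertible T"
  shows "Psi A B (m + n) x T = Psi A B m x (Psi A B n ((f ^^ m) x) T)"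
proof -
  let ?S = "Psi A B m x (Psi A B n ((f ^^ m) x) T)"
  have S: "invertible ?S" by (simp add: inv_Psi assms)
  have Phi_Psi: "Phi A B k y (Psi A B k y R) = R" if "invertible R" for k y R
    unfolding Phi_def Psi_def
    by (simp add: matrix_mul_assoc inv_A inv_B inv_twisted_prod matrix_inv_cancel invertible_matrix_inv
        invertible_mult pow_cancel that)
  have "Phi A B (m + n) x ?S = T"
    by (simp add: Phi_add[OF S] Phi_Psi inv_Psi assms)
  then show ?thesis using Psi_Phi[OF S] by metis
qed

text \<open>Products over the orbit of \<open>y\<close> and their inverses are inserted on either
  side of \<open>T\<close>. Holonomies thus intertwine the pull-backs based at \<open>x\<close> and
  at \<open>y\<close>, and convergence at one base point transfers to the other.\<close>

lemma Psi_compare: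
  assumes "invertible T"
  shows "Psi A B n x T = hol A n y x ** Psi A B n y T ** hol B n x y"
  unfolding Psi_def hol_def
  by (simp add: rev.pow_mult[symmetric] inv_A inv_B inv_twisted_prod invertible_mult
      invertible_matrix_inv assms matrix_mul_assoc matrix_inv_cancel)

text \<open>This is \<open>Psi_compare\<close> for a \<open>Phi\<close>-image, solved for that
  image: moving the base point of a forward transport changes its input.\<close>

lemma Phi_compare:
  assumes "invertible T"
  shows "Phi A B n y T = Phi A B n x (hol A n y x ** T ** hol B n x y)"
proof -
  let ?S = "hol A n y x ** T ** hol B n x y"
  have S: "invertible ?S" by (simp add: inv_hol inv_A inv_B invertible_mult assms)
  have "Psi A B n x (Phi A B n y T) = ?S"
    using Psi_compare[OF inv_Phi[OF assms], of n x n y] Psi_Phi[OF assms, of n y] by metis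
  moreover have "Phi A B n x (Psi A B n x R) = R" if "invertible R" for R
    unfolding Phi_def Psi_def
    by (simp add: matrix_mul_assoc inv_A inv_B inv_twisted_prod matrix_inv_cancel invertible_matrix_inv
        invertible_mult pow_cancel that)
  ultimately show ?thesis using inv_Phi[OF assms] by metis
qed

text \<open>The products of \<open>B\<close> cancel in the ratio of two transported matrices, so
  initial errors grow at the rate given by the bunching of \<open>A\<close>.\<close>

lemma Phi_ratio:
  fixes x n
  assumes "invertible S" "invertible T"
  defines "M \<equiv> twisted_prod f \<alpha> A n x"
  shows "Phi A B n x S = (M ** (\<alpha> ^^ n) (S ** matrix_inv T) ** matrix_inv M) ** Phi A B n x T"
  unfolding Phi_def M_def
  by (simp add: pow_mult pow_matrix_inv assms invertible_matrix_inv matrix_mul_assoc inv_A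
      inv_twisted_prod matrix_inv_cancel pow_inv)

end

end

section \<open>Time reversal exchanges the forward transport and the pull-back\<close>

context twisted
begin

context
  fixes A B :: "'a \<Rightarrow> real ^ 'n ^ 'n"
  assumes inv_A: "\<And>x. invertible (A x)" and inv_B: "\<And>x. invertible (B x)"
begin

lemma rev_Phi: "invertible T \<Longrightarrow> rev.Phi (rev_gen A) (rev_gen B) n x T = Psi A B n ((g ^^ n) x) T"
  unfolding rev.Phi_def Psi_def
  by (simp add: twisted_prod_rev inv_A inv_B rev.pow_matrix_inv[symmetric] inv_twisted_prod
      invertible_matrix_inv matrix_inv_matrix_inv rev.pow_mult[symmetric] invertible_mult)

lemma rev_Psi: "invertible T \<Longrightarrow> rev.Psi (rev_gen A) (rev_gen B) n x T = Phi A B n ((g ^^ n) x) T"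
  unfolding rev.Psi_def Phi_def
  by (simp add: twisted_prod_rev inv_A inv_B pow_matrix_inv inv_twisted_prod
      invertible_matrix_inv matrix_inv_matrix_inv pow_mult invertible_mult pow_cancel
      rev.pow_inv rev.pow_matrix_inv)

end

end

section \<open>Holonomies of fiber-bunched cocycles\<close>

text \<open>The control function \<open>D\<close> is \<open>d(x, y)\<^sup>\<nu>\<close>, except for the time-reversed cocycle, where it is
  \<open>d(g x, g y)\<^sup>\<nu>\<close>: as \<open>g\<close> need not be Lipschitz, the reversed generator need not be Hoelder.\<close>

locale bunched = twisted f g \<alpha> \<beta>
  for f g :: "'a \<Rightarrow> 'a" and \<alpha> \<beta> :: "real ^ 'n ^ 'n \<Rightarrow> real ^ 'n ^ 'n" +
  fixes A :: "'a \<Rightarrow> real ^ 'n ^ 'n" and D :: "'a \<Rightarrow> 'a \<Rightarrow> real" and K \<rho> \<theta> \<mu> :: real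
  assumes inv_A: "invertible (A x)"
    and D_nonneg: "0 \<le> D x y" and D_sym: "D x y = D y x"
    and K_ge_1: "1 \<le> K" and \<rho>_pos: "0 < \<rho>" and \<theta>_pos: "0 < \<theta>" and gap: "\<rho> + \<theta> < \<mu>"
    and dev_A: "dev (matrix_inv (A y) ** A x) \<le> K * D x y"
    and dev_A': "dev (A y ** matrix_inv (A x)) \<le> K * D x y"
    and dev_\<alpha>: "invertible S \<Longrightarrow> dev ((\<alpha> ^^ n) S) \<le> K * exp (\<rho> * real n) * dev S"
    and dev_\<beta>: "invertible S \<Longrightarrow> dev ((\<beta> ^^ n) S) \<le> K * exp (\<rho> * real n) * dev S"
    and bunch: "opnorm ((\<beta> ^^ n) (twisted_prod f \<alpha> A n x)) *
      opnorm ((\<beta> ^^ n) (matrix_inv (twisted_prod f \<alpha> A n x))) \<le> K * exp (\<theta> * real n)"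
    and bunch': "opnorm (twisted_prod f \<alpha> A n x) * opnorm (matrix_inv (twisted_prod f \<alpha> A n x))
      \<le> K * exp (\<theta> * real n)"
begin

text \<open>Reversal exchanges \<open>dev_A\<close> with \<open>dev_A'\<close> and
  \<open>bunch\<close> with \<open>bunch'\<close>, the reason why the locale has both of each. The
  factor \<open>K * exp \<rho>\<close> pays for the application of \<open>\<beta>\<close> in
  \<open>rev_gen\<close>, and the control function is shifted because \<open>rev_gen A x\<close>
  reads \<open>A\<close> at \<open>g x\<close>.\<close>

lemma bunched_reverse: "bunched g f \<beta> \<alpha> (rev_gen A) (\<lambda>x y. D (g x) (g y)) (K * (K * exp \<rho>)) \<rho> \<theta> \<mu>"
proof -
  have ge: "1 \<le> K * exp \<rho>"
    using K_ge_1 \<rho>_pos by (metis less_imp_le mult_mono' mult_1 one_le_exp_iff zero_le_one)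
  then have ge': "K \<le> K * (K * exp \<rho>)"
    using K_ge_1 by simp
  have weaken: "u \<le> K * (K * exp \<rho>) * t" if "u \<le> K * t" "0 \<le> t" for u t :: real
    using that mult_right_mono[OF ge', of t] by linarith
  have inv_rev: "invertible (rev_gen A x)" for x
    by (simp add: inv_rev_gen inv_A)
  have dev_step: "dev (\<beta> S) \<le> K * (K * exp \<rho>) * t" if "invertible S" "dev S \<le> K * t" for S t
  proof -
    have "dev (\<beta> S) \<le> (K * exp \<rho>) * dev S" using dev_\<beta>[OF that(1), of 1] by simp
    also have "\<dots> \<le> (K * exp \<rho>) * (K * t)" using ge by (intro mult_left_mono that) auto
    finally show ?thesis by (simp add: mult.assoc mult.commute mult.left_commute)
  qed
  show ?thesis
  proof
    fix x y :: 'a and n :: nat and S :: "real ^ 'n ^ 'n"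
    show "invertible (rev_gen A x)" by (rule inv_rev)
    show "0 \<le> D (g x) (g y)" by (rule D_nonneg)
    show "D (g x) (g y) = D (g y) (g x)" by (rule D_sym)
    show "1 \<le> K * (K * exp \<rho>)" using ge' K_ge_1 by linarith
    show "0 < \<rho>" "0 < \<theta>" "\<rho> + \<theta> < \<mu>" by (rule \<rho>_pos \<theta>_pos gap)+
    have inv_rev_eq: "matrix_inv (rev_gen A z) = \<beta> (A (g z))" for z
      using rev.pow_matrix_inv[of "matrix_inv (A (g z))" 1]
      by (simp add: rev_gen_def inv_A invertible_matrix_inv matrix_inv_matrix_inv)
    have "matrix_inv (rev_gen A y) ** rev_gen A x = \<beta> (A (g y) ** matrix_inv (A (g x)))"
      by (simp add: inv_rev_eq \<beta>_mult inv_A invertible_matrix_inv) (simp add: rev_gen_def)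
    then show "dev (matrix_inv (rev_gen A y) ** rev_gen A x) \<le> K * (K * exp \<rho>) * D (g x) (g y)"
      using dev_step[OF _ dev_A'] by (simp add: inv_A invertible_matrix_inv invertible_mult)
    have "rev_gen A y ** matrix_inv (rev_gen A x) = \<beta> (matrix_inv (A (g y)) ** A (g x))"
      by (simp add: inv_rev_eq \<beta>_mult inv_A invertible_matrix_inv) (simp add: rev_gen_def)
    then show "dev (rev_gen A y ** matrix_inv (rev_gen A x)) \<le> K * (K * exp \<rho>) * D (g x) (g y)"
      using dev_step[OF _ dev_A] by (simp add: inv_A invertible_matrix_inv invertible_mult)
    show "invertible S \<Longrightarrow> dev ((\<beta> ^^ n) S) \<le> K * (K * exp \<rho>) * exp (\<rho> * real n) * dev S"
      using weaken[of _ "exp (\<rho> * real n) * dev S"] dev_\<beta>[of S n] by (simp add: mult.assoc dev_nonneg)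
    show "invertible S \<Longrightarrow> dev ((\<alpha> ^^ n) S) \<le> K * (K * exp \<rho>) * exp (\<rho> * real n) * dev S"
      using weaken[of _ "exp (\<rho> * real n) * dev S"] dev_\<alpha>[of S n] by (simp add: mult.assoc dev_nonneg)
    let ?T = "twisted_prod f \<alpha> A n ((g ^^ n) x)"
    have T: "invertible ?T" "invertible (matrix_inv ?T)"
      by (simp_all add: inv_A inv_twisted_prod invertible_matrix_inv)
    have rev: "twisted_prod g \<beta> (rev_gen A) n x = (\<beta> ^^ n) (matrix_inv ?T)"
      by (rule twisted_prod_rev[OF inv_A])
    have rev': "matrix_inv (twisted_prod g \<beta> (rev_gen A) n x) = (\<beta> ^^ n) ?T"
      unfolding rev by (simp add: rev.pow_matrix_inv[symmetric] T matrix_inv_matrix_inv)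
    show "opnorm ((\<alpha> ^^ n) (twisted_prod g \<beta> (rev_gen A) n x)) *
      opnorm ((\<alpha> ^^ n) (matrix_inv (twisted_prod g \<beta> (rev_gen A) n x)))
      \<le> K * (K * exp \<rho>) * exp (\<theta> * real n)"
      unfolding rev' unfolding rev using weaken[OF bunch'[of n "(g ^^ n) x"]]
      by (simp add: pow_cancel T mult.commute)
    show "opnorm (twisted_prod g \<beta> (rev_gen A) n x) * opnorm (matrix_inv (twisted_prod g \<beta> (rev_gen A) n x))
      \<le> K * (K * exp \<rho>) * exp (\<theta> * real n)"
      unfolding rev' unfolding rev using weaken[OF bunch[of n "(g ^^ n) x"]] by (simp add: mult.commute)
  qed
qed

text \<open>The powers of \<open>K\<close> come from \<open>bunch\<close>,
  \<open>dev_\<beta>\<close> and \<open>dev_A\<close>, and exp \<rho> from \<open>\<beta>\<close>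
  being iterated n + 1 times at step n. The geometric series with ratio \<open>contraction\<close>
  sums to \<open>hol_const\<close>.\<close>

definition step_const where "step_const = K ^ 3 * exp \<rho>"
definition contraction where "contraction = exp (\<rho> + \<theta> - \<mu>)"
definition hol_const where "hol_const = step_const / (1 - contraction)"

lemma contraction_bounds: "0 < contraction" "contraction < 1"
  using gap by (simp_all add: contraction_def)

lemma step_const_pos: "0 < step_const"
  using K_ge_1 by (simp add: step_const_def)

lemma hol_const_pos: "0 < hol_const"
  using contraction_bounds step_const_pos by (simp add: hol_const_def)

lemma hol_step:
  assumes "D ((f ^^ n) x) ((f ^^ n) y) \<le> c * exp (- \<mu> * real n)"
  obtains w where "hol A (Suc n) x y = w ** hol A n x y" "dev w \<le> step_const * c * contraction ^ n"
proof
  let ?M = "(\<beta> ^^ n) (twisted_prod f \<alpha> A n y)"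
  let ?v = "matrix_inv (A ((f ^^ n) y)) ** A ((f ^^ n) x)"
  let ?u = "(\<beta> ^^ Suc n) ?v"
  show "hol A (Suc n) x y = (matrix_inv ?M ** ?u ** ?M) ** hol A n x y"
    by (rule hol_Suc) (rule inv_A)
  have v: "invertible ?v" by (simp add: inv_A invertible_matrix_inv invertible_mult)
  have M: "invertible ?M" "matrix_inv ?M = (\<beta> ^^ n) (matrix_inv (twisted_prod f \<alpha> A n y))"
    by (simp_all add: inv_A inv_twisted_prod rev.pow_inv rev.pow_matrix_inv)
  have "dev (matrix_inv ?M ** ?u ** ?M) \<le> opnorm (matrix_inv ?M) * opnorm ?M * dev ?u"
    using dev_conj[OF invertible_matrix_inv(3)[OF M(1)], of ?u] by (simp add: matrix_inv_matrix_inv M(1))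
  also have "\<dots> \<le> (K * exp (\<theta> * real n)) * dev ?u"
    unfolding M(2) using bunch[of n y] by (intro mult_right_mono dev_nonneg) (simp add: mult.commute)
  also have "\<dots> \<le> (K * exp (\<theta> * real n)) * ((K * exp (\<rho> * real (Suc n))) * (K * (c * exp (- \<mu> * real n))))"
  proof (intro mult_left_mono)
    have "dev ?u \<le> (K * exp (\<rho> * real (Suc n))) * dev ?v"
      by (rule dev_\<beta>[OF v])
    also have "\<dots> \<le> (K * exp (\<rho> * real (Suc n))) * (K * (c * exp (- \<mu> * real n)))"
      using K_ge_1 order_trans[OF dev_A mult_left_mono[OF assms, of K]]
      by (intro mult_left_mono) auto
    finally show "dev ?u \<le> \<dots>" .
  qed (use K_ge_1 in auto)
  also have "\<dots> = step_const * c * contraction ^ n"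
    by (simp add: step_const_def contraction_def exp_of_nat_mult[symmetric] power3_eq_cube algebra_simps exp_add[symmetric])
  finally show "dev (matrix_inv ?M ** ?u ** ?M) \<le> step_const * c * contraction ^ n" .
qed

text \<open>By \<open>dev_mult\<close> the deviations of the n steps add up in the exponent to at
  most a geometric series. Closeness is required up to time n only, so the bound also covers
  shadowing orbits, which may separate afterwards.\<close>

lemma hol_dev:
  assumes "\<And>i. i < n \<Longrightarrow> D ((f ^^ i) x) ((f ^^ i) y) \<le> c * exp (- \<mu> * real i)" "0 \<le> c"
  shows "dev (hol A n x y) \<le> exp (hol_const * c) - 1"
proof -
  have "1 + dev (hol A m x y) \<le> exp (step_const * c * (\<Sum>i<m. contraction ^ i))" if "m \<le> n" for m
    using that
  proof (induction m)
    case 0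
    then show ?case by (simp add: hol_0 inv_A dev_mat_1)
  next
    case (Suc m)
    obtain w where w: "hol A (Suc m) x y = w ** hol A m x y" "dev w \<le> step_const * c * contraction ^ m"
      using hol_step[OF assms(1)[of m]] Suc.prems by auto
    have "1 + dev (hol A (Suc m) x y) \<le> (1 + dev w) * (1 + dev (hol A m x y))"
      unfolding w(1) by (rule dev_mult)
    also have "\<dots> \<le> exp (step_const * c * contraction ^ m) * exp (step_const * c * (\<Sum>i<m. contraction ^ i))"
    proof (intro mult_mono)
      show "1 + dev w \<le> exp (step_const * c * contraction ^ m)"
        using w(2) exp_ge_add_one_self[of "step_const * c * contraction ^ m"] by linarith
      show "1 + dev (hol A m x y) \<le> exp (step_const * c * (\<Sum>i<m. contraction ^ i))"
        using Suc by simp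
      show "0 \<le> 1 + dev (hol A m x y)" using dev_nonneg[of "hol A m x y"] by linarith
    qed simp
    also have "\<dots> = exp (step_const * c * (\<Sum>i<Suc m. contraction ^ i))"
      by (simp add: exp_add[symmetric] algebra_simps)
    finally show ?case .
  qed
  then have "1 + dev (hol A n x y) \<le> exp (step_const * c * (\<Sum>i<n. contraction ^ i))" by simp
  also have "\<dots> \<le> exp (hol_const * c)"
  proof -
    have "(\<Sum>i<n. contraction ^ i) \<le> 1 / (1 - contraction)"
    proof -
      have "(\<Sum>i<n. contraction ^ i) = (1 - contraction ^ n) / (1 - contraction)" using contraction_bounds by (simp add: sum_gp_strict)
      also have "\<dots> \<le> 1 / (1 - contraction)" using contraction_bounds by (intro divide_right_mono) auto
      finally show ?thesis .
    qed
    then have "step_const * c * (\<Sum>i<n. contraction ^ i) \<le> step_const * c * (1 / (1 - contraction))"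
      using step_const_pos assms(2) by (intro mult_left_mono) auto
    then show ?thesis by (simp add: hol_const_def mult.commute mult.left_commute)
  qed
  finally show ?thesis by simp
qed

lemma hol_limit:
  assumes "\<And>i. D ((f ^^ i) x) ((f ^^ i) y) \<le> c * exp (- \<mu> * real i)" "0 \<le> c"
  obtains H where "(\<lambda>n. hol A n x y) \<longlonglongrightarrow> H" "dev H \<le> exp (hol_const * c) - 1"
proof -
  have "opnorm (hol A (Suc n) x y - hol A n x y) \<le> (step_const * c * exp (hol_const * c)) * contraction ^ n" for n
  proof -
    obtain w where w: "hol A (Suc n) x y = w ** hol A n x y" "dev w \<le> step_const * c * contraction ^ n"
      using hol_step[OF assms(1)[of n]] by auto
    have "opnorm (hol A (Suc n) x y - hol A n x y) = opnorm ((w - mat 1) ** hol A n x y)"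
      by (simp add: w matrix_diff_rdistrib)
    also have "\<dots> \<le> dev w * opnorm (hol A n x y)"
      unfolding dev_def by (rule opnorm_mult)
    also have "\<dots> \<le> (step_const * c * contraction ^ n) * exp (hol_const * c)"
      using hol_dev[OF assms, of n] opnorm_le_dev[of "hol A n x y"] w(2) step_const_pos assms(2) contraction_bounds
      by (intro mult_mono opnorm_nonneg) auto
    finally show ?thesis by (simp add: mult_ac)
  qed
  then have "convergent (\<lambda>n. hol A n x y)"
    using contraction_bounds by (intro convergent_opnorm_geometric) auto
  then obtain H where H: "(\<lambda>n. hol A n x y) \<longlonglongrightarrow> H"
    by (auto simp: convergent_def)
  have "(\<lambda>n. dev (hol A n x y)) \<longlonglongrightarrow> dev H"
    unfolding dev_def by (intro tendsto_opnorm tendsto_intros H)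
  then have "dev H \<le> exp (hol_const * c) - 1"
    by (rule LIMSEQ_le_const2) (use hol_dev[OF assms] in auto)
  with H show ?thesis by (rule that)
qed

text \<open>Finite-time holonomies from x to y and from y to x are inverse to each other, hence so
  are their limits; this is what makes the limit invertible.\<close>

lemma hol_limit_inverse:
  assumes "\<And>i. D ((f ^^ i) x) ((f ^^ i) y) \<le> c * exp (- \<mu> * real i)" "0 \<le> c"
  obtains H H' where "(\<lambda>n. hol A n x y) \<longlonglongrightarrow> H" "dev H \<le> exp (hol_const * c) - 1"
    "(\<lambda>n. hol A n y x) \<longlonglongrightarrow> H'" "dev H' \<le> exp (hol_const * c) - 1" "invertible H" "matrix_inv H = H'"
proof -
  obtain H where H: "(\<lambda>n. hol A n x y) \<longlonglongrightarrow> H" "dev H \<le> exp (hol_const * c) - 1"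
    using hol_limit[OF assms] by metis
  obtain H' where H': "(\<lambda>n. hol A n y x) \<longlonglongrightarrow> H'" "dev H' \<le> exp (hol_const * c) - 1"
    using hol_limit[OF assms(1)[unfolded D_sym[of "(f ^^ _) x"]] assms(2)] by metis
  have "(\<lambda>n. hol A n x y ** hol A n y x) \<longlonglongrightarrow> H ** H'"
    by (intro tendsto_matrix_mult H H')
  then have "H ** H' = mat 1"
    by (simp add: hol_hol inv_A LIMSEQ_const_iff)
  from matrix_inv_unique[OF this] show ?thesis
    using that[OF H H'] by simp
qed

end

section \<open>Two bunched cocycles with common constants\<close>

locale bunched_pair = twisted f g \<alpha> \<beta> +
  A: bunched f g \<alpha> \<beta> A D K \<rho> \<theta> \<mu> + B: bunched f g \<alpha> \<beta> B D K \<rho> \<theta> \<mu>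
  for f g :: "'a \<Rightarrow> 'a" and \<alpha> \<beta> :: "real ^ 'n ^ 'n \<Rightarrow> real ^ 'n ^ 'n"
    and A B :: "'a \<Rightarrow> real ^ 'n ^ 'n" and D K \<rho> \<theta> \<mu>
begin

lemmas inv_AB = A.inv_A B.inv_A

lemma bunched_pair_reverse:
  "bunched_pair g f \<beta> \<alpha> (rev_gen A) (rev_gen B) (\<lambda>x y. D (g x) (g y)) (K * (K * exp \<rho>)) \<rho> \<theta> \<mu>"
  by (intro bunched_pair.intro twisted_reverse A.bunched_reverse B.bunched_reverse)

text \<open>\<open>G\<close> and \<open>H\<close> are limits of holonomies between \<open>x\<close>
  and \<open>y\<close>, so one pair serves for every sequence of times and every start
  matrix.\<close>

lemma Psi_limit_compare:
  assumes D: "\<And>i. D ((f ^^ i) x) ((f ^^ i) y) \<le> c * exp (- \<mu> * real i)" and "0 \<le> c"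
  obtains G H where "invertible G" "invertible H"
    "dev G \<le> exp (A.hol_const * c) - 1" "dev (matrix_inv G) \<le> exp (A.hol_const * c) - 1"
    "dev H \<le> exp (A.hol_const * c) - 1" "dev (matrix_inv H) \<le> exp (A.hol_const * c) - 1"
    "\<And>s T R. \<lbrakk>filterlim s at_top sequentially; invertible T; (\<lambda>N. Psi A B (s N) y T) \<longlonglongrightarrow> R\<rbrakk>
      \<Longrightarrow> (\<lambda>N. Psi A B (s N) x T) \<longlonglongrightarrow> G ** R ** H"
proof -
  have D': "\<And>i. D ((f ^^ i) y) ((f ^^ i) x) \<le> c * exp (- \<mu> * real i)"
    using D A.D_sym by metis
  obtain G G' where G: "(\<lambda>n. hol A n y x) \<longlonglongrightarrow> G" "dev G \<le> exp (A.hol_const * c) - 1"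
    "dev G' \<le> exp (A.hol_const * c) - 1" "invertible G" "matrix_inv G = G'"
    using A.hol_limit_inverse[OF D' \<open>0 \<le> c\<close>] by metis
  obtain H H' where H: "(\<lambda>n. hol B n x y) \<longlonglongrightarrow> H" "dev H \<le> exp (A.hol_const * c) - 1"
    "dev H' \<le> exp (A.hol_const * c) - 1" "invertible H" "matrix_inv H = H'"
    using B.hol_limit_inverse[OF D \<open>0 \<le> c\<close>] by metis
  show ?thesis
  proof
    fix s :: "nat \<Rightarrow> nat" and T R
    assume s: "filterlim s at_top sequentially" and T: "invertible T"
      and R: "(\<lambda>N. Psi A B (s N) y T) \<longlonglongrightarrow> R"
    have "(\<lambda>N. hol A (s N) y x ** Psi A B (s N) y T ** hol B (s N) x y) \<longlonglongrightarrow> G ** R ** H"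
      by (intro tendsto_matrix_mult R filterlim_compose[OF G(1) s] filterlim_compose[OF H(1) s])
    then show "(\<lambda>N. Psi A B (s N) x T) \<longlonglongrightarrow> G ** R ** H"
      by (simp add: Psi_compare[OF inv_AB T, where x = x and y = y])
  qed (use G H in auto)
qed

text \<open>The orbits of \<open>a N\<close> and \<open>b N\<close> are compared for
  \<open>n N\<close> steps only, but \<open>D\<close> starts at order exp(-\<mu> n). This outweighs
  the growth exp((\<rho> + \<theta>) n) of an initial ratio, so the ratio \<open>W N\<close> of the
  two images tends to the identity.\<close>

lemma Phi_shadow:
  fixes a b :: "nat \<Rightarrow> 'a" and n :: "nat \<Rightarrow> nat"
  assumes "invertible Q0" "\<And>N. invertible (Q1 N)" and n: "filterlim n at_top sequentially"
    and "0 \<le> c0"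
    and D: "\<And>N m. m < n N \<Longrightarrow> D ((f ^^ m) (a N)) ((f ^^ m) (b N)) \<le>
      c0 * exp (- \<mu> * real (n N)) * exp (- \<mu> * real m)"
    and Q1: "\<And>N. opnorm (Q1 N - Q0) \<le> c0 * exp (- \<mu> * real (n N))"
    and lim: "(\<lambda>N. Phi A B (n N) (a N) Q0) \<longlonglongrightarrow> T"
  shows "(\<lambda>N. Phi A B (n N) (b N) (Q1 N)) \<longlonglongrightarrow> T"
proof -
  define c where "c N = c0 * exp (- \<mu> * real (n N))" for N
  \<comment> \<open>Multiplied by \<open>c N\<close>, these bound the three kinds of error:
    \<open>x\<close> a holonomy, \<open>y\<close> the change from \<open>Q0\<close> to
    \<open>Q1 N\<close>, \<open>z\<close> the holonomy of \<open>B\<close> conjugated by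
    \<open>Q0\<close>.\<close>
  define x where "x = A.hol_const * exp (A.hol_const * c0)"
  define y where "y = opnorm (matrix_inv Q0)"
  define z where "z = opnorm Q0 * opnorm (matrix_inv Q0) * x"
  \<comment> \<open>Chosen so that (1 + x c)(1 + y c)(1 + z c) - 1 \<le> c Lam whenever 0 \<le> c
    \<le> c0.\<close>
  define Lam where "Lam = x + y + z + c0 * (x * y + y * z + z * x) + c0 ^ 2 * (x * y * z)"
  have nonneg: "0 \<le> x" "0 \<le> y" "0 \<le> z"
    using A.hol_const_pos by (auto simp: x_def y_def z_def opnorm_nonneg)
  have \<mu>: "0 < \<mu>" using A.gap A.\<rho>_pos A.\<theta>_pos by linarith
  have c: "0 \<le> c N" "c N \<le> c0" for N
    using \<open>0 \<le> c0\<close> \<mu> by (auto simp: c_def intro: mult_left_le)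
  have e: "exp (A.hol_const * c N) - 1 \<le> x * c N" for N
  proof -
    have "1 - A.hol_const * c N \<le> exp (- (A.hol_const * c N))" using exp_ge_add_one_self[of "- (A.hol_const * c N)"] by simp
    then have "(1 - A.hol_const * c N) * exp (A.hol_const * c N) \<le> 1"
      by (simp add: exp_minus field_simps)
    then have "exp (A.hol_const * c N) - 1 \<le> A.hol_const * c N * exp (A.hol_const * c N)" by (simp add: algebra_simps)
    also have "\<dots> \<le> A.hol_const * c N * exp (A.hol_const * c0)"
      using A.hol_const_pos c by (intro mult_left_mono) auto
    finally show ?thesis by (simp add: x_def mult_ac)
  qed
  define W where "W N = (let M = twisted_prod f \<alpha> A (n N) (a N); S = hol A (n N) (b N) (a N) ** Q1 N ** hol B (n N) (a N) (b N)
      in M ** (\<alpha> ^^ n N) (S ** matrix_inv Q0) ** matrix_inv M)" for N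
  have W: "Phi A B (n N) (b N) (Q1 N) = W N ** Phi A B (n N) (a N) Q0" for N
    unfolding W_def Let_def
    by (subst Phi_compare[where x = "a N"], rule A.inv_A, rule B.inv_A, rule assms(2))
       (rule Phi_ratio[OF inv_AB _ assms(1)], simp add: inv_hol inv_AB invertible_mult assms(2))
  have "dev (W N) \<le> (K ^ 2 * Lam * c0) * A.contraction ^ n N" for N
  proof -
    let ?hA = "hol A (n N) (b N) (a N)" and ?hB = "hol B (n N) (a N) (b N)"
    let ?S = "?hA ** Q1 N ** ?hB"
    let ?M = "twisted_prod f \<alpha> A (n N) (a N)"
    have D': "D ((f ^^ m) (b N)) ((f ^^ m) (a N)) \<le> c N * exp (- \<mu> * real m)" if "m < n N" for m
      unfolding c_def A.D_sym[of "(f ^^ m) (b N)"] using D[OF that] .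
    have hA: "dev ?hA \<le> x * c N"
      using A.hol_dev[of "n N" "b N" "a N" "c N", OF D' c(1)] e[of N] by linarith
    have hB: "dev ?hB \<le> x * c N"
      using B.hol_dev[of "n N" "a N" "b N" "c N", OF D[folded c_def] c(1)] e[of N] by linarith
    \<comment> \<open>\<open>Q0\<close> is carried past the holonomy of \<open>B\<close>, so that
      each of the three factors is close to the identity.\<close>
    have "?S ** matrix_inv Q0 = ?hA ** (Q1 N ** matrix_inv Q0) ** (Q0 ** ?hB ** matrix_inv Q0)"
      by (simp add: matrix_mul_assoc matrix_inv_cancel assms(1,2))
    then have "1 + dev (?S ** matrix_inv Q0) \<le>
        (1 + dev (?hA ** (Q1 N ** matrix_inv Q0))) * (1 + dev (Q0 ** ?hB ** matrix_inv Q0))"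
      by (simp only: dev_mult)
    also have "\<dots> \<le> ((1 + dev ?hA) * (1 + dev (Q1 N ** matrix_inv Q0))) * (1 + dev (Q0 ** ?hB ** matrix_inv Q0))"
      using dev_nonneg[of "Q0 ** ?hB ** matrix_inv Q0"] by (intro mult_right_mono dev_mult) linarith
    also have "\<dots> \<le> ((1 + x * c N) * (1 + y * c N)) * (1 + z * c N)"
    proof (intro mult_mono add_left_mono)
      show "dev ?hA \<le> x * c N" by (rule hA)
      show "dev (Q1 N ** matrix_inv Q0) \<le> y * c N"
        using order_trans[OF dev_diff_le(2)[OF assms(1)] mult_left_mono[OF Q1[of N] opnorm_nonneg]]
        by (simp add: y_def c_def)
      have "dev (Q0 ** ?hB ** matrix_inv Q0) \<le> opnorm Q0 * opnorm (matrix_inv Q0) * (x * c N)"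
        using order_trans[OF dev_conj[OF assms(1)] mult_left_mono[OF hB]] by (simp add: opnorm_nonneg)
      then show "dev (Q0 ** ?hB ** matrix_inv Q0) \<le> z * c N"
        by (simp add: z_def mult.assoc)
    qed (use nonneg c[of N] in \<open>auto intro!: add_nonneg_nonneg mult_nonneg_nonneg dev_nonneg\<close>)
    finally have "dev (?S ** matrix_inv Q0) \<le>
        c N * (x + y + z) + (c N * c N) * (x * y + y * z + z * x) + (c N * c N * c N) * (x * y * z)"
      by (simp add: algebra_simps)
    also have "\<dots> \<le> c N * (x + y + z) + (c N * c0) * (x * y + y * z + z * x) + (c N * c0 * c0) * (x * y * z)"
    proof -
      have "c N * c N \<le> c N * c0" using c[of N] by (intro mult_left_mono)
      moreover have "c N * c N * c N \<le> c N * c0 * c0"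
        using c[of N] \<open>0 \<le> c0\<close> by (intro mult_mono) auto
      ultimately show ?thesis
        using nonneg by (intro add_mono order_refl mult_right_mono) auto
    qed
    also have "\<dots> = c N * Lam"
      by (simp add: Lam_def algebra_simps power2_eq_square)
    finally have S: "dev (?S ** matrix_inv Q0) \<le> c N * Lam" .
    have inv_S: "invertible (?S ** matrix_inv Q0)"
      by (simp add: invertible_mult inv_hol inv_AB assms(1,2) invertible_matrix_inv)
    have "dev (W N) \<le> opnorm ?M * opnorm (matrix_inv ?M) * dev ((\<alpha> ^^ n N) (?S ** matrix_inv Q0))"
      unfolding W_def Let_def by (rule dev_conj) (simp add: inv_twisted_prod A.inv_A)
    also have "\<dots> \<le> (K * exp (\<theta> * real (n N))) * (K * exp (\<rho> * real (n N)) * (c N * Lam))"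
      using A.K_ge_1 order_trans[OF A.dev_\<alpha>[OF inv_S, of "n N"] mult_left_mono[OF S]]
      by (intro mult_mono A.bunch' dev_nonneg) auto
    also have "\<dots> = (K ^ 2 * Lam * c0) * A.contraction ^ n N"
      by (simp add: c_def A.contraction_def exp_of_nat_mult[symmetric] algebra_simps exp_add[symmetric] power2_eq_square)
    finally show ?thesis .
  qed
  moreover have "(\<lambda>N. (K ^ 2 * Lam * c0) * A.contraction ^ n N) \<longlonglongrightarrow> 0"
    by (rule tendsto_mult_right_zero)
       (rule filterlim_compose[OF LIMSEQ_realpow_zero[OF less_imp_le[OF A.contraction_bounds(1)] A.contraction_bounds(2)] n])
  ultimately have "(\<lambda>N. dev (W N)) \<longlonglongrightarrow> 0"
    by (intro tendsto_sandwich[of "\<lambda>_. 0" "\<lambda>N. dev (W N)"] always_eventually tendsto_const)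
       (simp_all add: dev_nonneg)
  then have "W \<longlonglongrightarrow> mat 1"
    unfolding dev_def by (rule tendsto_opnormI)
  then have "(\<lambda>N. W N ** Phi A B (n N) (a N) Q0) \<longlonglongrightarrow> mat 1 ** T"
    by (rule tendsto_matrix_mult[OF _ lim])
  then show ?thesis by (simp add: W)
qed

end

section \<open>Closing and homoclinic points for hyperbolic homeomorphisms\<close>

text \<open>The contraction laws compare a point with the centre of its local set, the case y1 = x
  of the definition; \<open>C\<close> and \<open>Lip\<close> are normalised to be at least
  1.\<close>

locale hyperbolic = inverse_maps f g
  for f g :: "'a::metric_space \<Rightarrow> 'a" +
  fixes C \<epsilon> lam \<tau> Lip :: real
    and Ws Wu :: "'a \<Rightarrow> 'a \<Rightarrow> bool" and br :: "'a \<Rightarrow> 'a \<Rightarrow> 'a"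
  assumes Ws_def: "Ws x y \<longleftrightarrow> (\<forall>n::nat. dist ((f ^^ n) x) ((f ^^ n) y) \<le> \<epsilon>)"
    and Wu_def: "Wu x y \<longleftrightarrow> (\<forall>n::nat. dist ((g ^^ n) x) ((g ^^ n) y) \<le> \<epsilon>)"
    and compact_UNIV: "compact (UNIV :: 'a set)"
    and pos: "1 \<le> C" "0 < \<epsilon>" "0 < lam" "0 < \<tau>" "1 \<le> Lip"
    and lipschitz: "dist (f x) (f y) \<le> Lip * dist x y"
    and stable: "Ws x y \<Longrightarrow> dist ((f ^^ n) x) ((f ^^ n) y) \<le> C * exp (- lam * real n) * dist x y"
    and unstable: "Wu x y \<Longrightarrow> dist ((g ^^ n) x) ((g ^^ n) y) \<le> C * exp (- lam * real n) * dist x y"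
    and br_mem: "dist x y \<le> \<tau> \<Longrightarrow> Ws x (br x y) \<and> Wu y (br x y)"
    and br_unique: "\<lbrakk>dist x y \<le> \<tau>; Ws x z; Wu y z\<rbrakk> \<Longrightarrow> z = br x y"
    and br_continuous: "continuous_on {(x, y). dist x y \<le> \<tau>} (\<lambda>(x, y). br x y)"
begin

lemma lipschitz_iterate: "dist ((f ^^ n) x) ((f ^^ n) y) \<le> Lip ^ n * dist x y"
proof (induction n)
  case (Suc n)
  have "dist ((f ^^ Suc n) x) ((f ^^ Suc n) y) \<le> Lip * dist ((f ^^ n) x) ((f ^^ n) y)"
    using lipschitz by simp
  also have "\<dots> \<le> Lip * (Lip ^ n * dist x y)" using Suc pos by (intro mult_left_mono) auto
  finally show ?case by simp
qed simp

lemma continuous_f: "continuous_on UNIV f"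
  using pos by (intro lipschitz_on_continuous_on[of Lip] lipschitz_onI lipschitz) auto

lemma continuous_iterate: "continuous_on UNIV (f ^^ n)"
  using pos by (intro lipschitz_on_continuous_on[of "Lip ^ n"] lipschitz_onI lipschitz_iterate) auto

lemma tendsto_iterate: "(X \<longlongrightarrow> x) F \<Longrightarrow> ((\<lambda>j. (f ^^ n) (X j)) \<longlongrightarrow> (f ^^ n) x) F"
  by (rule continuous_on_tendsto_compose[OF continuous_iterate]) auto

lemma dist_bounded: obtains R where "0 \<le> R" "\<And>x y :: 'a. dist x y \<le> R"
proof -
  obtain R where R: "\<And>x y :: 'a. dist x y \<le> R"
    using compact_imp_bounded[OF compact_UNIV] by (auto simp: bounded_two_points)
  then show ?thesis using that[of R] order_trans[OF zero_le_dist R] by blast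
qed

lemma convergent_subseq:
  fixes X :: "nat \<Rightarrow> 'a"
  obtains l s where "strict_mono (s :: nat \<Rightarrow> nat)" "(X \<circ> s) \<longlonglongrightarrow> l"
proof -
  have "seq_compact (UNIV :: 'a set)"
    using compact_UNIV by (simp add: compact_eq_seq_compact_metric)
  then show ?thesis by (rule seq_compactE[of UNIV X]) (auto intro: that)
qed

lemma dist_le_add: "\<lbrakk>dist u v \<le> a; dist v w \<le> b\<rbrakk> \<Longrightarrow> dist u w \<le> a + b" for u v w :: 'a
  using dist_triangle[of u w v] by linarith

lemma Ws_refl: "Ws x x" and Wu_refl: "Wu x x"
  using pos by (simp_all add: Ws_def Wu_def)

text \<open>Uniform continuity on the compact set of close pairs, together with
  \<open>br x x = x\<close> on the diagonal.\<close>

lemma br_close: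
  assumes "0 < \<eta>"
  obtains \<delta> where "0 < \<delta>" "\<delta> \<le> \<tau>" "\<And>x y. dist x y \<le> \<delta> \<Longrightarrow> dist y (br x y) \<le> \<eta>"
proof -
  let ?S = "{(x, y). dist x y \<le> \<tau>} :: ('a \<times> 'a) set"
  have "closed ?S"
    unfolding case_prod_unfold by (intro closed_Collect_le continuous_intros)
  from compact_Int_closed[OF compact_Times[OF compact_UNIV compact_UNIV] this]
  have "compact ?S" by (simp only: UNIV_Times_UNIV Int_UNIV_left)
  then have "uniformly_continuous_on ?S (\<lambda>(x, y). br x y)"
    by (rule compact_uniformly_continuous[OF br_continuous])
  then obtain d where d: "0 < d" "\<And>u v. \<lbrakk>u \<in> ?S; v \<in> ?S; dist v u < d\<rbrakk> \<Longrightarrow>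
      dist ((\<lambda>(x, y). br x y) v) ((\<lambda>(x, y). br x y) u) < \<eta> / 2"
    using assms by (elim uniformly_continuous_onE[of _ _ "\<eta> / 2"]) auto
  show ?thesis
  proof
    show "0 < min (min (d / 2) \<tau>) (\<eta> / 2)" "min (min (d / 2) \<tau>) (\<eta> / 2) \<le> \<tau>"
      using d pos assms by auto
    fix x y :: 'a assume xy: "dist x y \<le> min (min (d / 2) \<tau>) (\<eta> / 2)"
    have "br x x = x" using br_unique[of x x x] pos Ws_refl Wu_refl by simp
    moreover have "dist ((\<lambda>(x, y). br x y) (x, y)) ((\<lambda>(x, y). br x y) (x, x)) < \<eta> / 2"
    proof (rule d(2))
      have "dist (x, y) (x, x) = dist x y" by (simp add: dist_Pair_Pair dist_commute)
      then show "dist (x, y) (x, x) < d" using xy d by linarith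
    qed (use xy pos in auto)
    ultimately have "dist (br x y) x < \<eta> / 2" by simp
    moreover have "dist y (br x y) \<le> dist x y + dist (br x y) x"
      using dist_triangle[of y "br x y" x] by (simp add: dist_commute)
    ultimately show "dist y (br x y) \<le> \<eta>" using xy by linarith
  qed
qed

lemma exp_small:
  assumes "0 < e"
  obtains N :: nat where "\<And>n. N \<le> n \<Longrightarrow> C * exp (- lam * real n) \<le> e"
proof -
  have "(\<lambda>n. C * exp (- lam) ^ n) \<longlonglongrightarrow> 0"
    using pos by (intro tendsto_mult_right_zero LIMSEQ_realpow_zero) auto
  then have "eventually (\<lambda>n. C * exp (- lam) ^ n < e) sequentially"
    using assms by (rule order_tendstoD)
  then obtain N where "\<And>n. N \<le> n \<Longrightarrow> C * exp (- lam) ^ n < e"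
    by (auto simp: eventually_sequentially)
  moreover have "exp (- lam) ^ n = exp (- lam * real n)" for n
    using exp_of_nat_mult[of n "- lam"] by (simp add: mult.commute)
  ultimately show ?thesis using that[of N] by (simp add: less_imp_le)
qed

text \<open>Although the bracket is only assumed to be continuous, it is Lipschitz at the diagonal:
  for \<open>z = [x, y]\<close>, after a fixed number of iterations the unstable displacement between \<open>y\<close> and
  \<open>z\<close> has grown, whereas the stable one between \<open>x\<close> and \<open>z\<close> has shrunk, so that the former is
  controlled by the distance of the iterates of \<open>x\<close> and \<open>y\<close>.\<close>

lemma br_lipschitz:
  obtains K \<delta> where "1 \<le> K" "0 < \<delta>" "\<And>x y. dist x y \<le> \<delta> \<Longrightarrow>
    \<exists>z. Ws x z \<and> Wu y z \<and> dist x z \<le> K * dist x y \<and> dist y z \<le> K * dist x y"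
proof -
  obtain N where "C * exp (- lam * real N) \<le> 1/2"
    using exp_small[of "1/2"] by auto
  then have N: "C * exp (- lam * real N) \<le> 1/2" .
  have LN: "1 \<le> Lip ^ N" using pos by simp
  \<comment> \<open>A displacement of \<epsilon> / Lip ^ N stays below \<epsilon> for N forward
    steps, which keeps the images of y and z in one local unstable set at time N.\<close>
  obtain \<delta> where \<delta>: "0 < \<delta>" "\<delta> \<le> \<tau>" "\<And>x y. dist x y \<le> \<delta> \<Longrightarrow> dist y (br x y) \<le> \<epsilon> / Lip ^ N"
    using br_close[of "\<epsilon> / Lip ^ N"] pos by auto
  show ?thesis
  proof
    show "1 \<le> Lip ^ N + 1" using LN by simp
    show "0 < \<delta>" by fact
    fix x y :: 'a assume xy: "dist x y \<le> \<delta>"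
    define z where "z = br x y"
    have z: "Ws x z" "Wu y z" using br_mem[of x y] xy \<delta> by (auto simp: z_def)
    have yz: "dist y z \<le> \<epsilon> / Lip ^ N" using \<delta>(3)[OF xy] by (simp add: z_def)
    have fwd: "dist ((f ^^ i) y) ((f ^^ i) z) \<le> \<epsilon>" if "i \<le> N" for i
    proof -
      have "dist ((f ^^ i) y) ((f ^^ i) z) \<le> Lip ^ i * dist y z" by (rule lipschitz_iterate)
      also have "\<dots> \<le> Lip ^ N * (\<epsilon> / Lip ^ N)"
        using pos that yz by (intro mult_mono power_increasing) auto
      also have "\<dots> = \<epsilon>" using pos by simp
      finally show ?thesis .
    qed
    have "Wu ((f ^^ N) y) ((f ^^ N) z)"
      unfolding Wu_def
    proof
      fix n
      show "dist ((g ^^ n) ((f ^^ N) y)) ((g ^^ n) ((f ^^ N) z)) \<le> \<epsilon>"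
      proof (cases "n \<le> N")
        case True
        then show ?thesis using fwd[of "N - n"] by (simp add: iterate_g_f_le)
      next
        case False
        then show ?thesis using z(2) by (simp add: iterate_g_f_ge Wu_def)
      qed
    qed
    from unstable[OF this, of N]
    have "dist y z \<le> C * exp (- lam * real N) * dist ((f ^^ N) y) ((f ^^ N) z)" by simp
    also have "\<dots> \<le> 1/2 * dist ((f ^^ N) y) ((f ^^ N) z)" using N by (intro mult_right_mono) auto
    finally have 1: "2 * dist y z \<le> dist ((f ^^ N) y) ((f ^^ N) z)" by simp
    have "dist ((f ^^ N) x) ((f ^^ N) z) \<le> C * exp (- lam * real N) * dist x z"
      by (rule stable[OF z(1)])
    also have "\<dots> \<le> 1/2 * dist x z" using N by (intro mult_right_mono) auto
    finally have 2: "2 * dist ((f ^^ N) x) ((f ^^ N) z) \<le> dist x z" by simp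
    have 3: "dist ((f ^^ N) x) ((f ^^ N) y) \<le> Lip ^ N * dist x y" by (rule lipschitz_iterate)
    have 4: "dist ((f ^^ N) y) ((f ^^ N) z) \<le> dist ((f ^^ N) x) ((f ^^ N) y) + dist ((f ^^ N) x) ((f ^^ N) z)"
      using dist_triangle[of "(f ^^ N) y" "(f ^^ N) z" "(f ^^ N) x"] by (simp add: dist_commute)
    have 5: "dist x z \<le> dist x y + dist y z" by (rule dist_triangle)
    have 6: "dist x y \<le> Lip ^ N * dist x y" using LN mult_right_mono[OF LN, of "dist x y"] by simp
    \<comment> \<open>With r = d(x, y): 2 d(y, z) \<le> Lip ^ N r + d(x, z) / 2 and d(x, z) \<le> r
      + d(y, z) give 3/2 d(y, z) \<le> (Lip ^ N + 1/2) r, where r / 2 \<le> Lip ^ N r / 2.\<close>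
    have 7: "dist y z \<le> Lip ^ N * dist x y" using 1 2 3 4 5 6 by linarith
    then have "dist y z \<le> (Lip ^ N + 1) * dist x y" "dist x z \<le> (Lip ^ N + 1) * dist x y"
      using 5 zero_le_dist[of x y] by (simp_all only: distrib_right mult_1)
    then show "\<exists>z. Ws x z \<and> Wu y z \<and> dist x z \<le> (Lip ^ N + 1) * dist x y \<and> dist y z \<le> (Lip ^ N + 1) * dist x y"
      using z by blast
  qed
qed

text \<open>Anosov closing with exponential bounds. Bracketing \<open>y\<close> with the k-th image
  of the previous point gives points \<open>yy j\<close> whose backward orbits can be chained; a
  limit \<open>q'\<close> follows the segment of \<open>y\<close> over and over in forward time. It
  need not be periodic, but it shares a local stable set with its image under \<open>f ^^ k\<close>,
  so its iterates accumulate at a fixed point \<open>p\<close> of \<open>f ^^ k\<close>. A last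
  bracket of \<open>y\<close> with \<open>p\<close> splits the error into parts decaying from either
  end.\<close>

lemma closing:
  obtains K \<delta> and N :: nat where "1 \<le> K" "0 < \<delta>"
    "\<And>y k. \<lbrakk>N \<le> k; 0 < k; dist y ((f ^^ k) y) \<le> \<delta>\<rbrakk> \<Longrightarrow> \<exists>q. (f ^^ k) q = q \<and>
      (\<forall>i\<le>k. dist ((f ^^ i) y) ((f ^^ i) q) \<le>
        K * (exp (- lam * real i) + exp (- lam * real (k - i))) * dist y ((f ^^ k) y))"
proof -
  obtain K0 \<delta>1 where K0: "1 \<le> K0" "0 < \<delta>1" "\<And>x y. dist x y \<le> \<delta>1 \<Longrightarrow>
    \<exists>z. Ws x z \<and> Wu y z \<and> dist x z \<le> K0 * dist x y \<and> dist y z \<le> K0 * dist x y"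
    by (rule br_lipschitz) (rule that)
  obtain N where N: "\<And>n. N \<le> n \<Longrightarrow> C * exp (- lam * real n) \<le> 1 / (4 * K0)"
    using exp_small[of "1 / (4 * K0)"] K0 by auto
  \<comment> \<open>4 C K0 for the chained pull-backs (\<open>chain\<close>) plus 2 C K0 for the
    stable displacement from \<open>y\<close> to \<open>yy l\<close>.\<close>
  define E where "E = 6 * C * K0"
  have CK1: "1 \<le> C * K0" using mult_mono[of 1 C 1 K0] pos(1) K0(1) by simp
  have E1: "1 \<le> E" unfolding E_def using CK1 by linarith
  \<comment> \<open>Large enough for C K0 E d + E d, the displacement in the final bracket.\<close>
  define M where "M = 2 * C * K0 * E"
  have ME: "2 * E \<le> M" unfolding M_def using mult_right_mono[OF CK1, of "2 * E"] E1 by (simp add: algebra_simps)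
  define \<delta> where "\<delta> = min \<epsilon> \<delta>1 / M"
  have \<delta>: "0 < \<delta>" "M * \<delta> \<le> \<epsilon>" "M * \<delta> \<le> \<delta>1"
    using pos(2) K0(2) ME E1 by (simp_all add: \<delta>_def)
  have main: "\<exists>q. (f ^^ k) q = q \<and>
      (\<forall>i\<le>k. dist ((f ^^ i) y) ((f ^^ i) q) \<le>
        C * M * (exp (- lam * real i) + exp (- lam * real (k - i))) * dist y ((f ^^ k) y))"
    if k: "N \<le> k" "0 < k" and d\<delta>: "dist y ((f ^^ k) y) \<le> \<delta>" for y k
  proof -
    define d where "d = dist y ((f ^^ k) y)"
    have d0: "0 \<le> d" by (simp add: d_def)
    have Md: "M * d \<le> \<epsilon>" "M * d \<le> \<delta>1"
    proof -
      have "M * d \<le> M * \<delta>" unfolding d_def using d\<delta> ME E1 by (intro mult_left_mono) auto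
      then show "M * d \<le> \<epsilon>" "M * d \<le> \<delta>1" using \<delta>(2,3) by linarith+
    qed
    have Ed: "2 * (E * d) \<le> M * d" using mult_right_mono[OF ME d0] by simp
    have dE: "d \<le> E * d" using mult_right_mono[OF E1 d0] by simp
    have small: "C * exp (- lam * real k) \<le> 1 / (4 * K0)" by (rule N[OF k(1)])
    have half: "exp (- lam * real k) \<le> 1/2"
    proof -
      have "exp (- lam * real k) \<le> C * exp (- lam * real k)" using pos by simp
      also have "\<dots> \<le> 1 / (4 * K0)" by (rule small)
      also have "\<dots> \<le> 1/2" using K0(1) by (simp add: field_simps)
      finally show ?thesis .
    qed
    let ?P = "\<lambda>v. Ws y v \<and> dist y v \<le> 2 * K0 * d"
    let ?Q = "\<lambda>v w. Wu ((f ^^ k) v) w \<and> dist ((f ^^ k) v) w \<le> 2 * K0 * d"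
    \<comment> \<open>The bound reproduces itself: a stable displacement 2 K0 d is at most d after k
      steps, so \<open>y\<close> and the image of \<open>v\<close> are at most 2 d apart, and their
      bracket is again within 2 K0 d.\<close>
    have step: "\<exists>w. ?P w \<and> ?Q v w" if v: "?P v" for v
    proof -
      have "dist ((f ^^ k) y) ((f ^^ k) v) \<le> C * exp (- lam * real k) * dist y v"
        using stable v by blast
      also have "\<dots> \<le> 1 / (4 * K0) * (2 * K0 * d)"
        using small v K0 by (intro mult_mono) auto
      also have "\<dots> \<le> d" using K0 d0 by (simp add: field_simps)
      finally have yv: "dist y ((f ^^ k) v) \<le> 2 * d"
        using dist_triangle[of y "(f ^^ k) v" "(f ^^ k) y"] by (simp add: d_def)
      then obtain w where w: "Ws y w" "Wu ((f ^^ k) v) w" "dist y w \<le> K0 * dist y ((f ^^ k) v)"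
        "dist ((f ^^ k) v) w \<le> K0 * dist y ((f ^^ k) v)"
        using K0(3)[of y "(f ^^ k) v"] Md Ed dE by auto
      moreover have "K0 * dist y ((f ^^ k) v) \<le> 2 * K0 * d"
        using mult_left_mono[OF yv, of K0] K0 by simp
      ultimately show ?thesis by (intro exI[of _ w]) auto
    qed
    have "\<exists>yy. \<forall>n. ?P (yy n) \<and> ?Q (yy n) (yy (Suc n))"
    proof (rule dependent_nat_choice)
      have "?P y" using Ws_refl K0 d0 by simp
      then show "\<exists>v. ?P v" by blast
    qed (rule step)
    then obtain yy where yy: "\<And>n. ?P (yy n)" "\<And>n. ?Q (yy n) (yy (Suc n))"
      by blast
    \<comment> \<open>Each jump of size 2 K0 d is pulled back along an unstable set; the one
      numbered s, counted from 0, contributes at most 2 C K0 d / 2 ^ s.\<close>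
    have chain: "dist ((f ^^ i) ((g ^^ (s * k)) (yy (l + s)))) ((f ^^ i) (yy l)) \<le> 4 * C * K0 * d * (1 - (1/2) ^ s)"
      if "i \<le> k" for s l i
    proof (induction s)
      case (Suc s)
      let ?v = "yy (l + s)" and ?w = "yy (l + Suc s)"
      have le: "i \<le> Suc s * k" using that by simp
      have e1: "(f ^^ i) ((g ^^ (Suc s * k)) ?w) = (g ^^ (Suc s * k - i)) ?w"
        by (rule iterate_f_g_le[OF le])
      have e2: "(f ^^ i) ((g ^^ (s * k)) ?v) = (g ^^ (Suc s * k - i)) ((f ^^ k) ?v)"
      proof -
        have "(g ^^ (s * k)) ?v = (g ^^ (Suc s * k)) ((f ^^ k) ?v)"
          by (subst iterate_g_f_ge) auto
        then show ?thesis by (simp only: iterate_f_g_le[OF le])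
      qed
      have "dist ((g ^^ (Suc s * k - i)) ((f ^^ k) ?v)) ((g ^^ (Suc s * k - i)) ?w) \<le>
          C * exp (- lam * real (Suc s * k - i)) * dist ((f ^^ k) ?v) ?w"
        using yy(2)[of "l + s"] by (intro unstable) simp
      moreover have "\<dots> \<le> C * (1/2) ^ s * (2 * K0 * d)"
      proof (intro mult_mono)
        have "exp (- lam * real (Suc s * k - i)) \<le> exp (real s * (- lam * real k))"
        proof -
          have "real s * real k \<le> real (Suc s * k - i)" using that by (simp add: of_nat_diff)
          then have "lam * (real s * real k) \<le> lam * real (Suc s * k - i)" using pos by (intro mult_left_mono) auto
          then show ?thesis by (simp add: mult_ac)
        qed
        also have "\<dots> = exp (- lam * real k) ^ s" by (rule exp_of_nat_mult)
        also have "\<dots> \<le> (1/2) ^ s" using half by (intro power_mono) auto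
        finally show "exp (- lam * real (Suc s * k - i)) \<le> (1/2) ^ s" .
        show "dist ((f ^^ k) ?v) ?w \<le> 2 * K0 * d" using yy(2)[of "l + s"] by simp
      qed (use pos K0 d0 in auto)
      moreover have "dist ((g ^^ (Suc s * k - i)) ?w) ((f ^^ i) (yy l)) \<le>
        dist ((g ^^ (Suc s * k - i)) ((f ^^ k) ?v)) ((g ^^ (Suc s * k - i)) ?w) +
        dist ((g ^^ (Suc s * k - i)) ((f ^^ k) ?v)) ((f ^^ i) (yy l))"
        using dist_triangle[of "(g ^^ (Suc s * k - i)) ?w" "(f ^^ i) (yy l)" "(g ^^ (Suc s * k - i)) ((f ^^ k) ?v)"]
        by (simp only: dist_commute)
      ultimately have "dist ((f ^^ i) ((g ^^ (Suc s * k)) ?w)) ((f ^^ i) (yy l)) \<le>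
        C * (1/2) ^ s * (2 * K0 * d) + 4 * C * K0 * d * (1 - (1/2) ^ s)"
        using Suc unfolding e1 e2 by linarith
      also have "\<dots> = 4 * C * K0 * d * (1 - (1/2) ^ Suc s)" by (simp add: algebra_simps)
      finally show ?case .
    qed simp
    \<comment> \<open>The orbit of \<open>q j\<close> passes near \<open>y\<close> at the times 0,
      k, ..., j k.\<close>
    define q where "q j = (g ^^ (j * k)) (yy j)" for j
    have q: "dist ((f ^^ (l * k + i)) (q j)) ((f ^^ i) y) \<le> E * d" if "l \<le> j" "i \<le> k" for l j i
    proof -
      have "(f ^^ (l * k)) (q j) = (g ^^ ((j - l) * k)) (yy (l + (j - l)))"
        unfolding q_def using that by (subst iterate_f_g_le) (auto simp: diff_mult_distrib)
      then have "(f ^^ (l * k + i)) (q j) = (f ^^ i) ((g ^^ ((j - l) * k)) (yy (l + (j - l))))"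
        by (simp only: add.commute[of "l * k"] funpow_add o_apply)
      then have "dist ((f ^^ (l * k + i)) (q j)) ((f ^^ i) (yy l)) \<le> 4 * C * K0 * d * (1 - (1/2) ^ (j - l))"
        using chain[OF that(2), of "j - l" l] by simp
      also have "\<dots> \<le> 4 * C * K0 * d"
        using pos K0 d0 by (intro mult_left_le) auto
      finally have 1: "dist ((f ^^ (l * k + i)) (q j)) ((f ^^ i) (yy l)) \<le> 4 * C * K0 * d" .
      have "dist ((f ^^ i) y) ((f ^^ i) (yy l)) \<le> C * exp (- lam * real i) * dist y (yy l)"
        using yy(1) stable by blast
      also have "\<dots> \<le> C * 1 * (2 * K0 * d)"
        using pos yy(1)[of l] by (intro mult_mono) auto
      finally show ?thesis
        using 1 dist_triangle[of "(f ^^ (l * k + i)) (q j)" "(f ^^ i) y" "(f ^^ i) (yy l)"]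
        by (simp add: dist_commute E_def algebra_simps)
    qed
    obtain q' s where s: "strict_mono (s :: nat \<Rightarrow> nat)" "(q \<circ> s) \<longlonglongrightarrow> q'"
      by (rule convergent_subseq)
    have q': "dist ((f ^^ (l * k + i)) q') ((f ^^ i) y) \<le> E * d" if "i \<le> k" for l i
    proof (rule LIMSEQ_le_const2)
      show "(\<lambda>j. dist ((f ^^ (l * k + i)) ((q \<circ> s) j)) ((f ^^ i) y)) \<longlonglongrightarrow> dist ((f ^^ (l * k + i)) q') ((f ^^ i) y)"
        by (intro tendsto_dist tendsto_iterate s tendsto_const)
      have "dist ((f ^^ (l * k + i)) ((q \<circ> s) j)) ((f ^^ i) y) \<le> E * d" if "l \<le> j" for j
        using q[OF _ \<open>i \<le> k\<close>, of l "s j"] le_trans[OF that seq_suble[OF s(1)]] by simp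
      then show "\<exists>N. \<forall>j\<ge>N. dist ((f ^^ (l * k + i)) ((q \<circ> s) j)) ((f ^^ i) y) \<le> E * d"
        by blast
    qed
    \<comment> \<open>Both forward orbits stay within E d of the same repeated segment of
      \<open>y\<close>, hence within \<epsilon> of each other.\<close>
    have "Ws q' ((f ^^ k) q')"
      unfolding Ws_def
    proof
      fix m
      let ?i = "m mod k" and ?l = "m div k"
      have i: "?i \<le> k" using k by (simp add: less_imp_le)
      have "(f ^^ m) q' = (f ^^ (?l * k + ?i)) q'" by simp
      moreover have "(f ^^ m) ((f ^^ k) q') = (f ^^ (Suc ?l * k + ?i)) q'"
      proof -
        have "Suc ?l * k + ?i = m + k" by simp
        then show ?thesis by (simp only: funpow_add o_apply)
      qed
      ultimately have "dist ((f ^^ m) q') ((f ^^ m) ((f ^^ k) q')) \<le> E * d + E * d"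
        using dist_le_add[OF q'[OF i, of ?l] q'[OF i, of "Suc ?l", unfolded dist_commute[of _ "(f ^^ ?i) y"]]]
        by (simp only:)
      then show "dist ((f ^^ m) q') ((f ^^ m) ((f ^^ k) q')) \<le> \<epsilon>" using Ed Md by linarith
    qed
    note st = stable[OF this]
    obtain p t where t: "strict_mono (t :: nat \<Rightarrow> nat)" "((\<lambda>l. (f ^^ (l * k)) q') \<circ> t) \<longlonglongrightarrow> p"
      by (rule convergent_subseq)
    have "(f ^^ k) p = p"
    proof -
      let ?X = "\<lambda>l. (f ^^ (t l * k)) q'"
      have X: "?X \<longlonglongrightarrow> p" using t by (simp add: comp_def)
      have "(\<lambda>l. dist (?X l) ((f ^^ k) (?X l))) \<longlonglongrightarrow> dist p ((f ^^ k) p)"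
        by (intro tendsto_dist X tendsto_iterate)
      moreover have "(\<lambda>l. dist (?X l) ((f ^^ k) (?X l))) \<longlonglongrightarrow> 0"
      proof (rule tendsto_sandwich[of "\<lambda>_. 0" _ _ "\<lambda>l. (C * dist q' ((f ^^ k) q')) * exp (- lam) ^ l"])
        show "\<forall>\<^sub>F l in sequentially. dist (?X l) ((f ^^ k) (?X l)) \<le> (C * dist q' ((f ^^ k) q')) * exp (- lam) ^ l"
        proof (intro always_eventually allI)
          fix l
          have "(f ^^ k) (?X l) = (f ^^ (t l * k)) ((f ^^ k) q')"
            using fun_cong[OF funpow_add[of k "t l * k" f], of q'] fun_cong[OF funpow_add[of "t l * k" k f], of q']
            by (simp add: add.commute)
          then have "dist (?X l) ((f ^^ k) (?X l)) = dist (?X l) ((f ^^ (t l * k)) ((f ^^ k) q'))"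
            by (simp only:)
          also have "\<dots> \<le> C * exp (- lam * real (t l * k)) * dist q' ((f ^^ k) q')" by (rule st)
          also have "\<dots> \<le> C * exp (- lam) ^ l * dist q' ((f ^^ k) q')"
          proof (intro mult_right_mono mult_left_mono)
            have "l \<le> t l * k" using mult_le_mono[of l "t l" 1 k] seq_suble[OF t(1), of l] k by simp
            then have "lam * real l \<le> lam * real (t l * k)"
              using pos by (intro mult_left_mono of_nat_mono) auto
            then show "exp (- lam * real (t l * k)) \<le> exp (- lam) ^ l"
              by (simp add: exp_of_nat_mult[symmetric] mult_ac)
          qed (use pos in auto)
          finally show "dist (?X l) ((f ^^ k) (?X l)) \<le> (C * dist q' ((f ^^ k) q')) * exp (- lam) ^ l"
            by (simp add: mult_ac)
        qed
        show "(\<lambda>l. (C * dist q' ((f ^^ k) q')) * exp (- lam) ^ l) \<longlonglongrightarrow> 0"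
          using pos by (intro tendsto_mult_right_zero LIMSEQ_realpow_zero) auto
      qed auto
      ultimately have "dist p ((f ^^ k) p) = 0" by (rule LIMSEQ_unique)
      then show ?thesis by simp
    qed
    have p: "dist ((f ^^ i) p) ((f ^^ i) y) \<le> E * d" if "i \<le> k" for i
    proof (rule LIMSEQ_le_const2)
      show "(\<lambda>j. dist ((f ^^ i) (((\<lambda>l. (f ^^ (l * k)) q') \<circ> t) j)) ((f ^^ i) y)) \<longlonglongrightarrow> dist ((f ^^ i) p) ((f ^^ i) y)"
        by (intro tendsto_dist tendsto_iterate t tendsto_const)
      show "\<exists>N. \<forall>j\<ge>N. dist ((f ^^ i) (((\<lambda>l. (f ^^ (l * k)) q') \<circ> t) j)) ((f ^^ i) y) \<le> E * d"
      proof -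
        have "(f ^^ i) ((f ^^ (l * k)) q') = (f ^^ (l * k + i)) q'" for l
          by (simp only: add.commute[of "l * k"] funpow_add o_apply)
        then show ?thesis using q'[OF that] by simp
      qed
    qed
    have yp: "dist y p \<le> E * d" using p[of 0] by (simp add: dist_commute)
    \<comment> \<open>The stable part from \<open>y\<close> to \<open>z\<close> decays from time 0
      on; the unstable part from \<open>p\<close> to \<open>z\<close> is estimated backwards from
      time k.\<close>
    obtain z where z: "Ws y z" "Wu p z" "dist y z \<le> K0 * dist y p" "dist p z \<le> K0 * dist y p"
    proof -
      have "dist y p \<le> \<delta>1" using yp Ed Md d0 E1 mult_nonneg_nonneg[of E d] by linarith
      then show ?thesis using K0(3) that by blast
    qed
    have "K0 * dist y p \<le> K0 * (E * d)" using yp K0 by (intro mult_left_mono) auto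
    then have yz: "dist y z \<le> K0 * (E * d)" using z by linarith
    have M2: "C * (K0 * (E * d)) + E * d \<le> M * d"
    proof -
      have "E * d \<le> (C * K0) * (E * d)" using mult_right_mono[OF CK1, of "E * d"] E1 d0 by simp
      then show ?thesis by (simp add: M_def mult_ac)
    qed
    have fyz: "dist ((f ^^ i) y) ((f ^^ i) z) \<le> exp (- lam * real i) * (C * (K0 * (E * d)))" for i
      using order_trans[OF stable[OF z(1), of i] mult_left_mono[OF yz, of "C * exp (- lam * real i)"]] pos
      by (simp add: mult_ac)
    have fpz: "dist ((f ^^ i) p) ((f ^^ i) z) \<le> M * d" if "i \<le> k" for i
    proof -
      have "dist ((f ^^ i) p) ((f ^^ i) z) \<le> E * d + exp (- lam * real i) * (C * (K0 * (E * d)))"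
        by (rule dist_le_add[OF p[OF that] fyz])
      also have "\<dots> \<le> E * d + 1 * (C * (K0 * (E * d)))"
        using pos K0 E1 d0 by (intro add_left_mono mult_right_mono) auto
      finally show ?thesis using M2 by simp
    qed
    have "Wu ((f ^^ k) p) ((f ^^ k) z)"
      unfolding Wu_def
    proof
      fix n
      show "dist ((g ^^ n) ((f ^^ k) p)) ((g ^^ n) ((f ^^ k) z)) \<le> \<epsilon>"
      proof (cases "n \<le> k")
        case True
        then show ?thesis using fpz[of "k - n"] Md by (simp add: iterate_g_f_le)
      next
        case False
        then show ?thesis using z(2) by (simp add: iterate_g_f_ge Wu_def)
      qed
    qed
    note un = unstable[OF this]
    show ?thesis
    proof (intro exI conjI allI impI)
      show "(f ^^ k) p = p" by fact
      fix i assume i: "i \<le> k"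
      have "dist ((f ^^ i) p) ((f ^^ i) z) \<le> C * exp (- lam * real (k - i)) * dist ((f ^^ k) p) ((f ^^ k) z)"
        using un[of "k - i"] i by (simp add: iterate_g_f_le)
      also have "\<dots> \<le> C * exp (- lam * real (k - i)) * (M * d)"
        using pos fpz[of k] by (intro mult_left_mono) auto
      finally have pz: "dist ((f ^^ i) p) ((f ^^ i) z) \<le> C * exp (- lam * real (k - i)) * (M * d)" .
      have "C * (K0 * (E * d)) \<le> C * (M * d)"
      proof (intro mult_left_mono)
        have "1 * (K0 * (E * d)) \<le> C * (K0 * (E * d))"
          using pos K0 E1 d0 by (intro mult_right_mono) auto
        then show "K0 * (E * d) \<le> M * d" using M2 d0 E1 mult_nonneg_nonneg[of E d] by linarith
      qed (use pos in auto)
      from order_trans[OF fyz[of i] mult_left_mono[OF this, of "exp (- lam * real i)"]]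
      have "dist ((f ^^ i) y) ((f ^^ i) z) \<le> exp (- lam * real i) * (C * (M * d))" by simp
      then have "dist ((f ^^ i) y) ((f ^^ i) p) \<le>
          exp (- lam * real i) * (C * (M * d)) + C * exp (- lam * real (k - i)) * (M * d)"
        using dist_le_add[OF _ pz[unfolded dist_commute[of "(f ^^ i) p"]]] by simp
      then show "dist ((f ^^ i) y) ((f ^^ i) p) \<le>
          C * M * (exp (- lam * real i) + exp (- lam * real (k - i))) * dist y ((f ^^ k) y)"
        by (simp add: d_def algebra_simps)
    qed
  qed
  have "1 \<le> C * M" using mult_mono[of 1 C 1 M] pos ME E1 by simp
  then show ?thesis by (rule that[OF _ \<delta>(1) main])
qed

text \<open>Compactness makes two iterates at different multiples of N + 1 close to each other, and
  their return time is long enough for \<open>closing\<close>.\<close>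

lemma periodic_point: obtains p k where "0 < k" "(f ^^ k) p = (p :: 'a)"
proof -
  obtain K \<delta> and N :: nat where cl: "1 \<le> K" "0 < \<delta>"
    "\<And>y k. \<lbrakk>N \<le> k; 0 < k; dist y ((f ^^ k) y) \<le> \<delta>\<rbrakk> \<Longrightarrow> \<exists>q. (f ^^ k) q = q \<and>
      (\<forall>i\<le>k. dist ((f ^^ i) y) ((f ^^ i) q) \<le>
        K * (exp (- lam * real i) + exp (- lam * real (k - i))) * dist y ((f ^^ k) y))"
    by (rule closing) (rule that)
  fix x :: 'a
  let ?X = "\<lambda>n. (f ^^ (n * Suc N)) x"
  obtain l s where "strict_mono (s :: nat \<Rightarrow> nat)" "(?X \<circ> s) \<longlonglongrightarrow> l"
    by (rule convergent_subseq)
  then have "Cauchy (?X \<circ> s)" and s: "strict_mono s" by (auto intro: LIMSEQ_imp_Cauchy)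
  then obtain M where M: "\<And>m n. \<lbrakk>M \<le> m; M \<le> n\<rbrakk> \<Longrightarrow> dist (?X (s m)) (?X (s n)) < \<delta>"
    using cl(2) unfolding Cauchy_def comp_def by blast
  have lt: "s M < s (Suc M)" using s by (simp add: strict_mono_Suc_iff)
  define k where "k = (s (Suc M) - s M) * Suc N"
  have k: "N \<le> k" "0 < k" using lt by (cases "s (Suc M) - s M"; simp add: k_def)+
  have "s (Suc M) * Suc N = k + s M * Suc N"
    using lt by (simp add: k_def add_mult_distrib[symmetric] del: mult_Suc_right)
  then have "?X (s (Suc M)) = (f ^^ k) (?X (s M))"
    by (simp only: funpow_add o_apply)
  then obtain q where "(f ^^ k) q = q"
    using cl(3)[OF k, of "?X (s M)"] M[of M "Suc M"] by auto
  then show ?thesis using that k by blast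
qed

end

section \<open>Homoclinic points of a periodic orbit and their density\<close>

context hyperbolic
begin

text \<open>The indices \<open>i\<close> and \<open>j\<close> are the times after which the backward orbit (in \<open>Us p i x\<close>) and the
  forward orbit (in \<open>Ss p j x\<close>) of \<open>x\<close> approach \<open>p\<close> itself rather than another point of its orbit.\<close>

definition Us :: "'a \<Rightarrow> nat \<Rightarrow> 'a \<Rightarrow> bool" where
  "Us p i x \<longleftrightarrow> (\<exists>c. \<forall>n. dist ((g ^^ n) x) ((g ^^ n) ((f ^^ i) p)) \<le> c * exp (- lam * real n))"

definition Ss :: "'a \<Rightarrow> nat \<Rightarrow> 'a \<Rightarrow> bool" where
  "Ss p j x \<longleftrightarrow> (\<exists>c. \<forall>n. dist ((f ^^ n) x) ((f ^^ n) ((g ^^ j) p)) \<le> c * exp (- lam * real n))"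

text \<open>Asymptotics with an arbitrary constant, instead of membership in local sets, make the
  set forward invariant and admit points that approach the orbit late.\<close>

definition Hom :: "'a \<Rightarrow> 'a set" where
  "Hom p = {x. (\<exists>i. Us p i x) \<and> (\<exists>j. Ss p j x)}"

text \<open>The first m distances are bounded by compactness and absorbed into the constant.\<close>

lemma exp_decay_shift:
  fixes u v :: "nat \<Rightarrow> 'a"
  assumes "\<And>n. dist (u (n + m)) (v (n + m)) \<le> c * exp (- lam * real n)"
  shows "\<exists>c'. \<forall>n. dist (u n) (v n) \<le> c' * exp (- lam * real n)"
proof -
  obtain R where R: "0 \<le> R" "\<And>x y :: 'a. dist x y \<le> R"
    by (rule dist_bounded) (rule that)
  have c: "0 \<le> c" using order_trans[OF zero_le_dist assms[of 0]] by simp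
  have "dist (u n) (v n) \<le> ((R + c) * exp (lam * real m)) * exp (- lam * real n)" for n
  proof (cases "m \<le> n")
    case True
    then have "dist (u n) (v n) \<le> c * exp (- lam * real (n - m))" using assms[of "n - m"] by simp
    also have "\<dots> \<le> (R + c) * exp (- lam * real (n - m))" using R by (intro mult_right_mono) auto
    also have "exp (- lam * real (n - m)) = exp (lam * real m) * exp (- lam * real n)"
      using True by (simp add: exp_add[symmetric] of_nat_diff algebra_simps)
    finally show ?thesis by (simp only: mult.assoc)
  next
    case False
    have "dist (u n) (v n) \<le> (R + c) * 1" using R(2)[of "u n" "v n"] c by simp
    also have "\<dots> \<le> (R + c) * exp (lam * real m + - lam * real n)"
      using False pos R c by (intro mult_left_mono) auto
    finally show ?thesis by (simp only: exp_add mult.assoc)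
  qed
  then show ?thesis by blast
qed

lemma Ss_Ws: assumes "Ws x z" "Ss p j x" shows "Ss p j z"
proof -
  obtain c where c: "\<And>n. dist ((f ^^ n) x) ((f ^^ n) ((g ^^ j) p)) \<le> c * exp (- lam * real n)"
    using assms(2) by (auto simp: Ss_def)
  have "dist ((f ^^ n) z) ((f ^^ n) ((g ^^ j) p)) \<le> (C * dist x z + c) * exp (- lam * real n)" for n
    using dist_le_add[OF stable[OF assms(1), of n, unfolded dist_commute[of "(f ^^ n) x" "(f ^^ n) z"]] c[of n]]
    by (simp add: algebra_simps)
  then show ?thesis unfolding Ss_def by blast
qed

lemma Us_Wu: assumes "Wu x z" "Us p i x" shows "Us p i z"
proof -
  obtain c where c: "\<And>n. dist ((g ^^ n) x) ((g ^^ n) ((f ^^ i) p)) \<le> c * exp (- lam * real n)"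
    using assms(2) by (auto simp: Us_def)
  have "dist ((g ^^ n) z) ((g ^^ n) ((f ^^ i) p)) \<le> (C * dist x z + c) * exp (- lam * real n)" for n
    using dist_le_add[OF unstable[OF assms(1), of n, unfolded dist_commute[of "(g ^^ n) x" "(g ^^ n) z"]] c[of n]]
    by (simp add: algebra_simps)
  then show ?thesis unfolding Us_def by blast
qed

lemma Us_forward: assumes "Wu p z" shows "Us p n ((f ^^ n) z)"
  unfolding Us_def
  by (rule exp_decay_shift[of _ n _ "C * dist p z"])
     (use unstable[OF assms] in \<open>simp add: iterate_g_f_ge dist_commute mult_ac\<close>)

lemma Ss_backward: assumes "Ws p z" shows "Ss p n ((g ^^ n) z)"
  unfolding Ss_def
proof (rule exp_decay_shift[of _ n _ "C * dist p z"])
  fix m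
  have "(f ^^ (m + n)) ((g ^^ n) y) = (f ^^ m) y" for y
    by (simp add: funpow_add)
  then show "dist ((f ^^ (m + n)) ((g ^^ n) z)) ((f ^^ (m + n)) ((g ^^ n) p)) \<le> C * dist p z * exp (- lam * real m)"
    using stable[OF assms, of m] by (simp add: dist_commute mult_ac)
qed

lemma Us_f: assumes "Us p i x" shows "Us p (Suc i) (f x)"
proof -
  obtain c where c: "\<And>n. dist ((g ^^ n) x) ((g ^^ n) ((f ^^ i) p)) \<le> c * exp (- lam * real n)"
    using assms by (auto simp: Us_def)
  have "(g ^^ (n + 1)) (f y) = (g ^^ n) y" for n y
    using iterate_g_f_ge[of 1 "n + 1" y] by simp
  then show ?thesis
    unfolding Us_def by (intro exp_decay_shift[of _ 1 _ c]) (simp only: funpow.simps(2)[of i f] o_apply c)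
qed

lemma Ss_f: assumes "Ss p (Suc j) x" shows "Ss p j (f x)"
proof -
  obtain c where c: "\<And>n. dist ((f ^^ n) x) ((f ^^ n) ((g ^^ Suc j) p)) \<le> c * exp (- lam * real n)"
    using assms by (auto simp: Ss_def)
  have c0: "0 \<le> c" using order_trans[OF zero_le_dist c[of 0]] by simp
  have "dist ((f ^^ n) (f x)) ((f ^^ n) ((g ^^ j) p)) \<le> c * exp (- lam * real n)" for n
  proof -
    have "dist ((f ^^ n) (f x)) ((f ^^ n) ((g ^^ j) p)) \<le> c * exp (- lam * real (Suc n))"
      using c[of "Suc n"] by (simp only: funpow_Suc_right[of n f] funpow.simps(2)[of j g] o_apply f_g)
    also have "\<dots> \<le> c * exp (- lam * real n)" using c0 pos by (intro mult_left_mono) auto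
    finally show ?thesis .
  qed
  then show ?thesis unfolding Ss_def by blast
qed

lemma Hom_f:
  assumes "(f ^^ k) p = p" "0 < k" "x \<in> Hom p"
  shows "f x \<in> Hom p"
proof -
  obtain i j where x: "Us p i x" "Ss p j x" using assms(3) by (auto simp: Hom_def)
  \<comment> \<open>The index j can be lowered along f only if it is positive; a full period is
    added first.\<close>
  have "(g ^^ k) p = p" using iterate_g_f[of k p] assms(1) by simp
  then have "Ss p (j + k) x" using x(2) by (simp add: Ss_def funpow_add)
  then have "Ss p (j + k - 1) (f x)" using assms(2) by (intro Ss_f) simp
  then show ?thesis using Us_f[OF x(1)] unfolding Hom_def by blast
qed

text \<open>Transitivity moves a point from near \<open>p\<close> to near \<open>y\<close>; its
  bracket with \<open>p\<close> lies on the unstable set of \<open>p\<close> and has nearly the same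
  future. The stable set is dual, and the bracket of one point of each kind near \<open>y\<close> is
  homoclinic.\<close>

lemma Hom_dense:
  assumes trans: "\<And>U V :: 'a set. \<lbrakk>open U; open V; U \<noteq> {}; V \<noteq> {}\<rbrakk> \<Longrightarrow> \<exists>n. (f ^^ n) ` U \<inter> V \<noteq> {}"
    and "0 < e"
  shows "\<exists>x\<in>Hom p. dist y x < e"
proof -
  obtain K \<delta> where K: "1 \<le> K" "0 < \<delta>" "\<And>x y. dist x y \<le> \<delta> \<Longrightarrow>
    \<exists>z. Ws x z \<and> Wu y z \<and> dist x z \<le> K * dist x y \<and> dist y z \<le> K * dist x y"
    by (rule br_lipschitz) (rule that)
  have trans': "\<exists>w n. dist a w < s \<and> dist b ((f ^^ n) w) < t" if st: "0 < s" "0 < t" for a b :: 'a and s t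
  proof -
    obtain n where "(f ^^ n) ` ball a s \<inter> ball b t \<noteq> {}"
      using trans[OF open_ball open_ball, of a s b t] st by auto
    then show ?thesis by (auto simp: mem_ball)
  qed
  define s where "s e = min \<delta> (e / (2 * C * K))" for e
  have CK: "1 \<le> C * K" using mult_mono[of 1 C 1 K] pos(1) K(1) by simp
  have s: "0 < s e" "s e \<le> \<delta>" "C * (K * s e) \<le> e / 2" if "0 < e" for e
  proof -
    show "0 < s e" "s e \<le> \<delta>" using that K pos by (auto simp: s_def)
    have "C * (K * s e) \<le> C * (K * (e / (2 * C * K)))"
      using pos K by (intro mult_left_mono) (auto simp: s_def)
    then show "C * (K * s e) \<le> e / 2" using pos K by (simp add: field_simps)
  qed
  have U: "\<exists>x i. Us p i x \<and> dist y x < e" if e: "0 < e" for e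
  proof -
    obtain w n where w: "dist p w < s e" "dist y ((f ^^ n) w) < e / 2"
      using trans'[of "s e" "e / 2" p y] s[OF e] e by auto
    obtain z where z: "Ws w z" "Wu p z" "dist w z \<le> K * dist w p"
      using K(3)[of w p] w s[OF e] by (auto simp: dist_commute)
    have "dist ((f ^^ n) w) ((f ^^ n) z) \<le> C * exp (- lam * real n) * dist w z" by (rule stable[OF z(1)])
    also have "\<dots> \<le> C * 1 * (K * s e)"
    proof (intro mult_mono)
      have "K * dist w p \<le> K * s e" using w K by (intro mult_left_mono) (auto simp: dist_commute)
      then show "dist w z \<le> K * s e" using z by linarith
    qed (use pos in auto)
    finally have "dist ((f ^^ n) w) ((f ^^ n) z) \<le> e / 2" using s[OF e] by simp
    then have "dist y ((f ^^ n) z) < e"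
      using w dist_triangle[of y "(f ^^ n) z" "(f ^^ n) w"] by linarith
    then show ?thesis using Us_forward[OF z(2)] by blast
  qed
  have S: "\<exists>x j. Ss p j x \<and> dist y x < e" if e: "0 < e" for e
  proof -
    obtain w n where w: "dist y w < e / 2" "dist p ((f ^^ n) w) < s e"
      using trans'[of "e / 2" "s e" y p] s[OF e] e by auto
    let ?v = "(f ^^ n) w"
    obtain z where z: "Ws p z" "Wu ?v z" "dist ?v z \<le> K * dist p ?v"
      using K(3)[of p ?v] w s[OF e] by auto
    have "dist ((g ^^ n) ?v) ((g ^^ n) z) \<le> C * exp (- lam * real n) * dist ?v z" by (rule unstable[OF z(2)])
    also have "\<dots> \<le> C * 1 * (K * s e)"
    proof (intro mult_mono)
      have "K * dist p ?v \<le> K * s e" using w K by (intro mult_left_mono) auto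
      then show "dist ?v z \<le> K * s e" using z by linarith
    qed (use pos in auto)
    finally have "dist w ((g ^^ n) z) \<le> e / 2" using s[OF e] by simp
    then have "dist y ((g ^^ n) z) < e"
      using w dist_triangle[of y "(g ^^ n) z" w] by linarith
    then show ?thesis using Ss_backward[OF z(1)] by blast
  qed
  define r where "r = min (e / (4 * K)) (\<delta> / 2)"
  have r: "0 < r" "r \<le> e / (4 * K)" "2 * r \<le> \<delta>"
    using \<open>0 < e\<close> K by (auto simp: r_def)
  obtain x i where x: "Us p i x" "dist y x < r" using U[OF r(1)] by blast
  obtain x' j where x': "Ss p j x'" "dist y x' < r" using S[OF r(1)] by blast
  have x'x: "dist x' x < 2 * r"
    using x(2) x'(2) dist_triangle[of x' x y] by (simp add: dist_commute)
  then obtain z where z: "Ws x' z" "Wu x z" "dist x' z \<le> K * dist x' x"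
    using K(3)[of x' x] r by auto
  have "z \<in> Hom p" using Ss_Ws[OF z(1) x'(1)] Us_Wu[OF z(2) x(1)] unfolding Hom_def by blast
  moreover have "dist y z < e"
  proof -
    have "K * dist x' x \<le> 2 * (K * r)" using mult_left_mono[of "dist x' x" "2 * r" K] x'x K by simp
    moreover have "K * r \<le> e / 4" using r(2) K(1) by (simp add: field_simps)
    moreover have "r \<le> K * r" using mult_right_mono[OF K(1), of r] r(1) by simp
    ultimately show ?thesis using z(3) x'(2) dist_triangle[of y z x'] \<open>0 < e\<close> by linarith
  qed
  ultimately show ?thesis by blast
qed

end

section \<open>The transfer map\<close>

lemma exp_powr: "0 \<le> c \<Longrightarrow> (c * exp x) powr \<nu> = c powr \<nu> * exp (\<nu> * x)" for c x \<nu> :: real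
proof -
  assume "0 \<le> c"
  then have "(c * exp x) powr \<nu> = c powr \<nu> * exp x powr \<nu>" by (simp add: powr_mult)
  also have "exp x powr \<nu> = exp (\<nu> * x)" by (simp add: powr_def)
  finally show ?thesis .
qed

text \<open>Two-sided, because a change of base point multiplies by a holonomy of \<open>A\<close>
  on the left and one of \<open>B\<close> on the right; bounding the inverses too makes the relation
  symmetric.\<close>

definition near :: "real \<Rightarrow> real ^ 'n ^ 'n \<Rightarrow> real ^ 'n ^ 'n \<Rightarrow> bool" where
  "near e S T \<longleftrightarrow> (\<exists>G H. invertible G \<and> invertible H \<and> dev G \<le> e \<and> dev (matrix_inv G) \<le> e \<and>
    dev H \<le> e \<and> dev (matrix_inv H) \<le> e \<and> S = G ** T ** H)"

lemma near_sym: "near e S T \<Longrightarrow> near e T S"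
proof -
  assume "near e S T"
  then obtain G H where GH: "invertible G" "invertible H" "dev G \<le> e" "dev (matrix_inv G) \<le> e"
    "dev H \<le> e" "dev (matrix_inv H) \<le> e" "S = G ** T ** H"
    unfolding near_def by blast
  have "T = matrix_inv G ** S ** matrix_inv H"
    unfolding GH(7) using GH(1,2) by (simp add: matrix_mul_assoc matrix_inv_cancel invertible_matrix_inv)
  then show "near e T S"
    unfolding near_def using GH
    by (intro exI[of _ "matrix_inv G"] exI[of _ "matrix_inv H"]) (simp add: invertible_matrix_inv matrix_inv_matrix_inv)
qed

lemma dev_mult_le: "\<lbrakk>dev S \<le> e; dev T \<le> e\<rbrakk> \<Longrightarrow> dev (S ** T) \<le> (1 + e) ^ 2 - 1"
  using dev_mult[of S T] mult_mono[of "1 + dev S" "1 + e" "1 + dev T" "1 + e"] dev_nonneg[of S] dev_nonneg[of T]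
  by (simp add: power2_eq_square)

lemma near_trans:
  assumes "near e S T" "near e T U"
  shows "near ((1 + e) ^ 2 - 1) S U"
proof -
  obtain G H where GH: "invertible G" "invertible H" "dev G \<le> e" "dev (matrix_inv G) \<le> e"
    "dev H \<le> e" "dev (matrix_inv H) \<le> e" "S = G ** T ** H"
    using assms(1) unfolding near_def by blast
  obtain G' H' where GH': "invertible G'" "invertible H'" "dev G' \<le> e" "dev (matrix_inv G') \<le> e"
    "dev H' \<le> e" "dev (matrix_inv H') \<le> e" "T = G' ** U ** H'"
    using assms(2) unfolding near_def by blast
  show ?thesis
    unfolding near_def
    by (intro exI[of _ "G ** G'"] exI[of _ "H' ** H"])
       (simp add: GH GH' invertible_mult matrix_inv_mult matrix_mul_assoc dev_mult_le)
qed

lemma near_bounds: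
  assumes "near e S T" "invertible T" "e \<le> 1"
  shows "opnorm S \<le> 4 * opnorm T" "opnorm (matrix_inv S) \<le> 4 * opnorm (matrix_inv T)"
    "opnorm (S - T) \<le> 3 * e * opnorm T"
proof -
  obtain G H where GH: "invertible G" "invertible H" "dev G \<le> e" "dev (matrix_inv G) \<le> e"
    "dev H \<le> e" "dev (matrix_inv H) \<le> e" "S = G ** T ** H"
    using assms(1) unfolding near_def by blast
  have e0: "0 \<le> e" using GH(3) dev_nonneg[of G] by linarith
  have le2: "opnorm X \<le> 2" if "dev X \<le> e" for X :: "real ^ 'n ^ 'n"
    using opnorm_le_dev[of X] that assms(3) by linarith
  have 4: "opnorm (X ** Y ** Z) \<le> 4 * opnorm Y" if "dev X \<le> e" "dev Z \<le> e" for X Y Z :: "real ^ 'n ^ 'n"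
  proof -
    have "opnorm (X ** Y ** Z) \<le> opnorm X * opnorm Y * opnorm Z" by (rule opnorm_mult3)
    also have "\<dots> \<le> 2 * opnorm Y * 2"
      using le2[OF that(1)] le2[OF that(2)] by (intro mult_mono mult_nonneg_nonneg opnorm_nonneg) auto
    finally show ?thesis by simp
  qed
  show "opnorm S \<le> 4 * opnorm T" unfolding GH(7) by (intro 4 GH)
  have "matrix_inv S = matrix_inv H ** matrix_inv T ** matrix_inv G"
    unfolding GH(7) using GH(1,2) assms(2) by (simp add: matrix_inv_mult invertible_mult matrix_mul_assoc)
  then show "opnorm (matrix_inv S) \<le> 4 * opnorm (matrix_inv T)" using 4 GH by simp
  have "S - T = (G - mat 1) ** T ** H + T ** (H - mat 1)"
    unfolding GH(7) by (simp add: matrix_diff_ldistrib matrix_diff_rdistrib)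
  then have "opnorm (S - T) \<le> opnorm ((G - mat 1) ** T ** H) + opnorm (T ** (H - mat 1))"
    by (simp only: opnorm_triangle)
  also have "\<dots> \<le> dev G * opnorm T * opnorm H + opnorm T * dev H"
    unfolding dev_def by (intro add_mono opnorm_mult3 opnorm_mult)
  also have "\<dots> \<le> e * opnorm T * 2 + opnorm T * e"
    using GH e0 le2[OF GH(5)]
    by (intro add_mono mult_mono mult_nonneg_nonneg opnorm_nonneg order_refl dev_nonneg) auto
  finally show "opnorm (S - T) \<le> 3 * e * opnorm T" by (simp add: algebra_simps)
qed

text \<open>By their uniform bound the inverses are Hoelder on \<open>X\<close> as well. Both maps
  extend, and the relation that their product is the identity passes to the limit, which keeps the
  extension invertible.\<close>

lemma holder_extension:
  fixes P :: "'a::metric_space \<Rightarrow> real ^ 'n ^ 'n"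
  assumes "0 < \<nu>" "0 \<le> M" and dense: "closure X = UNIV"
    and inv: "\<And>x. x \<in> X \<Longrightarrow> invertible (P x)"
    and bounded: "\<And>x. x \<in> X \<Longrightarrow> opnorm (matrix_inv (P x)) \<le> R"
    and holder: "\<And>x y. \<lbrakk>x \<in> X; y \<in> X\<rbrakk> \<Longrightarrow> opnorm (P x - P y) \<le> M * dist x y powr \<nu>"
  obtains P' where "\<And>x. x \<in> X \<Longrightarrow> P' x = P x" "\<And>x. invertible (P' x)" "continuous_on UNIV P'"
    "\<And>x y. opnorm (P' x - P' y) \<le> M * dist x y powr \<nu>"
proof -
  have uc: "uniformly_continuous_on X F"
    if F: "\<And>x y. \<lbrakk>x \<in> X; y \<in> X\<rbrakk> \<Longrightarrow> opnorm (F x - F y) \<le> M' * dist x y powr \<nu>" and "0 \<le> M'"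
    for F :: "'a \<Rightarrow> real ^ 'n ^ 'n" and M'
  proof -
    obtain c where c: "c > 0" "\<And>T :: real ^ 'n ^ 'n. norm T \<le> c * opnorm T"
      using opnorm_norm_equiv by metis
    show ?thesis
      unfolding uniformly_continuous_on_def
    proof (intro allI impI)
      fix e :: real assume e: "0 < e"
      define d where "d = (e / (c * (M' + 1))) powr (1 / \<nu>)"
      have d: "0 < d" "d powr \<nu> = e / (c * (M' + 1))"
        using e c \<open>0 \<le> M'\<close> \<open>0 < \<nu>\<close> by (simp_all add: d_def powr_powr)
      have "dist (F y) (F x) < e" if xy: "x \<in> X" "y \<in> X" "dist y x < d" for x y
      proof -
        have "dist (F y) (F x) \<le> c * (M' * dist y x powr \<nu>)"
          unfolding dist_norm using order_trans[OF c(2) mult_left_mono[OF F[OF xy(2,1)], of c]] c(1) by simp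
        also have "\<dots> \<le> c * (M' * d powr \<nu>)"
          using xy c \<open>0 \<le> M'\<close> \<open>0 < \<nu>\<close> by (intro mult_left_mono powr_mono2) auto
        also have "\<dots> < c * ((M' + 1) * d powr \<nu>)"
          using c(1) d(1) by (intro mult_strict_left_mono mult_strict_right_mono) simp_all
        also have "\<dots> = (c * (M' + 1)) * (e / (c * (M' + 1)))" by (simp only: d(2) mult.assoc)
        also have "\<dots> = e" 
        proof -
          have "c * (M' + 1) \<noteq> 0" using c(1) \<open>0 \<le> M'\<close> by simp
          then show ?thesis by simp
        qed
        finally show ?thesis .
      qed
      then show "\<exists>d>0. \<forall>x\<in>X. \<forall>x'\<in>X. dist x' x < d \<longrightarrow> dist (F x') (F x) < e"
        using d(1) by (intro exI[of _ d]) simp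
    qed
  qed
  have "X \<noteq> {}" using dense by auto
  then obtain x0 where x0: "x0 \<in> X" by blast
  have R: "0 \<le> R" using order_trans[OF opnorm_nonneg bounded[OF x0]] .
  have holder_inv: "opnorm (matrix_inv (P x) - matrix_inv (P y)) \<le> (R * M * R) * dist x y powr \<nu>"
    if "x \<in> X" "y \<in> X" for x y
  proof -
    have "matrix_inv (P x) - matrix_inv (P y) = matrix_inv (P x) ** (P y - P x) ** matrix_inv (P y)"
      using inv[OF that(1)] inv[OF that(2)]
      by (simp add: matrix_diff_ldistrib matrix_diff_rdistrib invertible_matrix_inv matrix_inv_cancel)
    then have "opnorm (matrix_inv (P x) - matrix_inv (P y)) \<le>
        opnorm (matrix_inv (P x)) * opnorm (P y - P x) * opnorm (matrix_inv (P y))"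
      by (simp only: opnorm_mult3)
    also have "\<dots> \<le> R * (M * dist x y powr \<nu>) * R"
      using bounded[OF that(1)] bounded[OF that(2)] holder[OF that] R \<open>0 \<le> M\<close>
      by (intro mult_mono mult_nonneg_nonneg opnorm_nonneg) (auto simp: opnorm_minus_commute[of "P y"])
    finally show ?thesis by (simp add: mult_ac)
  qed
  have uc1: "uniformly_continuous_on X P"
    by (rule uc[OF holder \<open>0 \<le> M\<close>])
  have uc2: "uniformly_continuous_on X (\<lambda>x. matrix_inv (P x))"
    by (rule uc[OF holder_inv]) (use R \<open>0 \<le> M\<close> in simp_all)
  obtain P1 where P1: "uniformly_continuous_on (closure X) P1" "\<And>x. x \<in> X \<Longrightarrow> P x = P1 x"
    by (rule uniformly_continuous_on_extension_on_closure[OF uc1]) (rule that)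
  obtain P2 where P2: "uniformly_continuous_on (closure X) P2" "\<And>x. x \<in> X \<Longrightarrow> matrix_inv (P x) = P2 x"
    by (rule uniformly_continuous_on_extension_on_closure[OF uc2]) (rule that)
  have cont: "continuous_on UNIV P1" "continuous_on UNIV P2"
    by (rule uniformly_continuous_imp_continuous[OF P1(1)[unfolded dense]]
        uniformly_continuous_imp_continuous[OF P2(1)[unfolded dense]])+
  have lim: "(\<lambda>n. P1 (u n)) \<longlonglongrightarrow> P1 x" "(\<lambda>n. P2 (u n)) \<longlonglongrightarrow> P2 x" if "u \<longlonglongrightarrow> x" for u x
    by (rule continuous_on_tendsto_compose[OF cont(1) that] continuous_on_tendsto_compose[OF cont(2) that]; simp)+
  have approx: "\<exists>u. (\<forall>n. u n \<in> X) \<and> u \<longlonglongrightarrow> x" for x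
    by (simp only: closure_sequential[symmetric] dense UNIV_I)
  show ?thesis
  proof
    show "P1 x = P x" if "x \<in> X" for x using P1(2)[OF that] by simp
    show "continuous_on UNIV P1" by fact
    show "invertible (P1 x)" for x
    proof -
      obtain u where u: "\<And>n. u n \<in> X" "u \<longlonglongrightarrow> x" using approx by blast
      have "(\<lambda>n. P1 (u n) ** P2 (u n)) \<longlonglongrightarrow> P1 x ** P2 x"
        by (intro tendsto_matrix_mult lim u)
      moreover have "P1 (u n) ** P2 (u n) = mat 1" for n
        by (simp only: P1(2)[OF u(1), symmetric] P2(2)[OF u(1), symmetric] invertible_matrix_inv(1)[OF inv[OF u(1)]])
      ultimately have "P1 x ** P2 x = mat 1" by (simp add: LIMSEQ_const_iff)
      then show ?thesis by (rule matrix_inv_unique)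
    qed
    show "opnorm (P1 x - P1 y) \<le> M * dist x y powr \<nu>" for x y
    proof -
      obtain u where u: "\<And>n. u n \<in> X" "u \<longlonglongrightarrow> x" using approx by blast
      obtain v where v: "\<And>n. v n \<in> X" "v \<longlonglongrightarrow> y" using approx by blast
      show ?thesis
      proof (rule LIMSEQ_le)
        show "(\<lambda>n. opnorm (P1 (u n) - P1 (v n))) \<longlonglongrightarrow> opnorm (P1 x - P1 y)"
          by (intro tendsto_opnorm tendsto_diff lim u v)
        show "(\<lambda>n. M * dist (u n) (v n) powr \<nu>) \<longlonglongrightarrow> M * dist x y powr \<nu>"
          using \<open>0 < \<nu>\<close> by (intro tendsto_mult tendsto_const tendsto_powr' tendsto_dist u v) auto
        have "opnorm (P1 (u n) - P1 (v n)) \<le> M * dist (u n) (v n) powr \<nu>" for n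
          using holder[OF u(1) v(1)] by (simp only: P1(2)[OF u(1)] P1(2)[OF v(1)])
        then show "\<exists>N. \<forall>n\<ge>N. opnorm (P1 (u n) - P1 (v n)) \<le> M * dist (u n) (v n) powr \<nu>"
          by blast
      qed
    qed
  qed
qed

section \<open>The two limits at points asymptotic to the periodic orbit\<close>

locale livsic =
  hyp: hyperbolic f g C \<epsilon> lam \<tau> Lip Ws Wu br +
  bunched_pair f g \<alpha> \<beta> A B "\<lambda>x y. dist x y powr \<nu>" K \<rho> \<theta> "\<nu> * lam"
  for f g :: "'a::metric_space \<Rightarrow> 'a" and C \<epsilon> lam \<tau> Lip Ws Wu br
    and \<alpha> \<beta> :: "real ^ 'n ^ 'n \<Rightarrow> real ^ 'n ^ 'n" and A B \<nu> K \<rho> \<theta> +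
  fixes p :: 'a and k :: nat and Q :: "'a \<Rightarrow> real ^ 'n ^ 'n" and KQ :: real
  assumes \<nu>_pos: "0 < \<nu>"
    and period: "(f ^^ k) p = p" and k_pos: "0 < k"
    and inv_Q: "invertible (Q x)"
    and holder_Q: "opnorm (Q x - Q y) \<le> KQ * dist x y powr \<nu>" and KQ_pos: "0 < KQ"
    and periodic_Q: "(f ^^ n) q = q \<Longrightarrow> Phi A B n q (Q q) = Q q"
begin

sublocale R: bunched_pair g f \<beta> \<alpha> "rev_gen A" "rev_gen B" "\<lambda>x y. dist (g x) (g y) powr \<nu>"
  "K * (K * exp \<rho>)" \<rho> \<theta> "\<nu> * lam"
  by (rule bunched_pair_reverse)

lemma Psi_Q: assumes "(f ^^ n) q = q" shows "Psi A B n q (Q q) = Q q"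
proof -
  have "Psi A B n q (Phi A B n q (Q q)) = Q q" by (rule Psi_Phi[OF inv_AB inv_Q])
  then show ?thesis by (simp only: periodic_Q[OF assms])
qed

lemma period_mult: "(f ^^ (k * N)) p = p" "(g ^^ (k * N)) p = p"
proof -
  show *: "(f ^^ (k * N)) p = p"
    by (induction N) (simp_all add: funpow_add period)
  show "(g ^^ (k * N)) p = p" using hyp.iterate_g_f[of "k * N" p] unfolding * .
qed

lemma powr_decay:
  assumes "d \<le> c * exp (- lam * real n)" "0 \<le> d"
  shows "d powr \<nu> \<le> c powr \<nu> * exp (- (\<nu> * lam) * real n)"
proof -
  have c: "0 \<le> c" using order_trans[OF assms(2,1)] by (simp add: zero_le_mult_iff)
  have "d powr \<nu> \<le> (c * exp (- lam * real n)) powr \<nu>"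
    using assms \<nu>_pos by (intro powr_mono2) auto
  also have "\<dots> = c powr \<nu> * exp (- (\<nu> * lam) * real n)"
    using exp_powr[OF c, of "- lam * real n" \<nu>] by (simp add: mult_ac)
  finally show ?thesis .
qed

lemma filterlim_affine: "filterlim (\<lambda>N. j + k * N) at_top sequentially"
proof (rule filterlim_at_top_mono[OF filterlim_ident])
  show "\<forall>\<^sub>F N in sequentially. N \<le> j + k * N"
    using k_pos by (intro always_eventually) (simp add: trans_le_add2)
qed

lemma Psi_compare_decay:
  assumes "\<And>n. dist ((f ^^ n) x) ((f ^^ n) y) \<le> c * exp (- lam * real n)"
  obtains G H where "invertible G" "invertible H"
    "dev G \<le> exp (A.hol_const * c powr \<nu>) - 1" "dev (matrix_inv G) \<le> exp (A.hol_const * c powr \<nu>) - 1"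
    "dev H \<le> exp (A.hol_const * c powr \<nu>) - 1" "dev (matrix_inv H) \<le> exp (A.hol_const * c powr \<nu>) - 1"
    "\<And>s T R. \<lbrakk>filterlim s at_top sequentially; invertible T; (\<lambda>N. Psi A B (s N) y T) \<longlonglongrightarrow> R\<rbrakk>
      \<Longrightarrow> (\<lambda>N. Psi A B (s N) x T) \<longlonglongrightarrow> G ** R ** H"
  by (rule Psi_limit_compare[of x y "c powr \<nu>", OF powr_decay[OF assms zero_le_dist] powr_ge_zero]) (rule that)

text \<open>Obtained from the reversed pair, whose control function reads the distances one step
  later; that only improves the exponential bound.\<close>

lemma Phi_compare_decay:
  assumes "\<And>n. dist ((g ^^ n) x) ((g ^^ n) y) \<le> c * exp (- lam * real n)"
  obtains G H where "invertible G" "invertible H"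
    "dev G \<le> exp (R.A.hol_const * c powr \<nu>) - 1" "dev (matrix_inv G) \<le> exp (R.A.hol_const * c powr \<nu>) - 1"
    "dev H \<le> exp (R.A.hol_const * c powr \<nu>) - 1" "dev (matrix_inv H) \<le> exp (R.A.hol_const * c powr \<nu>) - 1"
    "\<And>s T R. \<lbrakk>filterlim s at_top sequentially; invertible T; (\<lambda>N. Phi A B (s N) ((g ^^ s N) y) T) \<longlonglongrightarrow> R\<rbrakk>
      \<Longrightarrow> (\<lambda>N. Phi A B (s N) ((g ^^ s N) x) T) \<longlonglongrightarrow> G ** R ** H"
proof -
  have c0: "0 \<le> c" using order_trans[OF zero_le_dist assms[of 0]] by simp
  have D: "dist (g ((g ^^ n) x)) (g ((g ^^ n) y)) powr \<nu> \<le> c powr \<nu> * exp (- (\<nu> * lam) * real n)" for n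
  proof (rule powr_decay)
    have "dist (g ((g ^^ n) x)) (g ((g ^^ n) y)) \<le> c * exp (- lam * real (Suc n))"
      using assms[of "Suc n"] by simp
    also have "\<dots> \<le> c * exp (- lam * real n)"
      using c0 hyp.pos by (intro mult_left_mono) auto
    finally show "dist (g ((g ^^ n) x)) (g ((g ^^ n) y)) \<le> c * exp (- lam * real n)" .
  qed simp
  show ?thesis
  proof (rule R.Psi_limit_compare[of x y "c powr \<nu>", OF D powr_ge_zero], rule that)
    fix G H s and T R :: "real ^ 'n ^ 'n"
    assume lim: "\<And>s T R. \<lbrakk>filterlim s at_top sequentially; invertible T;
        (\<lambda>N. rev.Psi (rev_gen A) (rev_gen B) (s N) y T) \<longlonglongrightarrow> R\<rbrakk>
      \<Longrightarrow> (\<lambda>N. rev.Psi (rev_gen A) (rev_gen B) (s N) x T) \<longlonglongrightarrow> G ** R ** H"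
      and s: "filterlim s at_top sequentially" and T: "invertible T"
      and R: "(\<lambda>N. Phi A B (s N) ((g ^^ s N) y) T) \<longlonglongrightarrow> R"
    show "(\<lambda>N. Phi A B (s N) ((g ^^ s N) x) T) \<longlonglongrightarrow> G ** R ** H"
      using lim[OF s T, of R] R by (simp add: rev_Psi[OF inv_AB T])
  qed
qed

text \<open>Based at \<open>(g ^^ j) p\<close> the sequence is constant, since whole periods fix
  \<open>Q p\<close>; the holonomies carry its limit over to \<open>x\<close>.\<close>

lemma Psi_limit:
  assumes "hyp.Ss p j x"
  shows "\<exists>T. invertible T \<and> (\<lambda>N. Psi A B (j + k * N) x (Q p)) \<longlonglongrightarrow> T"
proof -
  obtain c where c: "\<And>n. dist ((f ^^ n) x) ((f ^^ n) ((g ^^ j) p)) \<le> c * exp (- lam * real n)"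
    using assms by (auto simp: hyp.Ss_def)
  let ?T = "Psi A B j ((g ^^ j) p) (Q p)"
  have "Psi A B (j + k * N) ((g ^^ j) p) (Q p) = ?T" for N
    by (simp add: Psi_add[OF inv_AB inv_Q] Psi_Q[OF period_mult(1)])
  then have lim: "(\<lambda>N. Psi A B (j + k * N) ((g ^^ j) p) (Q p)) \<longlonglongrightarrow> ?T" by simp
  obtain G H where GH: "invertible G" "invertible H"
    "\<And>s T R. \<lbrakk>filterlim s at_top sequentially; invertible T; (\<lambda>N. Psi A B (s N) ((g ^^ j) p) T) \<longlonglongrightarrow> R\<rbrakk>
      \<Longrightarrow> (\<lambda>N. Psi A B (s N) x T) \<longlonglongrightarrow> G ** R ** H"
    by (rule Psi_compare_decay[OF c]) (rule that)
  show ?thesis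
    by (intro exI[of _ "G ** ?T ** H"] conjI GH(3)[OF filterlim_affine inv_Q lim] invertible_mult GH(1,2)
        inv_Psi[OF inv_AB] inv_Q)
qed

lemma Phi_limit:
  assumes "hyp.Us p i x"
  shows "\<exists>T. invertible T \<and> (\<lambda>N. Phi A B (i + k * N) ((g ^^ (i + k * N)) x) (Q p)) \<longlonglongrightarrow> T"
proof -
  obtain c where c: "\<And>n. dist ((g ^^ n) x) ((g ^^ n) ((f ^^ i) p)) \<le> c * exp (- lam * real n)"
    using assms by (auto simp: hyp.Us_def)
  let ?T = "Phi A B i p (Q p)"
  have "(g ^^ (i + k * N)) ((f ^^ i) p) = p" for N
    using hyp.iterate_g_f_ge[of i "i + k * N" p] by (simp add: period_mult)
  moreover have "Phi A B (i + k * N) p (Q p) = ?T" for N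
  proof -
    have "Phi A B (k * N + i) p (Q p) = Phi A B i ((f ^^ (k * N)) p) (Phi A B (k * N) p (Q p))"
      by (rule Phi_add[OF inv_AB inv_Q])
    then show ?thesis by (simp only: period_mult(1) periodic_Q[OF period_mult(1)] add.commute)
  qed
  ultimately have lim: "(\<lambda>N. Phi A B (i + k * N) ((g ^^ (i + k * N)) ((f ^^ i) p)) (Q p)) \<longlonglongrightarrow> ?T" by simp
  obtain G H where GH: "invertible G" "invertible H"
    "\<And>s T R. \<lbrakk>filterlim s at_top sequentially; invertible T; (\<lambda>N. Phi A B (s N) ((g ^^ s N) ((f ^^ i) p)) T) \<longlonglongrightarrow> R\<rbrakk>
      \<Longrightarrow> (\<lambda>N. Phi A B (s N) ((g ^^ s N) x) T) \<longlonglongrightarrow> G ** R ** H"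
    by (rule Phi_compare_decay[OF c]) (rule that)
  show ?thesis
    by (intro exI[of _ "G ** ?T ** H"] conjI GH(3)[OF filterlim_affine inv_Q lim] invertible_mult GH(1,2)
        inv_Phi[OF inv_AB] inv_Q)
qed

end

text \<open>Up to time u the two-sided closing bound is governed by its left end: u and v both equal
  s up to constants, so t \<le> i + (u + v - t), and the closing error exp(-lam s) is a constant
  times exp(-lam u).\<close>

lemma exp_two_sided_le:
  fixes lam :: real and t u v i j s :: nat
  assumes "0 < lam" "t \<le> u" "u = i + s" "v = j + s"
  shows "(exp (- lam * real t) + exp (- lam * real (u + v - t))) * exp (- lam * real s) \<le>
    ((1 + exp (lam * real i)) * exp (lam * real i)) * exp (- lam * real u) * exp (- lam * real t)"
proof -
  have "exp (- lam * real (u + v - t)) \<le> exp (lam * real i + - lam * real t)"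
  proof -
    have "real t \<le> real i + real (u + v - t)" using assms by simp
    then have "lam * real t \<le> lam * (real i + real (u + v - t))" using assms(1) by (intro mult_left_mono) auto
    then show ?thesis by (simp add: algebra_simps)
  qed
  then have "exp (- lam * real t) + exp (- lam * real (u + v - t)) \<le> (1 + exp (lam * real i)) * exp (- lam * real t)"
    by (simp only: exp_add) (simp add: algebra_simps)
  then have "(exp (- lam * real t) + exp (- lam * real (u + v - t))) * exp (- lam * real s) \<le>
      ((1 + exp (lam * real i)) * exp (- lam * real t)) * exp (- lam * real s)"
    by (intro mult_right_mono) auto
  moreover have "exp (- lam * real s) = exp (lam * real i) * exp (- lam * real u)"
    unfolding assms(3) by (simp add: exp_add[symmetric] algebra_simps)
  then have "((1 + exp (lam * real i)) * exp (- lam * real t)) * exp (- lam * real s) =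
      ((1 + exp (lam * real i)) * exp (lam * real i)) * exp (- lam * real u) * exp (- lam * real t)"
    by (simp only: mult_ac)
  ultimately show ?thesis by (simp only:)
qed

section \<open>Agreement of the two limits at homoclinic points\<close>

context livsic
begin

text \<open>With both ends of the segment near \<open>p\<close>, closing yields points
  \<open>q N\<close> whose distance from it at time t \<le> n1 is of order exp(-lam n1) exp(-lam t),
  and likewise from the right end: the form that \<open>Phi_shadow\<close> and its reversal
  take.\<close>

lemma limits_agree:
  assumes "hyp.Us p i x" "hyp.Ss p j x"
    and limU: "(\<lambda>N. Phi A B (i + k * N) ((g ^^ (i + k * N)) x) (Q p)) \<longlonglongrightarrow> T"
    and limS: "(\<lambda>N. Psi A B (j + k * N) x (Q p)) \<longlonglongrightarrow> T'"
  shows "T = T'"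
proof -
  obtain c1 where c1: "\<And>n. dist ((g ^^ n) x) ((g ^^ n) ((f ^^ i) p)) \<le> c1 * exp (- lam * real n)"
    using assms(1) by (auto simp: hyp.Us_def)
  obtain c2 where c2: "\<And>n. dist ((f ^^ n) x) ((f ^^ n) ((g ^^ j) p)) \<le> c2 * exp (- lam * real n)"
    using assms(2) by (auto simp: hyp.Ss_def)
  have c_nonneg: "0 \<le> c1" "0 \<le> c2"
    using order_trans[OF zero_le_dist c1[of 0]] order_trans[OF zero_le_dist c2[of 0]] by simp_all
  obtain Kc \<delta> and N0 :: nat where cl: "1 \<le> Kc" "0 < \<delta>"
    "\<And>y k. \<lbrakk>N0 \<le> k; 0 < k; dist y ((f ^^ k) y) \<le> \<delta>\<rbrakk> \<Longrightarrow> \<exists>q. (f ^^ k) q = q \<and>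
      (\<forall>i\<le>k. dist ((f ^^ i) y) ((f ^^ i) q) \<le>
        Kc * (exp (- lam * real i) + exp (- lam * real (k - i))) * dist y ((f ^^ k) y))"
    by (rule hyp.closing) (rule that)
  define n1 where "n1 s = i + k * s" for s
  define n2 where "n2 s = j + k * s" for s
  define a where "a s = (g ^^ n1 s) x" for s
  have gp: "(g ^^ n1 s) ((f ^^ i) p) = p" for s
    using hyp.iterate_g_f_ge[of i "n1 s" p] by (simp add: period_mult n1_def)
  have fp: "(f ^^ n2 s) ((g ^^ j) p) = p" for s
    using funpow_add[of "k * s" j f] by (simp add: period_mult n2_def add.commute)
  have fa: "(f ^^ (n1 s + n2 s)) (a s) = (f ^^ n2 s) x" for s
    using funpow_add[of "n2 s" "n1 s" f] by (simp add: a_def add.commute)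
  have ap: "dist (a s) p \<le> c1 * exp (- lam * real (n1 s))" for s
    using c1[of "n1 s"] by (simp only: gp a_def)
  have bp: "dist ((f ^^ n2 s) x) p \<le> c2 * exp (- lam * real (n2 s))" for s
    using c2[of "n2 s"] by (simp only: fp)
  define c where "c = c1 + c2"
  have ab: "dist (a s) ((f ^^ (n1 s + n2 s)) (a s)) \<le> c * exp (- lam * real (k * s))" for s
  proof -
    have "exp (- lam * real (n1 s)) \<le> exp (- lam * real (k * s))"
      "exp (- lam * real (n2 s)) \<le> exp (- lam * real (k * s))"
      using hyp.pos(3) by (simp_all add: n1_def n2_def)
    note this[THEN mult_left_mono, OF c_nonneg(1)] this[THEN mult_left_mono, OF c_nonneg(2)]
    then show ?thesis
      using ap[of s] bp[of s] dist_triangle2[of "a s" "(f ^^ n2 s) x" p]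
      unfolding fa c_def distrib_right by linarith
  qed
  have "(\<lambda>s. c * exp (- lam) ^ s) \<longlonglongrightarrow> 0"
    using hyp.pos by (intro tendsto_mult_right_zero LIMSEQ_realpow_zero) auto
  then have "eventually (\<lambda>s. c * exp (- lam) ^ s < \<delta>) sequentially"
    using cl(2) by (rule order_tendstoD)
  then obtain N1 where N1: "\<And>s. N1 \<le> s \<Longrightarrow> c * exp (- lam) ^ s < \<delta>"
    by (auto simp: eventually_sequentially)
  \<comment> \<open>N1 makes the end points \<delta>-close, N0 the segment long enough for closing,
    and the 1 its length positive.\<close>
  define m where "m N = N + (N1 + N0 + 1)" for N :: nat
  have "\<exists>q. \<forall>N. (f ^^ (n1 (m N) + n2 (m N))) (q N) = q N \<and>
      (\<forall>t\<le>n1 (m N) + n2 (m N). dist ((f ^^ t) (a (m N))) ((f ^^ t) (q N)) \<le>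
        Kc * (exp (- lam * real t) + exp (- lam * real (n1 (m N) + n2 (m N) - t))) *
        (c * exp (- lam * real (k * m N))))"
  proof (rule choice, rule allI)
    fix N
    let ?n = "n1 (m N) + n2 (m N)"
    have le: "m N \<le> k * m N" using k_pos by simp
    have "c * exp (- lam * real (k * m N)) \<le> c * exp (- lam) ^ m N"
    proof (intro mult_left_mono)
      have "lam * real (m N) \<le> lam * real (k * m N)" using le hyp.pos by (intro mult_left_mono of_nat_mono) auto
      then show "exp (- lam * real (k * m N)) \<le> exp (- lam) ^ m N"
        by (simp add: exp_of_nat_mult[symmetric] mult_ac)
    qed (use c_nonneg in \<open>simp add: c_def\<close>)
    also have "\<dots> < \<delta>" by (rule N1) (simp add: m_def)
    finally have "dist (a (m N)) ((f ^^ ?n) (a (m N))) \<le> \<delta>" using ab[of "m N"] by linarith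
    moreover have "N0 \<le> ?n" "0 < ?n" using le by (auto simp: n1_def n2_def m_def)
    ultimately have "\<exists>q. (f ^^ ?n) q = q \<and> (\<forall>t\<le>?n. dist ((f ^^ t) (a (m N))) ((f ^^ t) q) \<le>
        Kc * (exp (- lam * real t) + exp (- lam * real (?n - t))) * dist (a (m N)) ((f ^^ ?n) (a (m N))))"
      by (intro cl(3))
    then obtain q where q: "(f ^^ ?n) q = q" "\<And>t. t \<le> ?n \<Longrightarrow> dist ((f ^^ t) (a (m N))) ((f ^^ t) q) \<le>
        Kc * (exp (- lam * real t) + exp (- lam * real (?n - t))) * dist (a (m N)) ((f ^^ ?n) (a (m N)))"
      by blast
    show "\<exists>q. (f ^^ ?n) q = q \<and> (\<forall>t\<le>?n. dist ((f ^^ t) (a (m N))) ((f ^^ t) q) \<le>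
        Kc * (exp (- lam * real t) + exp (- lam * real (?n - t))) * (c * exp (- lam * real (k * m N))))"
    proof (intro exI[of _ q] conjI allI impI)
      fix t assume t: "t \<le> ?n"
      have "Kc * (exp (- lam * real t) + exp (- lam * real (?n - t))) * dist (a (m N)) ((f ^^ ?n) (a (m N))) \<le>
        Kc * (exp (- lam * real t) + exp (- lam * real (?n - t))) * (c * exp (- lam * real (k * m N)))"
        using cl(1) by (intro mult_left_mono[OF ab]) simp
      with q(2)[OF t] show "dist ((f ^^ t) (a (m N))) ((f ^^ t) q) \<le>
        Kc * (exp (- lam * real t) + exp (- lam * real (?n - t))) * (c * exp (- lam * real (k * m N)))"
        by linarith
    qed (rule q(1))
  qed
  then obtain q where q: "\<And>N. (f ^^ (n1 (m N) + n2 (m N))) (q N) = q N"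
    and near_q: "\<And>N t. t \<le> n1 (m N) + n2 (m N) \<Longrightarrow> dist ((f ^^ t) (a (m N))) ((f ^^ t) (q N)) \<le>
        Kc * (exp (- lam * real t) + exp (- lam * real (n1 (m N) + n2 (m N) - t))) *
        (c * exp (- lam * real (k * m N)))"
    by blast
  define \<kappa> where "\<kappa> i = (1 + exp (lam * real i)) * exp (lam * real i)" for i :: nat
  have c0: "0 \<le> c" using c_nonneg by (simp add: c_def)
  have \<kappa>0: "0 \<le> \<kappa> i" for i by (simp add: \<kappa>_def add_nonneg_nonneg)
  have first: "dist ((f ^^ t) (a (m N))) ((f ^^ t) (q N)) \<le>
      (Kc * c * \<kappa> i) * exp (- lam * real (n1 (m N))) * exp (- lam * real t)" if t: "t \<le> n1 (m N)" for N t
  proof -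
    have "dist ((f ^^ t) (a (m N))) ((f ^^ t) (q N)) \<le> (Kc * c) *
        ((exp (- lam * real t) + exp (- lam * real (n1 (m N) + n2 (m N) - t))) * exp (- lam * real (k * m N)))"
      using near_q[of t N] t by (simp add: mult_ac)
    also have "\<dots> \<le> (Kc * c) * (\<kappa> i * exp (- lam * real (n1 (m N))) * exp (- lam * real t))"
      unfolding \<kappa>_def using c0 cl(1) hyp.pos t
      by (intro mult_left_mono exp_two_sided_le[where j = j]) (auto simp: n1_def n2_def)
    finally show ?thesis by (simp add: mult_ac)
  qed
  have second: "dist ((f ^^ (n1 (m N) + n2 (m N) - t)) (a (m N))) ((f ^^ (n1 (m N) + n2 (m N) - t)) (q N)) \<le>
      (Kc * c * \<kappa> j) * exp (- lam * real (n2 (m N))) * exp (- lam * real t)" if t: "t \<le> n2 (m N)" for N t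
  proof -
    let ?n = "n1 (m N) + n2 (m N)"
    have sub: "?n - (?n - t) = t" "?n = n2 (m N) + n1 (m N)" using t by auto
    have "dist ((f ^^ (?n - t)) (a (m N))) ((f ^^ (?n - t)) (q N)) \<le> (Kc * c) *
        ((exp (- lam * real t) + exp (- lam * real (n2 (m N) + n1 (m N) - t))) * exp (- lam * real (k * m N)))"
      using near_q[of "?n - t" N] by (simp add: sub(1)) (simp add: mult_ac add.commute)
    also have "\<dots> \<le> (Kc * c) * (\<kappa> j * exp (- lam * real (n2 (m N))) * exp (- lam * real t))"
      unfolding \<kappa>_def using c0 cl(1) hyp.pos t
      by (intro mult_left_mono exp_two_sided_le[where j = i]) (auto simp: n1_def n2_def)
    finally show ?thesis by (simp add: mult_ac)
  qed
  have m_lim: "filterlim m at_top sequentially"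
    unfolding m_def by (rule filterlim_add_const_nat_at_top)
  have decay: "d powr \<nu> \<le> c' powr \<nu> * exp (- (\<nu> * lam) * real n) * exp (- (\<nu> * lam) * real t)"
    if "d \<le> c' * exp (- lam * real n) * exp (- lam * real t)" "0 \<le> d" for d c' n t
    using powr_decay[of d c' "n + t"] that by (simp add: exp_add[symmetric] algebra_simps)
  have le: "y powr \<nu> \<le> y powr \<nu> + KQ * z powr \<nu>" "KQ * z powr \<nu> \<le> y powr \<nu> + KQ * z powr \<nu>" for y z
    using KQ_pos by simp_all
  \<comment> \<open>The constant is a sum so that one value bounds both the distances along the
    orbits and the change from \<open>Q p\<close> to \<open>Q (q N)\<close>.\<close>
  have U: "(\<lambda>N. Phi A B (n1 (m N)) (q N) (Q (q N))) \<longlonglongrightarrow> T"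
  proof (rule Phi_shadow[where a = "\<lambda>N. a (m N)"
        and ?c0.0 = "(Kc * c * \<kappa> i) powr \<nu> + KQ * (Kc * c * \<kappa> i + c1) powr \<nu>"])
    show "filterlim (\<lambda>N. n1 (m N)) at_top sequentially"
      unfolding n1_def by (rule filterlim_compose[OF filterlim_affine m_lim])
    show "(\<lambda>N. Phi A B (n1 (m N)) (a (m N)) (Q p)) \<longlonglongrightarrow> T"
      unfolding n1_def a_def by (rule filterlim_compose[OF limU m_lim])
    show "0 \<le> (Kc * c * \<kappa> i) powr \<nu> + KQ * (Kc * c * \<kappa> i + c1) powr \<nu>"
      using KQ_pos by simp
    show "dist ((f ^^ t) (a (m N))) ((f ^^ t) (q N)) powr \<nu> \<le>
        ((Kc * c * \<kappa> i) powr \<nu> + KQ * (Kc * c * \<kappa> i + c1) powr \<nu>) *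
        exp (- (\<nu> * lam) * real (n1 (m N))) * exp (- (\<nu> * lam) * real t)" if "t < n1 (m N)" for N t
      by (rule order_trans[OF decay[OF first[OF less_imp_le[OF that]] zero_le_dist]])
         (intro mult_right_mono le(1) exp_ge_zero)
    show "opnorm (Q (q N) - Q p) \<le> ((Kc * c * \<kappa> i) powr \<nu> + KQ * (Kc * c * \<kappa> i + c1) powr \<nu>) *
        exp (- (\<nu> * lam) * real (n1 (m N)))" for N
    proof -
      have "dist (q N) p \<le> dist (a (m N)) (q N) + dist (a (m N)) p"
        using dist_triangle2[of "q N" p "a (m N)"] by (simp add: dist_commute)
      also have "\<dots> \<le> (Kc * c * \<kappa> i + c1) * exp (- lam * real (n1 (m N)))"
        using first[of 0 N] ap[of "m N"] by (simp add: algebra_simps)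
      finally have "dist (q N) p powr \<nu> \<le> (Kc * c * \<kappa> i + c1) powr \<nu> * exp (- (\<nu> * lam) * real (n1 (m N)))"
        by (rule powr_decay) simp
      from order_trans[OF holder_Q mult_left_mono[OF this, of KQ]] KQ_pos
      have "opnorm (Q (q N) - Q p) \<le> KQ * (Kc * c * \<kappa> i + c1) powr \<nu> * exp (- (\<nu> * lam) * real (n1 (m N)))"
        by (simp add: mult_ac)
      then show ?thesis by (rule order_trans) (intro mult_right_mono le(2) exp_ge_zero)
    qed
  qed (rule inv_Q)+
  have S: "(\<lambda>N. Psi A B (n2 (m N)) ((g ^^ n2 (m N)) (q N)) (Q (q N))) \<longlonglongrightarrow> T'"
  proof -
    have "(\<lambda>N. rev.Phi (rev_gen A) (rev_gen B) (n2 (m N)) (q N) (Q (q N))) \<longlonglongrightarrow> T'"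
    proof (rule R.Phi_shadow[where a = "\<lambda>N. (f ^^ n2 (m N)) x"
          and ?c0.0 = "(Kc * c * \<kappa> j) powr \<nu> + KQ * (Kc * c * \<kappa> j + c2) powr \<nu>"])
      show "filterlim (\<lambda>N. n2 (m N)) at_top sequentially"
        unfolding n2_def by (rule filterlim_compose[OF filterlim_affine m_lim])
      have "(\<lambda>N. Psi A B (n2 (m N)) x (Q p)) \<longlonglongrightarrow> T'"
        unfolding n2_def by (rule filterlim_compose[OF limS m_lim])
      then show "(\<lambda>N. rev.Phi (rev_gen A) (rev_gen B) (n2 (m N)) ((f ^^ n2 (m N)) x) (Q p)) \<longlonglongrightarrow> T'"
        by (simp add: rev_Phi[OF inv_AB inv_Q])
      show "0 \<le> (Kc * c * \<kappa> j) powr \<nu> + KQ * (Kc * c * \<kappa> j + c2) powr \<nu>"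
        using KQ_pos by simp
      show "dist (g ((g ^^ t) ((f ^^ n2 (m N)) x))) (g ((g ^^ t) (q N))) powr \<nu> \<le>
          ((Kc * c * \<kappa> j) powr \<nu> + KQ * (Kc * c * \<kappa> j + c2) powr \<nu>) *
          exp (- (\<nu> * lam) * real (n2 (m N))) * exp (- (\<nu> * lam) * real t)" if t: "t < n2 (m N)" for N t
      proof -
        let ?n = "n1 (m N) + n2 (m N)"
        \<comment> \<open>The reversed control function looks one backward step further, hence the
          time t + 1, counted from the right end.\<close>
        have Suc_t: "Suc t \<le> ?n" "Suc t \<le> n2 (m N)" using t by auto
        have "g ((g ^^ t) ((f ^^ n2 (m N)) x)) = (f ^^ (?n - Suc t)) (a (m N))"
          using hyp.iterate_g_f_le[OF Suc_t(1), of "a (m N)"] by (simp add: fa)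
        moreover have "g ((g ^^ t) (q N)) = (f ^^ (?n - Suc t)) (q N)"
          using hyp.iterate_g_f_le[OF Suc_t(1), of "q N"] by (simp add: q)
        ultimately have "dist (g ((g ^^ t) ((f ^^ n2 (m N)) x))) (g ((g ^^ t) (q N))) \<le>
            (Kc * c * \<kappa> j) * exp (- lam * real (n2 (m N))) * exp (- lam * real (Suc t))"
          using second[OF Suc_t(2)] by simp
        also have "\<dots> \<le> (Kc * c * \<kappa> j) * exp (- lam * real (n2 (m N))) * exp (- lam * real t)"
          using hyp.pos cl(1) c0 \<kappa>0 by (intro mult_left_mono mult_nonneg_nonneg) auto
        finally have "dist (g ((g ^^ t) ((f ^^ n2 (m N)) x))) (g ((g ^^ t) (q N))) powr \<nu> \<le>
          (Kc * c * \<kappa> j) powr \<nu> * exp (- (\<nu> * lam) * real (n2 (m N))) * exp (- (\<nu> * lam) * real t)"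
          by (rule decay) simp
        then show ?thesis by (rule order_trans) (intro mult_right_mono le(1) exp_ge_zero)
      qed
      show "opnorm (Q (q N) - Q p) \<le> ((Kc * c * \<kappa> j) powr \<nu> + KQ * (Kc * c * \<kappa> j + c2) powr \<nu>) *
          exp (- (\<nu> * lam) * real (n2 (m N)))" for N
      proof -
        have "dist (q N) p \<le> dist ((f ^^ n2 (m N)) x) (q N) + dist ((f ^^ n2 (m N)) x) p"
          using dist_triangle2[of "q N" p "(f ^^ n2 (m N)) x"] by (simp add: dist_commute)
        also have "\<dots> \<le> (Kc * c * \<kappa> j + c2) * exp (- lam * real (n2 (m N)))"
          using second[of 0 N] bp[of "m N"] by (simp add: fa q algebra_simps)
        finally have "dist (q N) p powr \<nu> \<le> (Kc * c * \<kappa> j + c2) powr \<nu> * exp (- (\<nu> * lam) * real (n2 (m N)))"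
          by (rule powr_decay) simp
        from order_trans[OF holder_Q mult_left_mono[OF this, of KQ]] KQ_pos
        have "opnorm (Q (q N) - Q p) \<le> KQ * (Kc * c * \<kappa> j + c2) powr \<nu> * exp (- (\<nu> * lam) * real (n2 (m N)))"
          by (simp add: mult_ac)
        then show ?thesis by (rule order_trans) (intro mult_right_mono le(2) exp_ge_zero)
      qed
    qed (rule inv_Q)+
    then show ?thesis by (simp add: rev_Phi[OF inv_AB inv_Q])
  qed
  \<comment> \<open>A full period fixes \<open>Q (q N)\<close>; undoing its last n2 steps leaves the
    transport over the first n1.\<close>
  have "Psi A B (n2 (m N)) ((g ^^ n2 (m N)) (q N)) (Q (q N)) = Phi A B (n1 (m N)) (q N) (Q (q N))" for N
  proof -
    let ?y = "(f ^^ n1 (m N)) (q N)" and ?R = "Phi A B (n1 (m N)) (q N) (Q (q N))"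
    have "(f ^^ n2 (m N)) ?y = q N"
      using q[of N] funpow_add[of "n2 (m N)" "n1 (m N)" f] by (simp add: add.commute)
    then have y: "(g ^^ n2 (m N)) (q N) = ?y" using hyp.iterate_g_f[of "n2 (m N)" ?y] by simp
    have "Phi A B (n2 (m N)) ?y ?R = Q (q N)"
      using periodic_Q[OF q[of N]] unfolding Phi_add[OF inv_AB inv_Q] .
    moreover have "Psi A B (n2 (m N)) ?y (Phi A B (n2 (m N)) ?y ?R) = ?R"
      by (rule Psi_Phi[OF inv_AB inv_Phi[OF inv_AB inv_Q]])
    ultimately show ?thesis unfolding y by (simp only:)
  qed
  with S have "(\<lambda>N. Phi A B (n1 (m N)) (q N) (Q (q N))) \<longlonglongrightarrow> T'" by simp
  with U show ?thesis by (rule LIMSEQ_unique)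
qed

end

lemma near_mono: "\<lbrakk>near e S T; e \<le> e'\<rbrakk> \<Longrightarrow> near e' S T"
  unfolding near_def by (blast intro: order_trans)

context bunched
begin

text \<open>Continuity of the automorphism on GL from its bound near the identity, applied to the
  ratio of \<open>X n\<close> to \<open>T\<close>.\<close>

lemma tendsto_\<alpha>:
  assumes lim: "(X \<longlongrightarrow> T) F" and inv: "\<And>n. invertible (X n)" "invertible T"
  shows "((\<lambda>n. \<alpha> (X n)) \<longlongrightarrow> \<alpha> T) F"
proof -
  let ?S = "\<lambda>n. X n ** matrix_inv T"
  have S: "invertible (?S n)" for n by (intro invertible_mult inv invertible_matrix_inv)
  have "((\<lambda>n. (K * exp \<rho>) * (opnorm (matrix_inv T) * opnorm (X n - T))) \<longlongrightarrow> 0) F"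
    by (intro tendsto_mult_right_zero tendsto_opnormD lim)
  moreover have "dev (\<alpha> (?S n)) \<le> (K * exp \<rho>) * (opnorm (matrix_inv T) * opnorm (X n - T))" for n
    using order_trans[OF dev_\<alpha>[OF S, of 1] mult_left_mono[OF dev_diff_le(2)[OF inv(2)]]] K_ge_1 by simp
  ultimately have "((\<lambda>n. dev (\<alpha> (?S n))) \<longlongrightarrow> 0) F"
    by (intro tendsto_sandwich[of "\<lambda>_. 0" "\<lambda>n. dev (\<alpha> (?S n))"] always_eventually tendsto_const)
       (simp_all add: dev_nonneg)
  then have "((\<lambda>n. \<alpha> (?S n)) \<longlongrightarrow> mat 1) F" unfolding dev_def by (rule tendsto_opnormI)
  then have "((\<lambda>n. \<alpha> (?S n) ** \<alpha> T) \<longlongrightarrow> mat 1 ** \<alpha> T) F" by (rule tendsto_matrix_mult) simp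
  moreover have "\<alpha> (?S n) ** \<alpha> T = \<alpha> (X n)" for n
    using \<alpha>_mult[OF S inv(2)] by (simp add: matrix_inv_cancel inv)
  ultimately show ?thesis by simp
qed

lemma tendsto_A:
  assumes "((\<lambda>n. D (u n) x) \<longlongrightarrow> 0) F"
  shows "((\<lambda>n. A (u n)) \<longlongrightarrow> A x) F"
proof -
  have "((\<lambda>n. dev (matrix_inv (A x) ** A (u n))) \<longlongrightarrow> 0) F"
    by (rule tendsto_sandwich[of "\<lambda>_. 0" _ _ "\<lambda>n. K * D (u n) x"])
       (auto intro!: always_eventually tendsto_mult_right_zero[OF assms] simp: dev_nonneg dev_A)
  then have "((\<lambda>n. matrix_inv (A x) ** A (u n)) \<longlongrightarrow> mat 1) F"
    unfolding dev_def by (rule tendsto_opnormI)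
  then have "((\<lambda>n. A x ** (matrix_inv (A x) ** A (u n))) \<longlongrightarrow> A x ** mat 1) F"
    by (intro tendsto_matrix_mult tendsto_const)
  then show ?thesis by (simp add: matrix_inv_cancel inv_A)
qed

end

section \<open>The transfer map on homoclinic points: regularity and cohomological equation\<close>

context livsic
begin

text \<open>Several indices i can serve; \<open>transfer_limits\<close> shows that the value does
  not depend on the choice.\<close>

definition transfer :: "'a \<Rightarrow> real ^ 'n ^ 'n" where
  "transfer x = (SOME T. \<exists>i. hyp.Us p i x \<and>
    (\<lambda>N. Phi A B (i + k * N) ((g ^^ (i + k * N)) x) (Q p)) \<longlonglongrightarrow> T)"

text \<open>One forward index fixes the limit \<open>T\<close>; by \<open>limits_agree\<close> every
  backward index gives \<open>T\<close>, and then so does every forward index.\<close>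

lemma transfer_limits:
  assumes "x \<in> hyp.Hom p"
  shows "hyp.Us p i x \<Longrightarrow> (\<lambda>N. Phi A B (i + k * N) ((g ^^ (i + k * N)) x) (Q p)) \<longlonglongrightarrow> transfer x"
    and "hyp.Ss p j x \<Longrightarrow> (\<lambda>N. Psi A B (j + k * N) x (Q p)) \<longlonglongrightarrow> transfer x"
    and "invertible (transfer x)"
proof -
  obtain i0 j0 where ij: "hyp.Us p i0 x" "hyp.Ss p j0 x" using assms by (auto simp: hyp.Hom_def)
  obtain T where T: "invertible T" "(\<lambda>N. Psi A B (j0 + k * N) x (Q p)) \<longlonglongrightarrow> T"
    using Psi_limit[OF ij(2)] by blast
  have U: "(\<lambda>N. Phi A B (i + k * N) ((g ^^ (i + k * N)) x) (Q p)) \<longlonglongrightarrow> T" if "hyp.Us p i x" for i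
    using Phi_limit[OF that] limits_agree[OF that ij(2) _ T(2)] by blast
  have "\<exists>i. hyp.Us p i x \<and>
    (\<lambda>N. Phi A B (i + k * N) ((g ^^ (i + k * N)) x) (Q p)) \<longlonglongrightarrow> transfer x"
    unfolding transfer_def by (rule someI_ex) (use U[OF ij(1)] ij(1) in blast)
  then have eq: "transfer x = T" using U LIMSEQ_unique by blast
  show "invertible (transfer x)" using T eq by simp
  show "(\<lambda>N. Phi A B (i + k * N) ((g ^^ (i + k * N)) x) (Q p)) \<longlonglongrightarrow> transfer x" if "hyp.Us p i x"
    using U[OF that] eq by simp
  show "(\<lambda>N. Psi A B (j + k * N) x (Q p)) \<longlonglongrightarrow> transfer x" if Sj: "hyp.Ss p j x"
  proof -
    obtain T' where T': "(\<lambda>N. Psi A B (j + k * N) x (Q p)) \<longlonglongrightarrow> T'"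
      using Psi_limit[OF Sj] by blast
    then show ?thesis using limits_agree[OF ij(1) Sj U[OF ij(1)] T'] eq by simp
  qed
qed

text \<open>A forward index of \<open>x\<close> is also one of \<open>z\<close>, so both values are
  limits along the same times.\<close>

lemma near_transfer_Ws:
  assumes "x \<in> hyp.Hom p" "z \<in> hyp.Hom p" "Ws x z"
  shows "near (exp (A.hol_const * (C * dist x z) powr \<nu>) - 1) (transfer z) (transfer x)"
proof -
  obtain j where j: "hyp.Ss p j x" using assms(1) by (auto simp: hyp.Hom_def)
  have d: "dist ((f ^^ n) z) ((f ^^ n) x) \<le> (C * dist x z) * exp (- lam * real n)" for n
    using hyp.stable[OF assms(3), of n] by (simp add: dist_commute mult_ac)
  show ?thesis
  proof (rule Psi_compare_decay[OF d])
    fix G H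
    assume GH: "invertible G" "invertible H" "dev G \<le> exp (A.hol_const * (C * dist x z) powr \<nu>) - 1"
      "dev (matrix_inv G) \<le> exp (A.hol_const * (C * dist x z) powr \<nu>) - 1"
      "dev H \<le> exp (A.hol_const * (C * dist x z) powr \<nu>) - 1"
      "dev (matrix_inv H) \<le> exp (A.hol_const * (C * dist x z) powr \<nu>) - 1"
      and lim: "\<And>s T R. \<lbrakk>filterlim s at_top sequentially; invertible T; (\<lambda>N. Psi A B (s N) x T) \<longlonglongrightarrow> R\<rbrakk>
        \<Longrightarrow> (\<lambda>N. Psi A B (s N) z T) \<longlonglongrightarrow> G ** R ** H"
    have "transfer z = G ** transfer x ** H"
      by (rule LIMSEQ_unique[OF transfer_limits(2)[OF assms(2) hyp.Ss_Ws[OF assms(3) j]]])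
         (rule lim[OF filterlim_affine inv_Q transfer_limits(2)[OF assms(1) j]])
    then show ?thesis unfolding near_def using GH by blast
  qed
qed

lemma near_transfer_Wu:
  assumes "x \<in> hyp.Hom p" "z \<in> hyp.Hom p" "Wu x z"
  shows "near (exp (R.A.hol_const * (C * dist x z) powr \<nu>) - 1) (transfer z) (transfer x)"
proof -
  obtain i where i: "hyp.Us p i x" using assms(1) by (auto simp: hyp.Hom_def)
  have d: "dist ((g ^^ n) z) ((g ^^ n) x) \<le> (C * dist x z) * exp (- lam * real n)" for n
    using hyp.unstable[OF assms(3), of n] by (simp add: dist_commute mult_ac)
  show ?thesis
  proof (rule Phi_compare_decay[OF d])
    fix G H
    assume GH: "invertible G" "invertible H" "dev G \<le> exp (R.A.hol_const * (C * dist x z) powr \<nu>) - 1"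
      "dev (matrix_inv G) \<le> exp (R.A.hol_const * (C * dist x z) powr \<nu>) - 1"
      "dev H \<le> exp (R.A.hol_const * (C * dist x z) powr \<nu>) - 1"
      "dev (matrix_inv H) \<le> exp (R.A.hol_const * (C * dist x z) powr \<nu>) - 1"
      and lim: "\<And>s T R. \<lbrakk>filterlim s at_top sequentially; invertible T;
          (\<lambda>N. Phi A B (s N) ((g ^^ s N) x) T) \<longlonglongrightarrow> R\<rbrakk>
        \<Longrightarrow> (\<lambda>N. Phi A B (s N) ((g ^^ s N) z) T) \<longlonglongrightarrow> G ** R ** H"
    have "transfer z = G ** transfer x ** H"
      by (rule LIMSEQ_unique[OF transfer_limits(1)[OF assms(2) hyp.Us_Wu[OF assms(3) i]]])
         (rule lim[OF filterlim_affine inv_Q transfer_limits(1)[OF assms(1) i]])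
    then show ?thesis unfolding near_def using GH by blast
  qed
qed

text \<open>The bracket of x and y is itself homoclinic and joins them by a stable and an unstable
  step.\<close>

lemma near_transfer:
  obtains M \<delta> where "0 < M" "0 < \<delta>"
    "\<And>x y. \<lbrakk>x \<in> hyp.Hom p; y \<in> hyp.Hom p; dist x y \<le> \<delta>\<rbrakk> \<Longrightarrow>
      M * dist x y powr \<nu> \<le> 1 \<and> near (M * dist x y powr \<nu>) (transfer x) (transfer y)"
proof -
  obtain K0 \<delta>1 where K0: "1 \<le> K0" "0 < \<delta>1" "\<And>x y. dist x y \<le> \<delta>1 \<Longrightarrow>
    \<exists>z. Ws x z \<and> Wu y z \<and> dist x z \<le> K0 * dist x y \<and> dist y z \<le> K0 * dist x y"
    by (rule hyp.br_lipschitz) (rule that)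
  define c where "c = max A.hol_const R.A.hol_const * (C * K0) powr \<nu>"
  have CK: "0 < C * K0" using hyp.pos(1) K0(1) by simp
  have c: "0 < c" unfolding c_def using A.hol_const_pos CK by (intro mult_pos_pos) auto
  define \<delta> where "\<delta> = min \<delta>1 ((1 / (8 * c)) powr (1 / \<nu>))"
  have \<delta>: "0 < \<delta>" "\<delta> \<le> \<delta>1" "\<delta> powr \<nu> \<le> 1 / (8 * c)"
  proof -
    show "0 < \<delta>" "\<delta> \<le> \<delta>1" using K0 c by (auto simp: \<delta>_def)
    have "\<delta> powr \<nu> \<le> ((1 / (8 * c)) powr (1 / \<nu>)) powr \<nu>"
      using K0 c \<nu>_pos by (intro powr_mono2) (auto simp: \<delta>_def)
    also have "\<dots> = 1 / (8 * c)" using c \<nu>_pos by (simp add: powr_powr)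
    finally show "\<delta> powr \<nu> \<le> 1 / (8 * c)" .
  qed
  show ?thesis
  proof
    \<comment> \<open>Each step costs at most exp e - 1 \<le> 2 e, and both together (1 + 2 e)^2 - 1
      \<le> 8 e.\<close>
    show "0 < 8 * c" "0 < \<delta>" using c \<delta> by simp_all
    fix x y assume xy: "x \<in> hyp.Hom p" "y \<in> hyp.Hom p" "dist x y \<le> \<delta>"
    define e where "e = c * dist x y powr \<nu>"
    have e0: "0 \<le> e" using c by (simp add: e_def)
    have e8: "8 * e \<le> 1"
    proof -
      have "dist x y powr \<nu> \<le> 1 / (8 * c)"
        using order_trans[OF powr_mono2[OF less_imp_le[OF \<nu>_pos] zero_le_dist xy(3)] \<delta>(3)] .
      then show ?thesis using c by (simp add: e_def field_simps)
    qed
    obtain z where z: "Ws x z" "Wu y z" "dist x z \<le> K0 * dist x y" "dist y z \<le> K0 * dist x y"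
      using K0(3)[of x y] xy(3) \<delta>(2) by auto
    have zH: "z \<in> hyp.Hom p"
      using xy(1,2) hyp.Ss_Ws[OF z(1)] hyp.Us_Wu[OF z(2)] unfolding hyp.Hom_def by blast
    have small: "exp (l * (C * d) powr \<nu>) - 1 \<le> 2 * e"
      if l: "0 \<le> l" "l \<le> max A.hol_const R.A.hol_const" and d: "0 \<le> d" "d \<le> K0 * dist x y" for l d
    proof -
      have "(C * d) powr \<nu> \<le> (C * K0 * dist x y) powr \<nu>"
        using mult_left_mono[OF d(2), of C] d(1) hyp.pos(1) \<nu>_pos by (intro powr_mono2) (auto simp: mult.assoc)
      also have "\<dots> = (C * K0) powr \<nu> * dist x y powr \<nu>"
        using CK by (simp add: powr_mult)
      finally have "l * (C * d) powr \<nu> \<le> max A.hol_const R.A.hol_const * ((C * K0) powr \<nu> * dist x y powr \<nu>)"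
        using l by (intro mult_mono) auto
      then have le: "l * (C * d) powr \<nu> \<le> e" by (simp add: e_def c_def mult.assoc)
      have "exp (l * (C * d) powr \<nu>) \<le> exp e" using le by simp
      also have "\<dots> \<le> 1 + e + e\<^sup>2" using e0 e8 by (intro exp_bound) auto
      also have "\<dots> \<le> 1 + 2 * e" using mult_right_mono[of e 1 e] e0 e8 by (simp add: power2_eq_square)
      finally show ?thesis by simp
    qed
    have "near (2 * e) (transfer z) (transfer x)"
      by (rule near_mono[OF near_transfer_Ws[OF xy(1) zH z(1)]]) (use small[of A.hol_const "dist x z"] A.hol_const_pos z in auto)
    moreover have "near (2 * e) (transfer z) (transfer y)"
      by (rule near_mono[OF near_transfer_Wu[OF xy(2) zH z(2)]]) (use small[of R.A.hol_const "dist y z"] R.A.hol_const_pos z in auto)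
    ultimately have "near ((1 + 2 * e) ^ 2 - 1) (transfer x) (transfer y)"
      by (intro near_trans[OF near_sym])
    moreover have "(1 + 2 * e) ^ 2 - 1 \<le> 8 * e"
      using mult_right_mono[of e 1 e] e0 e8 by (simp add: power2_eq_square algebra_simps)
    ultimately have "near (8 * e) (transfer x) (transfer y)" by (rule near_mono)
    then show "8 * c * dist x y powr \<nu> \<le> 1 \<and> near (8 * c * dist x y powr \<nu>) (transfer x) (transfer y)"
      using e8 by (simp add: e_def mult.assoc)
  qed
qed

text \<open>With index i + 1 at \<open>f x\<close>, the transports start from the same points as for
  \<open>x\<close> and are one step longer; the relation between them passes to the limit.\<close>

lemma transfer_f:
  assumes "x \<in> hyp.Hom p"
  shows "transfer (f x) ** B x = A x ** \<alpha> (transfer x)"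
proof -
  obtain i where i: "hyp.Us p i x" using assms by (auto simp: hyp.Hom_def)
  let ?S = "\<lambda>N. Phi A B (i + k * N) ((g ^^ (i + k * N)) x) (Q p)"
  have fx: "f x \<in> hyp.Hom p" by (rule hyp.Hom_f[OF period k_pos assms])
  have "Phi A B (Suc i + k * N) ((g ^^ (Suc i + k * N)) (f x)) (Q p) = A x ** \<alpha> (?S N) ** matrix_inv (B x)" for N
  proof -
    have gx: "(g ^^ (Suc i + k * N)) (f x) = (g ^^ (i + k * N)) x"
      by (simp add: funpow_swap1)
    have "Phi A B ((i + k * N) + 1) ((g ^^ (i + k * N)) x) (Q p) =
        Phi A B 1 ((f ^^ (i + k * N)) ((g ^^ (i + k * N)) x)) (?S N)"
      by (rule Phi_add[OF inv_AB inv_Q])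
    then show ?thesis
      unfolding gx by (simp add: Phi_def twisted_prod_1[OF A.inv_A, simplified] twisted_prod_1[OF B.inv_A, simplified])
  qed
  then have "(\<lambda>N. A x ** \<alpha> (?S N) ** matrix_inv (B x)) \<longlonglongrightarrow> transfer (f x)"
    using transfer_limits(1)[OF fx hyp.Us_f[OF i]] by simp
  moreover have "(\<lambda>N. A x ** \<alpha> (?S N) ** matrix_inv (B x)) \<longlonglongrightarrow> A x ** \<alpha> (transfer x) ** matrix_inv (B x)"
    by (intro tendsto_matrix_mult tendsto_const A.tendsto_\<alpha> transfer_limits(1)[OF assms i]
        inv_Phi[OF inv_AB inv_Q] transfer_limits(3)[OF assms])
  ultimately have "transfer (f x) = A x ** \<alpha> (transfer x) ** matrix_inv (B x)"
    by (rule LIMSEQ_unique)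
  then show ?thesis by (simp add: matrix_inv_cancel B.inv_A)
qed

context
  assumes trans: "\<And>U V :: 'a set. \<lbrakk>open U; open V; U \<noteq> {}; V \<noteq> {}\<rbrakk> \<Longrightarrow> \<exists>n. (f ^^ n) ` U \<inter> V \<noteq> {}"
begin

text \<open>Every homoclinic point is \<delta>-close to one of finitely many, and nearness with
  constant at most 1 changes the norms of a matrix and of its inverse by a factor of at most
  4.\<close>

lemma transfer_bounded:
  obtains R where "0 < R" "\<And>x. x \<in> hyp.Hom p \<Longrightarrow> opnorm (transfer x) \<le> R"
    "\<And>x. x \<in> hyp.Hom p \<Longrightarrow> opnorm (matrix_inv (transfer x)) \<le> R"
proof -
  obtain M \<delta> where M: "0 < M" "0 < \<delta>"
    "\<And>x y. \<lbrakk>x \<in> hyp.Hom p; y \<in> hyp.Hom p; dist x y \<le> \<delta>\<rbrakk> \<Longrightarrow>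
      M * dist x y powr \<nu> \<le> 1 \<and> near (M * dist x y powr \<nu>) (transfer x) (transfer y)"
    by (rule near_transfer) (rule that)
  have "0 < \<delta> / 2" using M by simp
  then obtain X where X: "finite X" "(UNIV :: 'a set) \<subseteq> (\<Union>x\<in>X. ball x (\<delta> / 2))"
    using hyp.compact_UNIV unfolding compact_eq_totally_bounded by blast
  have "\<exists>h. \<forall>x. h x \<in> hyp.Hom p \<and> dist x (h x) < \<delta> / 2"
    by (rule choice, rule allI) (use hyp.Hom_dense[OF trans \<open>0 < \<delta> / 2\<close>, of p] in blast)
  then obtain h where h: "\<And>x. h x \<in> hyp.Hom p" "\<And>x. dist x (h x) < \<delta> / 2" by blast
  define w where "w x = opnorm (transfer (h x)) + opnorm (matrix_inv (transfer (h x)))" for x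
  have w0: "0 \<le> w x" for x by (simp add: w_def opnorm_nonneg)
  have "opnorm (transfer x) \<le> 4 * sum w X + 1 \<and> opnorm (matrix_inv (transfer x)) \<le> 4 * sum w X + 1"
    if x: "x \<in> hyp.Hom p" for x
  proof -
    have "x \<in> (\<Union>y\<in>X. ball y (\<delta> / 2))" using X(2) by blast
    then obtain y where y: "y \<in> X" "dist y x < \<delta> / 2" by (auto simp: mem_ball)
    have "dist x (h y) \<le> \<delta>" using y(2) h(2)[of y] dist_triangle[of x "h y" y] by (simp add: dist_commute)
    note n = M(3)[OF x h(1) this]
    have "w y \<le> sum w X" using y(1) X(1) w0 by (intro member_le_sum) auto
    then have "4 * opnorm (transfer (h y)) \<le> 4 * sum w X + 1" "4 * opnorm (matrix_inv (transfer (h y))) \<le> 4 * sum w X + 1"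
      using opnorm_nonneg[of "transfer (h y)"] opnorm_nonneg[of "matrix_inv (transfer (h y))"]
      unfolding w_def[of y] by linarith+
    then show ?thesis
      using near_bounds(1,2)[OF conjunct2[OF n] transfer_limits(3)[OF h(1)] conjunct1[OF n]] by linarith
  qed
  moreover have "0 < 4 * sum w X + 1" using sum_nonneg[of X w] w0 by (simp add: add_nonneg_pos)
  ultimately show ?thesis by (intro that[of "4 * sum w X + 1"]) auto
qed

text \<open>\<open>near_transfer\<close> handles close pairs, boundedness the others.\<close>

lemma transfer_holder:
  obtains M where "0 < M" "\<And>x y. \<lbrakk>x \<in> hyp.Hom p; y \<in> hyp.Hom p\<rbrakk> \<Longrightarrow>
    opnorm (transfer x - transfer y) \<le> M * dist x y powr \<nu>"
proof -
  obtain M \<delta> where M: "0 < M" "0 < \<delta>"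
    "\<And>x y. \<lbrakk>x \<in> hyp.Hom p; y \<in> hyp.Hom p; dist x y \<le> \<delta>\<rbrakk> \<Longrightarrow>
      M * dist x y powr \<nu> \<le> 1 \<and> near (M * dist x y powr \<nu>) (transfer x) (transfer y)"
    by (rule near_transfer) (rule that)
  obtain R where R: "0 < R" "\<And>x. x \<in> hyp.Hom p \<Longrightarrow> opnorm (transfer x) \<le> R"
    "\<And>x. x \<in> hyp.Hom p \<Longrightarrow> opnorm (matrix_inv (transfer x)) \<le> R"
    by (rule transfer_bounded) (rule that)
  define M' where "M' = 3 * M * R + 2 * R / \<delta> powr \<nu>"
  have pos: "0 < 3 * M * R" "0 < 2 * R / \<delta> powr \<nu>" using M R by simp_all
  show ?thesis
  proof
    show "0 < M'" using pos by (simp add: M'_def)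
    fix x y assume xy: "x \<in> hyp.Hom p" "y \<in> hyp.Hom p"
    show "opnorm (transfer x - transfer y) \<le> M' * dist x y powr \<nu>"
    proof (cases "dist x y \<le> \<delta>")
      case True
      note n = M(3)[OF xy True]
      have "opnorm (transfer x - transfer y) \<le> 3 * (M * dist x y powr \<nu>) * opnorm (transfer y)"
        by (rule near_bounds(3)[OF conjunct2[OF n] transfer_limits(3)[OF xy(2)] conjunct1[OF n]])
      also have "\<dots> \<le> 3 * (M * dist x y powr \<nu>) * R"
        using M(1) R(2)[OF xy(2)] by (intro mult_left_mono) auto
      also have "\<dots> = (3 * M * R) * dist x y powr \<nu>" by simp
      also have "\<dots> \<le> M' * dist x y powr \<nu>"
        using pos by (intro mult_right_mono) (auto simp: M'_def)
      finally show ?thesis .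
    next
      case False
      have "opnorm (transfer x - transfer y) \<le> opnorm (transfer x) + opnorm (transfer y)"
        using opnorm_triangle[of "transfer x" "- transfer y"] by (simp add: opnorm_uminus)
      also have "\<dots> \<le> 2 * R" using R(2)[OF xy(1)] R(2)[OF xy(2)] by simp
      also have "\<dots> = (2 * R / \<delta> powr \<nu>) * \<delta> powr \<nu>" using M by simp
      also have "\<dots> \<le> M' * dist x y powr \<nu>"
        using False M pos \<nu>_pos by (intro mult_mono powr_mono2) (auto simp: M'_def)
      finally show ?thesis .
    qed
  qed
qed

theorem livsic:
  obtains P M where "0 < M" "\<And>x. invertible (P x)"
    "\<And>x y. opnorm (P x - P y) \<le> M * dist x y powr \<nu>"
    "\<And>x. P (f x) ** B x = A x ** \<alpha> (P x)"
proof -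
  obtain M where M: "0 < M" "\<And>x y. \<lbrakk>x \<in> hyp.Hom p; y \<in> hyp.Hom p\<rbrakk> \<Longrightarrow>
    opnorm (transfer x - transfer y) \<le> M * dist x y powr \<nu>"
    by (rule transfer_holder) (rule that)
  obtain R where R: "\<And>x. x \<in> hyp.Hom p \<Longrightarrow> opnorm (matrix_inv (transfer x)) \<le> R"
    by (rule transfer_bounded) (rule that)
  have dense: "closure (hyp.Hom p) = UNIV"
    using hyp.Hom_dense[OF trans] by (auto simp: closure_approachable dist_commute)
  obtain P where P: "\<And>x. x \<in> hyp.Hom p \<Longrightarrow> P x = transfer x" "\<And>x. invertible (P x)" "continuous_on UNIV P"
    "\<And>x y. opnorm (P x - P y) \<le> M * dist x y powr \<nu>"
    by (rule holder_extension[OF \<nu>_pos less_imp_le[OF M(1)] dense transfer_limits(3) R M(2)]) (assumption+, rule that)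
  have "P (f x) ** B x = A x ** \<alpha> (P x)" for x
  proof -
    have "x \<in> closure (hyp.Hom p)" by (simp add: dense)
    then obtain u where u: "\<And>n. u n \<in> hyp.Hom p" "u \<longlonglongrightarrow> x" unfolding closure_sequential by blast
    have D: "(\<lambda>n. dist (u n) x powr \<nu>) \<longlonglongrightarrow> 0"
      using tendsto_powr'[OF tendsto_dist[OF u(2) tendsto_const[of x]] tendsto_const[of \<nu>]] \<nu>_pos by simp
    have lim_P: "(\<lambda>n. P (v n)) \<longlonglongrightarrow> P y" if "v \<longlonglongrightarrow> y" for v y
      using continuous_on_tendsto_compose[OF P(3) that] by simp
    have "(\<lambda>n. f (u n)) \<longlonglongrightarrow> f x"
      using continuous_on_tendsto_compose[OF hyp.continuous_f u(2)] by simp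
    then have "(\<lambda>n. P (f (u n)) ** B (u n)) \<longlonglongrightarrow> P (f x) ** B x"
      by (intro tendsto_matrix_mult lim_P B.tendsto_A D)
    moreover have "(\<lambda>n. A (u n) ** \<alpha> (P (u n))) \<longlonglongrightarrow> A x ** \<alpha> (P x)"
      by (intro tendsto_matrix_mult A.tendsto_\<alpha> A.tendsto_A D lim_P u P(2))
    moreover have "P (f (u n)) ** B (u n) = A (u n) ** \<alpha> (P (u n))" for n
      using transfer_f[OF u(1)] by (simp only: P(1)[OF u(1)] P(1)[OF hyp.Hom_f[OF period k_pos u(1)]])
    ultimately show ?thesis using LIMSEQ_unique by fastforce
  qed
  then show ?thesis by (rule that[OF M(1) P(2,4)])
qed

end

end

section \<open>Integer iterates and the theorem\<close>

lemma iter_on_nat: "iter_on S h (int n) = h ^^ n"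
  by (simp add: iter_on_def)

lemma iter_on_neg_nat: "iter_on S h (- int n) = inv_into S h ^^ n"
  by (cases "n = 0") (simp_all add: iter_on_def)

lemma mem_stable_set: "y \<in> stable_set f \<epsilon> x \<longleftrightarrow> (\<forall>n. dist ((f ^^ n) x) ((f ^^ n) y) \<le> \<epsilon>)"
proof -
  have "(\<forall>n\<ge>0. R n) \<longleftrightarrow> (\<forall>n::nat. R (int n))" for R :: "int \<Rightarrow> bool"
    by (metis nonneg_int_cases of_nat_0_le_iff)
  then show ?thesis by (simp add: stable_set_def iter_on_nat)
qed

lemma mem_unstable_set:
  "y \<in> unstable_set f \<epsilon> x \<longleftrightarrow> (\<forall>n. dist ((inv_into UNIV f ^^ n) x) ((inv_into UNIV f ^^ n) y) \<le> \<epsilon>)"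
proof -
  have "(\<forall>n\<le>0. R n) \<longleftrightarrow> (\<forall>n::nat. R (- int n))" for R :: "int \<Rightarrow> bool"
    by (metis nonpos_int_cases neg_le_0_iff_le of_nat_0_le_iff)
  then show ?thesis by (simp add: unstable_set_def iter_on_neg_nat)
qed

lemma holder_tendsto:
  fixes A :: "'a::metric_space \<Rightarrow> real ^ 'n ^ 'n"
  assumes "0 < \<nu>" "\<And>x y. opnorm (A x - A y) \<le> c * dist x y powr \<nu>" "u \<longlonglongrightarrow> x"
  shows "(\<lambda>n. A (u n)) \<longlonglongrightarrow> A x"
proof (rule tendsto_opnormI)
  have "(\<lambda>n. dist (u n) x powr \<nu>) \<longlonglongrightarrow> 0"
    using tendsto_powr'[OF tendsto_dist[OF assms(3) tendsto_const[of x]] tendsto_const[of \<nu>]] assms(1) by simp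
  from tendsto_mult_right_zero[OF this, of c]
  show "(\<lambda>n. opnorm (A (u n) - A x)) \<longlonglongrightarrow> 0"
    by (rule tendsto_sandwich[of "\<lambda>_. 0", rotated -1]) (auto simp: assms(2) opnorm_nonneg)
qed

lemma twisted_iso_GL:
  fixes \<alpha> :: "real ^ 'n ^ 'n \<Rightarrow> real ^ 'n ^ 'n"
  assumes \<alpha>: "\<alpha> \<in> iso GL GL" and fg: "\<And>x. f (g x) = x" "\<And>x. g (f x) = x"
  shows "twisted f g \<alpha> (inv_into (carrier GL) \<alpha>)"
proof -
  have bij: "bij_betw \<alpha> (carrier GL) (carrier GL)" and hom: "\<alpha> \<in> hom GL GL"
    using \<alpha> by (auto simp: iso_def)
  have GL: "T \<in> carrier GL \<longleftrightarrow> invertible T" for T :: "real ^ 'n ^ 'n"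
    by (simp add: GL_def)
  show ?thesis
  proof
    show "f (g x) = x" "g (f x) = x" for x by (rule fg)+
    show "invertible (\<alpha> T)" if "invertible T" for T
      using bij_betwE[OF bij] that by (simp add: GL)
    show "invertible (inv_into (carrier GL) \<alpha> T)" if "invertible T" for T
      using bij_betwE[OF bij_betw_inv_into[OF bij]] that by (simp add: GL)
    show "\<alpha> (inv_into (carrier GL) \<alpha> T) = T" if "invertible T" for T
      using bij_betw_inv_into_right[OF bij] that by (simp add: GL)
    show "inv_into (carrier GL) \<alpha> (\<alpha> T) = T" if "invertible T" for T
      using bij_betw_inv_into_left[OF bij] that by (simp add: GL)
    show "\<alpha> (S ** T) = \<alpha> S ** \<alpha> T" if "invertible S" "invertible T" for S T
      using hom that by (simp add: hom_def GL_def)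
  qed
qed

section \<open>From the equation for the generators to all integer times\<close>

context twisted
begin

context
  fixes A B P :: "'a \<Rightarrow> real ^ 'n ^ 'n"
  assumes inv_A: "\<And>x. invertible (A x)" and inv_B: "\<And>x. invertible (B x)"
    and inv_P: "\<And>x. invertible (P x)" and cohomology: "\<And>x. P (f x) ** B x = A x ** \<alpha> (P x)"
begin

lemma twisted_prod_cohomology:
  "P ((f ^^ n) x) ** twisted_prod f \<alpha> B n x = twisted_prod f \<alpha> A n x ** (\<alpha> ^^ n) (P x)"
proof (induction n)
  case 0
  show ?case by (simp add: inv_A inv_B)
next
  case (Suc n)
  let ?y = "(f ^^ n) x"
  have "twisted_prod f \<alpha> A (Suc n) x ** (\<alpha> ^^ Suc n) (P x) =
      A ?y ** \<alpha> (twisted_prod f \<alpha> A n x ** (\<alpha> ^^ n) (P x))"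
    by (simp add: twisted_prod_Suc inv_A \<alpha>_mult inv_twisted_prod pow_inv inv_P matrix_mul_assoc)
  also have "\<dots> = A ?y ** \<alpha> (P ?y ** twisted_prod f \<alpha> B n x)"
    by (simp only: Suc)
  also have "\<dots> = (A ?y ** \<alpha> (P ?y)) ** \<alpha> (twisted_prod f \<alpha> B n x)"
    by (simp add: \<alpha>_mult inv_twisted_prod inv_B inv_P matrix_mul_assoc)
  also have "\<dots> = P (f ?y) ** twisted_prod f \<alpha> B (Suc n) x"
    by (simp only: cohomology[symmetric]) (simp add: twisted_prod_Suc inv_B matrix_mul_assoc)
  finally show ?case by simp
qed

end

end

context
  fixes f :: "'a \<Rightarrow> 'a" and \<alpha> :: "real ^ 'n ^ 'n \<Rightarrow> real ^ 'n ^ 'n"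
  assumes tw: "twisted f (inv_into UNIV f) \<alpha> (inv_into (carrier GL) \<alpha>)"
begin

interpretation twisted f "inv_into UNIV f" \<alpha> "inv_into (carrier GL) \<alpha>"
  by (rule tw)

lemma cocycle_nat: "cocycle f \<alpha> A (int n) x = twisted_prod f \<alpha> A n x"
  by (simp add: cocycle_def)

lemma cocycle_neg_nat:
  assumes "\<And>x. invertible (A x)"
  shows "cocycle f \<alpha> A (- int n) x =
    (inv_into (carrier GL) \<alpha> ^^ n) (matrix_inv (twisted_prod f \<alpha> A n ((inv_into UNIV f ^^ n) x)))"
proof (cases n)
  case 0
  then show ?thesis by (simp add: cocycle_def assms matrix_inv_mat_1)
next
  case (Suc m)
  then have "\<not> - int n \<ge> 0" "nat (- (- int n)) = n" by simp_all
  then show ?thesis unfolding cocycle_def iter_on_neg_nat by simp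
qed

lemma cocycle_cohomology:
  assumes inv_A: "\<And>x. invertible (A x)" and inv_B: "\<And>x. invertible (B x)"
    and inv_P: "\<And>x. invertible (P x)" and cohomology: "\<And>x. P (f x) ** B x = A x ** \<alpha> (P x)"
  shows "cocycle f \<alpha> A n x = P (iter f n x) ** cocycle f \<alpha> B n x ** matrix_inv (aut_iter \<alpha> n (P x))"
proof -
  note [simp] = inv_A inv_B inv_P inv_twisted_prod pow_inv rev.pow_inv invertible_mult invertible_matrix_inv
  note coh = twisted_prod_cohomology[of A B P, OF inv_A inv_B inv_P cohomology]
  show ?thesis
  proof (cases n rule: int_cases2)
    case (nonneg m)
    then show ?thesis
      by (simp add: cocycle_nat iter_on_nat coh matrix_inv_cancel)
  next
    case (nonpos m)
    \<comment> \<open>The forward identity from \<open>?y\<close> to \<open>x\<close> is inverted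
      and pulled back by the m-th iterate of \<open>?\<beta>\<close>.\<close>
    let ?y = "(inv_into UNIV f ^^ m) x" and ?\<beta> = "inv_into (carrier GL) \<alpha>"
    let ?a = "twisted_prod f \<alpha> A m ?y" and ?b = "twisted_prod f \<alpha> B m ?y"
    have "?a = P x ** ?b ** matrix_inv ((\<alpha> ^^ m) (P ?y))"
      using coh[of m ?y] by (simp add: matrix_inv_cancel)
    then have "matrix_inv ?a = (\<alpha> ^^ m) (P ?y) ** matrix_inv ?b ** matrix_inv (P x)"
      by (simp add: matrix_inv_mult matrix_inv_matrix_inv matrix_mul_assoc)
    then have "(?\<beta> ^^ m) (matrix_inv ?a) = P ?y ** (?\<beta> ^^ m) (matrix_inv ?b) ** matrix_inv ((?\<beta> ^^ m) (P x))"
      by (simp add: rev.pow_mult rev.pow_cancel rev.pow_matrix_inv)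
    then show ?thesis
      unfolding nonpos by (simp add: cocycle_neg_nat iter_on_neg_nat)
  qed
qed

text \<open>The two norm bounds are condition (i) at the times n and -n, the latter taken at
  \<open>(f ^^ n) x\<close>. The bounds on \<open>dev\<close> are condition (ii) with the identity
  as second matrix.\<close>

lemma bunching_conditions_nat:
  assumes inv_A: "\<And>x. invertible (A x)" and bc: "bunching_conditions f \<alpha> A K \<rho> \<theta>"
  shows "opnorm ((inv_into (carrier GL) \<alpha> ^^ n) (twisted_prod f \<alpha> A n x)) *
      opnorm ((inv_into (carrier GL) \<alpha> ^^ n) (matrix_inv (twisted_prod f \<alpha> A n x))) \<le> K * exp (\<theta> * real n)"
    and "opnorm (twisted_prod f \<alpha> A n x) * opnorm (matrix_inv (twisted_prod f \<alpha> A n x)) \<le> K * exp (\<theta> * real n)"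
    and "invertible S \<Longrightarrow> dev ((\<alpha> ^^ n) S) \<le> K * exp (\<rho> * real n) * dev S"
    and "invertible S \<Longrightarrow> dev ((inv_into (carrier GL) \<alpha> ^^ n) S) \<le> K * exp (\<rho> * real n) * dev S"
proof -
  note [simp] = inv_A inv_twisted_prod pow_inv rev.pow_inv invertible_matrix_inv invertible_mat_1
  have i: "opnorm (aut_iter \<alpha> (- l) (cocycle f \<alpha> A l x)) * opnorm (aut_iter \<alpha> (- l) (matrix_inv (cocycle f \<alpha> A l x)))
      < K * exp (\<theta> * real_of_int \<bar>l\<bar>)" for l x
    using bc unfolding bunching_conditions_def by blast
  have ii: "opnorm (aut_iter \<alpha> l S - aut_iter \<alpha> l (mat 1)) \<le> K * exp (\<rho> * real_of_int \<bar>l\<bar>) * opnorm (S - mat 1)"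
    if "invertible S" for l S
    using bc that unfolding bunching_conditions_def by (simp add: GL_def)
  show "opnorm ((inv_into (carrier GL) \<alpha> ^^ n) (twisted_prod f \<alpha> A n x)) *
      opnorm ((inv_into (carrier GL) \<alpha> ^^ n) (matrix_inv (twisted_prod f \<alpha> A n x))) \<le> K * exp (\<theta> * real n)"
    using i[of "int n" x] by (simp add: cocycle_nat iter_on_neg_nat)
  show "opnorm (twisted_prod f \<alpha> A n x) * opnorm (matrix_inv (twisted_prod f \<alpha> A n x)) \<le> K * exp (\<theta> * real n)"
    using i[of "- int n" "(f ^^ n) x"]
    by (simp add: cocycle_neg_nat iter_on_nat pow_cancel rev.pow_matrix_inv matrix_inv_matrix_inv pow_matrix_inv mult.commute)
  show "dev ((\<alpha> ^^ n) S) \<le> K * exp (\<rho> * real n) * dev S" if "invertible S"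
    using ii[OF that, of "int n"] by (simp add: iter_on_nat pow_one dev_def)
  show "dev ((inv_into (carrier GL) \<alpha> ^^ n) S) \<le> K * exp (\<rho> * real n) * dev S" if "invertible S"
    using ii[OF that, of "- int n"] by (simp add: iter_on_neg_nat rev.pow_one dev_def)
qed

end

text \<open>The condition number bounds a product of norms; by compactness the norm of
  \<open>A\<close> has a positive minimum, and dividing by it bounds the inverse.\<close>

lemma bounded_inverse:
  fixes A :: "'a::metric_space \<Rightarrow> real ^ 'n ^ 'n"
  assumes "compact (UNIV :: 'a set)" "0 < \<nu>"
    and holder: "\<And>x y. opnorm (A x - A y) \<le> c * dist x y powr \<nu>"
    and inv_A: "\<And>x. invertible (A x)"
    and cond: "\<And>x. opnorm (A x) * opnorm (matrix_inv (A x)) \<le> K"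
  obtains R where "\<And>x. opnorm (matrix_inv (A x)) \<le> R"
proof -
  have "continuous_on UNIV (\<lambda>x. opnorm (A x))"
    unfolding continuous_on_sequentially comp_def
    by (auto intro: tendsto_opnorm holder_tendsto[OF assms(2) holder])
  then obtain y where y: "\<And>x. opnorm (A y) \<le> opnorm (A x)"
    using continuous_attains_inf[OF assms(1)] by (metis UNIV_I UNIV_not_empty)
  have "1 \<le> opnorm (A y) * opnorm (matrix_inv (A y))"
    using opnorm_mult[of "A y" "matrix_inv (A y)"]
    by (simp add: invertible_matrix_inv[OF inv_A] opnorm_mat_1)
  then have pos: "0 < opnorm (A y)"
    using opnorm_nonneg[of "A y"] by (cases "opnorm (A y) = 0") auto
  show ?thesis
  proof
    fix x
    have "opnorm (A y) * opnorm (matrix_inv (A x)) \<le> K"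
      using mult_right_mono[OF y opnorm_nonneg] cond[of x] by (rule order_trans)
    then show "opnorm (matrix_inv (A x)) \<le> K / opnorm (A y)"
      using pos by (simp add: field_simps)
  qed
qed

theorem corollary1p2:
  fixes f :: "'a::metric_space \<Rightarrow> 'a"
    and A B :: "'a \<Rightarrow> real ^ 'n ^ 'n"
    and \<alpha> :: "real ^ 'n ^ 'n \<Rightarrow> real ^ 'n ^ 'n"
    and C \<epsilon> lam \<tau> \<nu> :: real
  assumes "compact (UNIV :: 'a set)"
    and "hyperbolic_homeo f C \<epsilon> lam \<tau>"
    and "\<exists>L. L-lipschitz_on UNIV f"
    and "transitive f"
    and "\<nu> > 0"
    and "holder_GL \<nu> A" and "holder_GL \<nu> B"
    and "\<alpha> \<in> iso GL GL"
    and "fiber_bunched f \<alpha> A \<nu> lam" and "fiber_bunched f \<alpha> B \<nu> lam"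
    and "\<exists>D\<in>{A, B}. \<exists>K>0. \<exists>\<rho>>0. \<exists>\<theta>>0.
           7 * \<rho> + 2 * \<theta> < \<nu> * lam \<and> bunching_conditions f \<alpha> D K \<rho> \<theta>"
  shows "(\<exists>Q. holder_GL \<nu> Q \<and>
            (\<forall>n. \<forall>p\<in>Fix (iter f n).
               cocycle f \<alpha> A n p =
                 Q p ** cocycle f \<alpha> B n p ** matrix_inv (aut_iter \<alpha> n (Q p))))
     \<longleftrightarrow> (\<exists>P. holder_GL \<nu> P \<and>
            (\<forall>x n.
               cocycle f \<alpha> A n x =
                 P (iter f n x) ** cocycle f \<alpha> B n x ** matrix_inv (aut_iter \<alpha> n (P x))))"
proof
  assume "\<exists>P. holder_GL \<nu> P \<and>
    (\<forall>x n. cocycle f \<alpha> A n x = P (iter f n x) ** cocycle f \<alpha> B n x ** matrix_inv (aut_iter \<alpha> n (P x)))"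
  then obtain P where P: "holder_GL \<nu> P"
    "\<And>x n. cocycle f \<alpha> A n x = P (iter f n x) ** cocycle f \<alpha> B n x ** matrix_inv (aut_iter \<alpha> n (P x))"
    by blast
  have "cocycle f \<alpha> A n p = P p ** cocycle f \<alpha> B n p ** matrix_inv (aut_iter \<alpha> n (P p))"
    if "p \<in> Fix (iter f n)" for n p
    using P(2)[of n p] that by (simp add: Fix_def)
  with P(1) show "\<exists>Q. holder_GL \<nu> Q \<and> (\<forall>n. \<forall>p\<in>Fix (iter f n).
      cocycle f \<alpha> A n p = Q p ** cocycle f \<alpha> B n p ** matrix_inv (aut_iter \<alpha> n (Q p)))"
    by blast
next
  let ?g = "inv_into UNIV f" and ?\<beta> = "inv_into (carrier GL) \<alpha>"
  assume "\<exists>Q. holder_GL \<nu> Q \<and> (\<forall>n. \<forall>p\<in>Fix (iter f n).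
      cocycle f \<alpha> A n p = Q p ** cocycle f \<alpha> B n p ** matrix_inv (aut_iter \<alpha> n (Q p)))"
  then obtain Q where Q: "holder_GL \<nu> Q" "\<And>n p. p \<in> Fix (iter f n) \<Longrightarrow>
      cocycle f \<alpha> A n p = Q p ** cocycle f \<alpha> B n p ** matrix_inv (aut_iter \<alpha> n (Q p))"
    by blast
  have inv: "invertible (A x)" "invertible (B x)" "invertible (Q x)" for x
    using assms(6,7) Q(1) by (simp_all add: holder_GL_def GL_def)
  obtain cA where cA: "cA > 0" "\<And>x y. opnorm (A x - A y) \<le> cA * dist x y powr \<nu>"
    using assms(6) by (auto simp: holder_GL_def)
  obtain cB where cB: "cB > 0" "\<And>x y. opnorm (B x - B y) \<le> cB * dist x y powr \<nu>"
    using assms(7) by (auto simp: holder_GL_def)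
  obtain cQ where cQ: "cQ > 0" "\<And>x y. opnorm (Q x - Q y) \<le> cQ * dist x y powr \<nu>"
    using Q(1) by (auto simp: holder_GL_def)
  note hyp = assms(2)[unfolded hyperbolic_homeo_def]
  have homeo: "homeomorphism UNIV UNIV f ?g" and pos: "C > 0" "\<epsilon> > 0" "lam > 0" "\<tau> > 0"
    using hyp by blast+
  have fg: "f (?g x) = x" "?g (f x) = x" for x
    using homeo by (simp_all add: homeomorphism_def)
  obtain L where L: "L-lipschitz_on UNIV f" using assms(3) by blast
  define br where "br x y = (THE z. z \<in> stable_set f \<epsilon> x \<inter> unstable_set f \<epsilon> y)" for x y
  have br: "br x y \<in> stable_set f \<epsilon> x \<inter> unstable_set f \<epsilon> y"
    "z \<in> stable_set f \<epsilon> x \<inter> unstable_set f \<epsilon> y \<Longrightarrow> z = br x y" if "dist x y \<le> \<tau>" for x y z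
  proof -
    have ex1: "\<exists>!z. z \<in> stable_set f \<epsilon> x \<inter> unstable_set f \<epsilon> y" using hyp that by blast
    show "br x y \<in> stable_set f \<epsilon> x \<inter> unstable_set f \<epsilon> y" unfolding br_def by (rule theI'[OF ex1])
    show "z = br x y" if "z \<in> stable_set f \<epsilon> x \<inter> unstable_set f \<epsilon> y"
      unfolding br_def by (rule the1_equality[OF ex1 that, symmetric])
  qed
  interpret H: hyperbolic f ?g "max C 1" \<epsilon> lam \<tau> "max L 1" "\<lambda>x y. y \<in> stable_set f \<epsilon> x"
    "\<lambda>x y. y \<in> unstable_set f \<epsilon> x" br
  proof
    fix x y z :: 'a and n :: nat
    show "y \<in> stable_set f \<epsilon> x \<longleftrightarrow> (\<forall>n. dist ((f ^^ n) x) ((f ^^ n) y) \<le> \<epsilon>)" by (rule mem_stable_set)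
    show "y \<in> unstable_set f \<epsilon> x \<longleftrightarrow> (\<forall>n. dist ((?g ^^ n) x) ((?g ^^ n) y) \<le> \<epsilon>)" by (rule mem_unstable_set)
    show "compact (UNIV :: 'a set)" by (rule assms(1))
    show "f (?g x) = x" "?g (f x) = x" by (rule fg)+
    show "1 \<le> max C 1" "0 < \<epsilon>" "0 < lam" "0 < \<tau>" "1 \<le> max L 1" using pos by auto
    have "dist (f x) (f y) \<le> L * dist x y" by (rule lipschitz_onD[OF L]) auto
    also have "\<dots> \<le> max L 1 * dist x y" by (intro mult_right_mono) auto
    finally show "dist (f x) (f y) \<le> max L 1 * dist x y" .
    have max_C: "d \<le> max C 1 * e * dist x y" if "d \<le> C * e * dist x y" "0 \<le> e" for d e
      using that by (elim order_trans) (intro mult_right_mono, auto)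
    show "dist ((f ^^ n) x) ((f ^^ n) y) \<le> max C 1 * exp (- lam * real n) * dist x y" if "y \<in> stable_set f \<epsilon> x"
    proof (rule max_C)
      have x: "x \<in> stable_set f \<epsilon> x" using pos by (simp add: mem_stable_set)
      have "\<forall>n\<ge>0. dist (iter f n x) (iter f n y) \<le> C * exp (- lam * real_of_int n) * dist x y"
        using hyp x that by blast
      then show "dist ((f ^^ n) x) ((f ^^ n) y) \<le> C * exp (- lam * real n) * dist x y"
        by (auto dest!: spec[of _ "int n"] simp: iter_on_nat)
    qed simp
    show "dist ((?g ^^ n) x) ((?g ^^ n) y) \<le> max C 1 * exp (- lam * real n) * dist x y" if "y \<in> unstable_set f \<epsilon> x"
    proof (rule max_C)
      have x: "x \<in> unstable_set f \<epsilon> x" using pos by (simp add: mem_unstable_set)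
      have "\<forall>n\<ge>0. dist (iter f (- n) x) (iter f (- n) y) \<le> C * exp (- lam * real_of_int n) * dist x y"
        using hyp x that by blast
      then show "dist ((?g ^^ n) x) ((?g ^^ n) y) \<le> C * exp (- lam * real n) * dist x y"
        by (auto dest!: spec[of _ "int n"] simp: iter_on_neg_nat)
    qed simp
    show "br x y \<in> stable_set f \<epsilon> x \<and> br x y \<in> unstable_set f \<epsilon> y" if "dist x y \<le> \<tau>"
      using br(1)[OF that] by blast
    show "z = br x y" if "dist x y \<le> \<tau>" "z \<in> stable_set f \<epsilon> x" "z \<in> unstable_set f \<epsilon> y"
      using br(2)[OF that(1)] that(2,3) by blast
    show "continuous_on {(x, y). dist x y \<le> \<tau>} (\<lambda>(x, y). br x y)"
      unfolding br_def using hyp by blast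
  qed
  have tw: "twisted f ?g \<alpha> ?\<beta>" by (rule twisted_iso_GL[OF assms(8) fg])
  interpret tw: twisted f ?g \<alpha> ?\<beta> by (rule tw)
  obtain CA \<rho> \<theta>A where bA: "CA > 0" "\<rho> > 0" "\<theta>A > 0" "5 * \<rho> + 2 * \<theta>A < \<nu> * lam"
    "bunching_conditions f \<alpha> A CA \<rho> \<theta>A"
    using assms(9) unfolding fiber_bunched_def by blast
  obtain CB \<rho>B \<theta>B where bB: "CB > 0" "\<rho>B > 0" "\<theta>B > 0" "5 * \<rho>B + 2 * \<theta>B < \<nu> * lam"
    "bunching_conditions f \<alpha> B CB \<rho>B \<theta>B"
    using assms(10) unfolding fiber_bunched_def by blast
  note ncA = bunching_conditions_nat[OF tw inv(1) bA(5)]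
  note ncB = bunching_conditions_nat[OF tw inv(2) bB(5)]
  have "opnorm (A x) * opnorm (matrix_inv (A x)) \<le> CA * exp \<theta>A" for x
    using ncA(2)[of 1 x] tw.twisted_prod_1[of A x, OF inv(1)] by simp
  then obtain RA where RA: "\<And>x. opnorm (matrix_inv (A x)) \<le> RA"
    by (rule bounded_inverse[OF assms(1,5) cA(2) inv(1)]) (rule that)
  have "opnorm (B x) * opnorm (matrix_inv (B x)) \<le> CB * exp \<theta>B" for x
    using ncB(2)[of 1 x] tw.twisted_prod_1[of B x, OF inv(2)] by simp
  then obtain RB where RB: "\<And>x. opnorm (matrix_inv (B x)) \<le> RB"
    by (rule bounded_inverse[OF assms(1,5) cB(2) inv(2)]) (rule that)
  \<comment> \<open>\<open>RA * cA\<close> and \<open>RB * cB\<close> are the constants of the ratio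
    estimates in \<open>dev_holder\<close>.\<close>
  define K where "K = Max {1, CA, CB, RA * cA, RB * cB}"
  have K: "1 \<le> K" "CA \<le> K" "CB \<le> K" "RA * cA \<le> K" "RB * cB \<le> K"
    by (simp_all add: K_def)
  define \<theta> where "\<theta> = max \<theta>A \<theta>B"
  have weaken: "u \<le> K * exp (\<theta> * real n)" if "u \<le> k * exp (t * real n)" "k \<le> K" "t \<le> \<theta>" for u k t n
    using that(1)
  proof (rule order_trans)
    show "k * exp (t * real n) \<le> K * exp (\<theta> * real n)"
      using that(2,3) K(1) by (intro mult_mono) (auto intro: mult_right_mono)
  qed
  have weaken': "u \<le> K * v" if "u \<le> k * v" "k \<le> K" "0 \<le> v" for u v k
    using that(1) mult_right_mono[OF that(2,3)] by (rule order_trans)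
  \<comment> \<open>Bunching of A gives \<rho> < \<nu> lam / 5, and either bunching inequality puts
    its own \<theta> below \<nu> lam / 2, so the \<rho> of A is compatible with the larger
    \<theta>.\<close>
  have gap: "\<rho> + \<theta> < \<nu> * lam" using bA bB by (auto simp: \<theta>_def)
  have dev_holder: "dev (matrix_inv (F y) ** F x) \<le> K * dist x y powr \<nu>" "dev (F y ** matrix_inv (F x)) \<le> K * dist x y powr \<nu>"
    if F: "\<And>x. invertible (F x)" "\<And>x. opnorm (matrix_inv (F x)) \<le> r" "r * c \<le> K"
      "\<And>x y. opnorm (F x - F y) \<le> c * dist x y powr \<nu>" for F :: "'a \<Rightarrow> real ^ 'n ^ 'n" and r c x y
  proof -
    have r: "0 \<le> r" using order_trans[OF opnorm_nonneg F(2)] .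
    have le: "opnorm (matrix_inv (F u)) * opnorm (F x - F y) \<le> K * dist x y powr \<nu>" for u
    proof -
      have "opnorm (matrix_inv (F u)) * opnorm (F x - F y) \<le> r * (c * dist x y powr \<nu>)"
        by (intro mult_mono F r opnorm_nonneg)
      then show ?thesis using weaken'[OF _ F(3), of _ "dist x y powr \<nu>"] by (simp add: mult.assoc)
    qed
    show "dev (matrix_inv (F y) ** F x) \<le> K * dist x y powr \<nu>"
      by (rule order_trans[OF dev_diff_le(1)[OF F(1)] le])
    show "dev (F y ** matrix_inv (F x)) \<le> K * dist x y powr \<nu>"
      by (rule order_trans[OF dev_diff_le(2)[OF F(1)]]) (subst opnorm_minus_commute, rule le)
  qed
  obtain p k where p: "0 < k" "(f ^^ k) p = p" by (rule H.periodic_point)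
  have bunchedA: "bunched f ?g \<alpha> ?\<beta> A (\<lambda>x y. dist x y powr \<nu>) K \<rho> \<theta> (\<nu> * lam)"
  proof (intro bunched.intro tw bunched_axioms.intro)
    fix x y :: 'a and n :: nat and S :: "real ^ 'n ^ 'n"
    show "dev (matrix_inv (A y) ** A x) \<le> K * dist x y powr \<nu>" "dev (A y ** matrix_inv (A x)) \<le> K * dist x y powr \<nu>"
      by (rule dev_holder[OF inv(1) RA K(4) cA(2)])+
    show "opnorm ((?\<beta> ^^ n) (twisted_prod f \<alpha> A n x)) * opnorm ((?\<beta> ^^ n) (matrix_inv (twisted_prod f \<alpha> A n x)))
      \<le> K * exp (\<theta> * real n)"
      by (rule weaken[OF ncA(1) K(2)]) (simp add: \<theta>_def)
    show "opnorm (twisted_prod f \<alpha> A n x) * opnorm (matrix_inv (twisted_prod f \<alpha> A n x)) \<le> K * exp (\<theta> * real n)"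
      by (rule weaken[OF ncA(2) K(2)]) (simp add: \<theta>_def)
    show "dev ((\<alpha> ^^ n) S) \<le> K * exp (\<rho> * real n) * dev S" if "invertible S"
      using weaken'[OF ncA(3)[OF that, unfolded mult.assoc] K(2)] by (simp add: dev_nonneg mult.assoc)
    show "dev ((?\<beta> ^^ n) S) \<le> K * exp (\<rho> * real n) * dev S" if "invertible S"
      using weaken'[OF ncA(4)[OF that, unfolded mult.assoc] K(2)] by (simp add: dev_nonneg mult.assoc)
  qed (use inv K(1) bA(2,3) gap in \<open>auto simp: \<theta>_def dist_commute\<close>)
  have bunchedB: "bunched f ?g \<alpha> ?\<beta> B (\<lambda>x y. dist x y powr \<nu>) K \<rho> \<theta> (\<nu> * lam)"
  proof (intro bunched.intro tw bunched_axioms.intro)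
    fix x y :: 'a and n :: nat and S :: "real ^ 'n ^ 'n"
    show "dev (matrix_inv (B y) ** B x) \<le> K * dist x y powr \<nu>" "dev (B y ** matrix_inv (B x)) \<le> K * dist x y powr \<nu>"
      by (rule dev_holder[OF inv(2) RB K(5) cB(2)])+
    show "opnorm ((?\<beta> ^^ n) (twisted_prod f \<alpha> B n x)) * opnorm ((?\<beta> ^^ n) (matrix_inv (twisted_prod f \<alpha> B n x)))
      \<le> K * exp (\<theta> * real n)"
      by (rule weaken[OF ncB(1) K(3)]) (simp add: \<theta>_def)
    show "opnorm (twisted_prod f \<alpha> B n x) * opnorm (matrix_inv (twisted_prod f \<alpha> B n x)) \<le> K * exp (\<theta> * real n)"
      by (rule weaken[OF ncB(2) K(3)]) (simp add: \<theta>_def)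
    \<comment> \<open>Condition (ii) concerns \<alpha> alone, so the rate \<rho> obtained with A
      serves for B.\<close>
    show "dev ((\<alpha> ^^ n) S) \<le> K * exp (\<rho> * real n) * dev S" if "invertible S"
      using bunched.dev_\<alpha>[OF bunchedA that] .
    show "dev ((?\<beta> ^^ n) S) \<le> K * exp (\<rho> * real n) * dev S" if "invertible S"
      using bunched.dev_\<beta>[OF bunchedA that] .
  qed (use inv K(1) bA(2,3) gap in \<open>auto simp: \<theta>_def dist_commute\<close>)
  interpret livsic f ?g "max C 1" \<epsilon> lam \<tau> "max L 1" "\<lambda>x y. y \<in> stable_set f \<epsilon> x"
    "\<lambda>x y. y \<in> unstable_set f \<epsilon> x" br \<alpha> ?\<beta> A B \<nu> K \<rho> \<theta> p k Q cQ
  proof (intro livsic.intro bunched_pair.intro tw bunchedA bunchedB H.hyperbolic_axioms livsic_axioms.intro)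
    \<comment> \<open>The periodic hypothesis says that \<open>Q q\<close> is a fixed point of the
      transport over a period.\<close>
    show "tw.Phi A B n q (Q q) = Q q" if "(f ^^ n) q = q" for n q
    proof -
      have "twisted_prod f \<alpha> A n q = Q q ** twisted_prod f \<alpha> B n q ** matrix_inv ((\<alpha> ^^ n) (Q q))"
        using Q(2)[of q "int n"] that by (simp add: Fix_def iter_on_nat cocycle_nat[OF tw])
      then show ?thesis
        by (simp add: tw.Phi_def matrix_inv_cancel tw.pow_inv tw.inv_twisted_prod inv)
    qed
  qed (use assms(5) p inv cQ in auto)
  have trans: "\<exists>n. (f ^^ n) ` U \<inter> V \<noteq> {}" if "open U" "open V" "U \<noteq> {}" "V \<noteq> {}" for U V :: "'a set"
    using assms(4) that unfolding transitive_def by blast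
  obtain P M where P: "0 < M" "\<And>x. invertible (P x)" "\<And>x y. opnorm (P x - P y) \<le> M * dist x y powr \<nu>"
    "\<And>x. P (f x) ** B x = A x ** \<alpha> (P x)"
    by (rule livsic[OF trans]) (assumption+, rule that)
  have "holder_GL \<nu> P" unfolding holder_GL_def using P by (auto simp: GL_def)
  moreover have "cocycle f \<alpha> A n x = P (iter f n x) ** cocycle f \<alpha> B n x ** matrix_inv (aut_iter \<alpha> n (P x))" for x n
    by (rule cocycle_cohomology[where A = A and B = B and P = P, OF tw inv(1,2) P(2,4)])
  ultimately show "\<exists>P. holder_GL \<nu> P \<and> (\<forall>x n. cocycle f \<alpha> A n x =
      P (iter f n x) ** cocycle f \<alpha> B n x ** matrix_inv (aut_iter \<alpha> n (P x)))"
    by blast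
qed

end
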